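(* Let $R$ be a commutative ring with identity and let $A$ be a symmetric cellular algebra over $R$ with cellular basis $\{C_{S,T}^{\lambda}\mid S,T\in M(\lambda),\ \lambda\in\Lambda\}$ and dual basis $\{D_{S,T}^{\lambda}\mid S,T\in M(\lambda),\ \lambda\in\Lambda\}$ determined by a symmetrizing trace $\tau$. For $\lambda\in\Lambda$ put $x_\lambda=\sum_{S\in M(\lambda)}C_{S,T}^{\lambda}D_{S,T}^{\lambda}$ for some $T\in M(\lambda)$ (this element does not depend on $T$), and let $L(A)=\{\sum_{\lambda\in\Lambda}r_\lambda x_\lambda\mid r_\lambda\in R\}$. Let $Z(A)$ be the center of $A$ and let $H(A)=\{\sum_{\lambda\in\Lambda,\,S,T\in M(\lambda)}C_{S,T}^{\lambda}\,a\,D_{S,T}^{\lambda}\mid a\in A\}$ be the Higman ideal. Then: (1) $L(A)$ is an ideal of $Z(A)$ and contains the Higman ideal $H(A)$. (2) $L(A)$ is independent of the choice of $\tau$; that is, any two symmetrizing traces on $A$ yield (via their respective dual bases of the given cellular basis) the same set $L(A)$. (3) If $R$ is a field, then $\dim_R L(A)$ is not less than the number of isomorphism classes of simple $A$-modules.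
   Context: Symmetric algebra: an associative unital $R$-algebra $A$, finitely generated and free as an $R$-module, with an $R$-bilinear form $f:A\times A\to R$ that is symmetric, associative ($f(ab,c)=f(a,bc)$) and non-degenerate (the determinant of $(f(a_i,a_j))_{i,j}$ is a unit of $R$ for some $R$-basis $\{a_i\}$ of $A$). The map $\tau:A\to R$, $\tau(a)=f(a,1)$, is called a symmetrizing trace. Cellular algebra (Graham–Lehrer) with cell datum $(\Lambda,M,C,i)$: an associative unital $R$-algebra $A$ such that (C1) $\Lambda$ is a finite poset, to each $\lambda\in\Lambda$ is attached a finite nonempty set $M(\lambda)$, and $A$ has an $R$-basis $\{C_{S,T}^{\lambda}\mid S,T\in M(\lambda),\lambda\in\Lambda\}$ (the cellular basis); (C2) $i$ is an $R$-linear anti-automorphism of $A$ with $i^2=\mathrm{id}$ and $i(C_{S,T}^{\lambda})=C_{T,S}^{\lambda}$; (C3) for $\lambda\in\Lambda$, $S,T\in M(\lambda)$ and $a\in A$, $aC_{S,T}^{\lambda}\equiv\sum_{S'\in M(\lambda)}r_a(S',S)C_{S',T}^{\lambda}\pmod{A(<\lambda)}$, where $r_a(S',S)\in R$ is independent of $T$ and $A(<\lambda)$ is the $R$-span of all $C_{S'',T''}^{\mu}$ with $\mu<\lambda$, $S'',T''\in M(\mu)$. A symmetric cellular algebra is an $R$-algebra that is both symmetric and cellular. Given a symmetrizing trace $\tau$, the dual basis $\{D_{S,T}^{\lambda}\}$ is the $R$-basis of $A$ determined by $\tau(C_{S,T}^{\lambda}D_{U,V}^{\mu})=1$ if $\lambda=\mu$,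 $S=U$, $T=V$, and $=0$ otherwise. *)

theory Defs
  imports "HOL-Algebra.Algebra" "HOL-Combinatorics.Permutations"
begin

section \<open>Associative algebras, bases and dimension\<close>

text \<open>The locale \<^locale>\<open>algebra\<close> of the library is restricted to commutative algebras.\<close>

locale assoc_algebra = module R A + ring A for R (structure) and A (structure) +
  assumes smult_mult_left:
      "\<lbrakk>r \<in> carrier R; a \<in> carrier A; b \<in> carrier A\<rbrakk> \<Longrightarrow>
        (r \<odot>\<^bsub>A\<^esub> a) \<otimes>\<^bsub>A\<^esub> b = r \<odot>\<^bsub>A\<^esub> (a \<otimes>\<^bsub>A\<^esub> b)"
    and smult_mult_right:
      "\<lbrakk>r \<in> carrier R; a \<in> carrier A; b \<in> carrier A\<rbrakk> \<Longrightarrow>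
        a \<otimes>\<^bsub>A\<^esub> (r \<odot>\<^bsub>A\<^esub> b) = r \<odot>\<^bsub>A\<^esub> (a \<otimes>\<^bsub>A\<^esub> b)"

definition lin_span ::
  "('r, 'y) ring_scheme \<Rightarrow> ('r, 'a, 'x) module_scheme \<Rightarrow> 'j set \<Rightarrow> ('j \<Rightarrow> 'a) \<Rightarrow> 'a set" where
  "lin_span R A I b = {(\<Oplus>\<^bsub>A\<^esub>j\<in>I. c j \<odot>\<^bsub>A\<^esub> b j) |c. c \<in> I \<rightarrow> carrier R}"

text \<open>A family \<open>b\<close>, indexed by the finite set \<open>I\<close>, is an \<open>R\<close>-basis of the submodule \<open>W\<close> of \<open>A\<close>
  if every element of \<open>W\<close> has unique coordinates.  Bases are families, not sets, so that
  nothing has to be said about repetitions over the zero ring.\<close>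

definition is_basis ::
  "('r, 'y) ring_scheme \<Rightarrow> ('r, 'a, 'x) module_scheme \<Rightarrow> 'a set \<Rightarrow> 'j set \<Rightarrow> ('j \<Rightarrow> 'a) \<Rightarrow> bool" where
  "is_basis R A W I b \<longleftrightarrow>
     finite I \<and> b \<in> I \<rightarrow> W \<and>
     (\<forall>w\<in>W. \<exists>!c. c \<in> I \<rightarrow>\<^sub>E carrier R \<and> w = (\<Oplus>\<^bsub>A\<^esub>j\<in>I. c j \<odot>\<^bsub>A\<^esub> b j))"

text \<open>Used only for finite-dimensional subspaces over a field.\<close>

definition vdim :: "('r, 'y) ring_scheme \<Rightarrow> ('r, 'a, 'x) module_scheme \<Rightarrow> 'a set \<Rightarrow> nat" where
  "vdim R A W = (THE n. \<exists>b. is_basis R A W {..<n} b)"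

definition alg_center :: "('a, 'x) ring_scheme \<Rightarrow> 'a set" where
  "alg_center A = {z \<in> carrier A. \<forall>a\<in>carrier A. z \<otimes>\<^bsub>A\<^esub> a = a \<otimes>\<^bsub>A\<^esub> z}"


section \<open>Symmetric algebras\<close>

text \<open>The Leibniz formula, for an \<open>n \<times> n\<close> matrix over a ring given by its carrier.\<close>

definition det_ring :: "('r, 'y) ring_scheme \<Rightarrow> nat \<Rightarrow> (nat \<Rightarrow> nat \<Rightarrow> 'r) \<Rightarrow> 'r" where
  "det_ring R n m =
     (\<Oplus>\<^bsub>R\<^esub>p\<in>{p. p permutes {..<n}}.
        (if evenperm p then \<one>\<^bsub>R\<^esub> else \<ominus>\<^bsub>R\<^esub> \<one>\<^bsub>R\<^esub>) \<otimes>\<^bsub>R\<^esub> (\<Otimes>\<^bsub>R\<^esub>j\<in>{..<n}. m j (p j)))"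

text \<open>Bilinearity is required in the first argument only; symmetry gives the second.\<close>

definition symmetrizing_form ::
  "('r, 'y) ring_scheme \<Rightarrow> ('r, 'a, 'x) module_scheme \<Rightarrow> ('a \<Rightarrow> 'a \<Rightarrow> 'r) \<Rightarrow> bool" where
  "symmetrizing_form R A f \<longleftrightarrow>
     f \<in> carrier A \<rightarrow> carrier A \<rightarrow> carrier R \<and>
     (\<forall>a\<in>carrier A. \<forall>b\<in>carrier A. \<forall>c\<in>carrier A. f (a \<oplus>\<^bsub>A\<^esub> b) c = f a c \<oplus>\<^bsub>R\<^esub> f b c) \<and>
     (\<forall>r\<in>carrier R. \<forall>a\<in>carrier A. \<forall>b\<in>carrier A. f (r \<odot>\<^bsub>A\<^esub> a) b = r \<otimes>\<^bsub>R\<^esub> f a b) \<and>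
     (\<forall>a\<in>carrier A. \<forall>b\<in>carrier A. f a b = f b a) \<and>
     (\<forall>a\<in>carrier A. \<forall>b\<in>carrier A. \<forall>c\<in>carrier A. f (a \<otimes>\<^bsub>A\<^esub> b) c = f a (b \<otimes>\<^bsub>A\<^esub> c)) \<and>
     (\<exists>n b. is_basis R A (carrier A) {..<n} b \<and>
        det_ring R n (\<lambda>j k. f (b j) (b k)) \<in> Units R)"

definition symmetrizing_trace ::
  "('r, 'y) ring_scheme \<Rightarrow> ('r, 'a, 'x) module_scheme \<Rightarrow> ('a \<Rightarrow> 'r) \<Rightarrow> bool" where
  "symmetrizing_trace R A \<tau> \<longleftrightarrow>
     (\<exists>f. symmetrizing_form R A f \<and> (\<forall>a\<in>carrier A. \<tau> a = f a \<one>\<^bsub>A\<^esub>))"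

text \<open>Finite generation and freeness are part of the existence of the basis in
  \<^const>\<open>symmetrizing_form\<close>.\<close>

definition symmetric_algebra ::
  "('r, 'y) ring_scheme \<Rightarrow> ('r, 'a, 'x) module_scheme \<Rightarrow> bool" where
  "symmetric_algebra R A \<longleftrightarrow> assoc_algebra R A \<and> (\<exists>f. symmetrizing_form R A f)"


section \<open>Cellular algebras\<close>

definition cell_index :: "'l set \<Rightarrow> ('l \<Rightarrow> 's set) \<Rightarrow> ('l \<times> 's \<times> 's) set" where
  "cell_index \<Lambda> M = (SIGMA l:\<Lambda>. M l \<times> M l)"

abbreviation cell_family :: "('l \<Rightarrow> 's \<Rightarrow> 's \<Rightarrow> 'a) \<Rightarrow> 'l \<times> 's \<times> 's \<Rightarrow> 'a" where
  "cell_family C \<equiv> (\<lambda>(l, S, T). C l S T)"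

text \<open>\<open>po\<close> is the partial order of \<open>\<Lambda>\<close>, and \<open>lower_span R A \<Lambda> po M C l\<close> is \<open>A(<l)\<close>.\<close>

definition lower_span ::
  "('r, 'y) ring_scheme \<Rightarrow> ('r, 'a, 'x) module_scheme \<Rightarrow> 'l set \<Rightarrow> 'l rel \<Rightarrow> ('l \<Rightarrow> 's set) \<Rightarrow>
   ('l \<Rightarrow> 's \<Rightarrow> 's \<Rightarrow> 'a) \<Rightarrow> 'l \<Rightarrow> 'a set" where
  "lower_span R A \<Lambda> po M C l =
     lin_span R A (cell_index {\<mu>\<in>\<Lambda>. (\<mu>, l) \<in> po \<and> \<mu> \<noteq> l} M) (cell_family C)"

locale cellular_algebra = assoc_algebra R A
  for R :: "('r, 'y) ring_scheme" (structure) and A :: "('r, 'a, 'x) module_scheme" (structure) +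
  fixes \<Lambda> :: "'l set" and po :: "'l rel" and M :: "'l \<Rightarrow> 's set"
    and C :: "'l \<Rightarrow> 's \<Rightarrow> 's \<Rightarrow> 'a" and \<iota> :: "'a \<Rightarrow> 'a"
  assumes finite_poset: "finite \<Lambda>" "partial_order_on \<Lambda> po"
    and finite_M: "l \<in> \<Lambda> \<Longrightarrow> finite (M l)"
    and nonempty_M: "l \<in> \<Lambda> \<Longrightarrow> M l \<noteq> {}"
    and cellular_basis: "is_basis R A (carrier A) (cell_index \<Lambda> M) (cell_family C)"
    and inv_closed: "\<iota> \<in> carrier A \<rightarrow> carrier A"
    and inv_add: "\<lbrakk>a \<in> carrier A; b \<in> carrier A\<rbrakk> \<Longrightarrow> \<iota> (a \<oplus>\<^bsub>A\<^esub> b) = \<iota> a \<oplus>\<^bsub>A\<^esub> \<iota> b"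
    and inv_smult: "\<lbrakk>r \<in> carrier R; a \<in> carrier A\<rbrakk> \<Longrightarrow> \<iota> (r \<odot>\<^bsub>A\<^esub> a) = r \<odot>\<^bsub>A\<^esub> \<iota> a"
    and inv_mult: "\<lbrakk>a \<in> carrier A; b \<in> carrier A\<rbrakk> \<Longrightarrow> \<iota> (a \<otimes>\<^bsub>A\<^esub> b) = \<iota> b \<otimes>\<^bsub>A\<^esub> \<iota> a"
    and inv_inv: "a \<in> carrier A \<Longrightarrow> \<iota> (\<iota> a) = a"
    and inv_basis: "\<lbrakk>l \<in> \<Lambda>; S \<in> M l; T \<in> M l\<rbrakk> \<Longrightarrow> \<iota> (C l S T) = C l T S"
    and straightening:
      "\<lbrakk>a \<in> carrier A; l \<in> \<Lambda>\<rbrakk> \<Longrightarrow>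
        \<exists>r \<in> M l \<rightarrow> M l \<rightarrow> carrier R. \<forall>S\<in>M l. \<forall>T\<in>M l.
          (a \<otimes>\<^bsub>A\<^esub> C l S T) \<ominus>\<^bsub>A\<^esub> (\<Oplus>\<^bsub>A\<^esub>S'\<in>M l. r S' S \<odot>\<^bsub>A\<^esub> C l S' T)
            \<in> lower_span R A \<Lambda> po M C l"

definition dual_cell_basis ::
  "('r, 'y) ring_scheme \<Rightarrow> ('r, 'a, 'x) module_scheme \<Rightarrow> 'l set \<Rightarrow> ('l \<Rightarrow> 's set) \<Rightarrow>
   ('l \<Rightarrow> 's \<Rightarrow> 's \<Rightarrow> 'a) \<Rightarrow> ('a \<Rightarrow> 'r) \<Rightarrow> ('l \<Rightarrow> 's \<Rightarrow> 's \<Rightarrow> 'a) \<Rightarrow> bool" where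
  "dual_cell_basis R A \<Lambda> M C \<tau> D \<longleftrightarrow>
     is_basis R A (carrier A) (cell_index \<Lambda> M) (cell_family D) \<and>
     (\<forall>l\<in>\<Lambda>. \<forall>S\<in>M l. \<forall>T\<in>M l. \<forall>\<mu>\<in>\<Lambda>. \<forall>U\<in>M \<mu>. \<forall>V\<in>M \<mu>.
        \<tau> (C l S T \<otimes>\<^bsub>A\<^esub> D \<mu> U V) = (if l = \<mu> \<and> S = U \<and> T = V then \<one>\<^bsub>R\<^esub> else \<zero>\<^bsub>R\<^esub>))"

definition x_elt_at ::
  "('r, 'a, 'x) module_scheme \<Rightarrow> ('l \<Rightarrow> 's set) \<Rightarrow> ('l \<Rightarrow> 's \<Rightarrow> 's \<Rightarrow> 'a) \<Rightarrow> ('l \<Rightarrow> 's \<Rightarrow> 's \<Rightarrow> 'a) \<Rightarrow>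
   'l \<Rightarrow> 's \<Rightarrow> 'a" where
  "x_elt_at A M C D l T = (\<Oplus>\<^bsub>A\<^esub>S\<in>M l. C l S T \<otimes>\<^bsub>A\<^esub> D l S T)"

definition x_elt ::
  "('r, 'a, 'x) module_scheme \<Rightarrow> ('l \<Rightarrow> 's set) \<Rightarrow> ('l \<Rightarrow> 's \<Rightarrow> 's \<Rightarrow> 'a) \<Rightarrow> ('l \<Rightarrow> 's \<Rightarrow> 's \<Rightarrow> 'a) \<Rightarrow>
   'l \<Rightarrow> 'a" where
  "x_elt A M C D l = x_elt_at A M C D l (SOME T. T \<in> M l)"

definition L_ideal ::
  "('r, 'y) ring_scheme \<Rightarrow> ('r, 'a, 'x) module_scheme \<Rightarrow> 'l set \<Rightarrow> ('l \<Rightarrow> 's set) \<Rightarrow>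
   ('l \<Rightarrow> 's \<Rightarrow> 's \<Rightarrow> 'a) \<Rightarrow> ('l \<Rightarrow> 's \<Rightarrow> 's \<Rightarrow> 'a) \<Rightarrow> 'a set" where
  "L_ideal R A \<Lambda> M C D = lin_span R A \<Lambda> (x_elt A M C D)"

definition higman_ideal ::
  "('r, 'a, 'x) module_scheme \<Rightarrow> 'l set \<Rightarrow> ('l \<Rightarrow> 's set) \<Rightarrow>
   ('l \<Rightarrow> 's \<Rightarrow> 's \<Rightarrow> 'a) \<Rightarrow> ('l \<Rightarrow> 's \<Rightarrow> 's \<Rightarrow> 'a) \<Rightarrow> 'a set" where
  "higman_ideal A \<Lambda> M C D =
     {finsum A (\<lambda>(l, S, T). C l S T \<otimes>\<^bsub>A\<^esub> a \<otimes>\<^bsub>A\<^esub> D l S T) (cell_index \<Lambda> M) |a. a \<in> carrier A}"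


section \<open>Simple modules\<close>

text \<open>The locale \<^locale>\<open>module\<close> of the library requires a commutative ring of scalars.  Of the record
  \<open>V\<close> only the carrier, the additive structure and the scalar multiplication matter.\<close>

locale left_module = A?: ring A + V?: abelian_group V
  for A :: "('a, 'y) ring_scheme" (structure) and V :: "('a, 'm, 'x) module_scheme" (structure) +
  assumes act_closed: "\<lbrakk>a \<in> carrier A; v \<in> carrier V\<rbrakk> \<Longrightarrow> a \<odot>\<^bsub>V\<^esub> v \<in> carrier V"
    and act_l_distr: "\<lbrakk>a \<in> carrier A; b \<in> carrier A; v \<in> carrier V\<rbrakk> \<Longrightarrow>
      (a \<oplus>\<^bsub>A\<^esub> b) \<odot>\<^bsub>V\<^esub> v = a \<odot>\<^bsub>V\<^esub> v \<oplus>\<^bsub>V\<^esub> b \<odot>\<^bsub>V\<^esub> v"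
    and act_r_distr: "\<lbrakk>a \<in> carrier A; v \<in> carrier V; w \<in> carrier V\<rbrakk> \<Longrightarrow>
      a \<odot>\<^bsub>V\<^esub> (v \<oplus>\<^bsub>V\<^esub> w) = a \<odot>\<^bsub>V\<^esub> v \<oplus>\<^bsub>V\<^esub> a \<odot>\<^bsub>V\<^esub> w"
    and act_assoc: "\<lbrakk>a \<in> carrier A; b \<in> carrier A; v \<in> carrier V\<rbrakk> \<Longrightarrow>
      (a \<otimes>\<^bsub>A\<^esub> b) \<odot>\<^bsub>V\<^esub> v = a \<odot>\<^bsub>V\<^esub> (b \<odot>\<^bsub>V\<^esub> v)"
    and act_one: "v \<in> carrier V \<Longrightarrow> \<one>\<^bsub>A\<^esub> \<odot>\<^bsub>V\<^esub> v = v"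

definition simple_module :: "('a, 'y) ring_scheme \<Rightarrow> ('a, 'm, 'x) module_scheme \<Rightarrow> bool" where
  "simple_module A V \<longleftrightarrow>
     left_module A V \<and> carrier V \<noteq> {\<zero>\<^bsub>V\<^esub>} \<and>
     (\<forall>H. submodule H A V \<longrightarrow> H = {\<zero>\<^bsub>V\<^esub>} \<or> H = carrier V)"

definition module_iso ::
  "('a, 'y) ring_scheme \<Rightarrow> ('a, 'm, 'x) module_scheme \<Rightarrow> ('a, 'n, 'z) module_scheme \<Rightarrow> bool" where
  "module_iso A V W \<longleftrightarrow>
     (\<exists>h. bij_betw h (carrier V) (carrier W) \<and>
        (\<forall>v\<in>carrier V. \<forall>w\<in>carrier V. h (v \<oplus>\<^bsub>V\<^esub> w) = h v \<oplus>\<^bsub>W\<^esub> h w) \<and>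
        (\<forall>a\<in>carrier A. \<forall>v\<in>carrier V. h (a \<odot>\<^bsub>V\<^esub> v) = a \<odot>\<^bsub>W\<^esub> h v))"

text \<open>Isomorphism classes of the simple \<open>A\<close>-modules whose carrier is a subset of the type \<open>'m\<close>.
  Every simple module is isomorphic to a quotient of \<open>A\<close> by a maximal left ideal, so \<open>'m = 'a set\<close>
  (where \<open>'a\<close> is the element type of \<open>A\<close>) already gives all isomorphism classes; a statement with
  \<open>'m\<close> a free type variable covers this instance and every other one.\<close>

definition simple_module_classes :: "('a, 'y) ring_scheme \<Rightarrow> ('a, 'm) module set set" where
  "simple_module_classes A =
     {V. simple_module A V} //
     {(V, W). simple_module A V \<and> simple_module A W \<and> module_iso A V W}"

end

theory Submission
  imports Defs
begin

text \<open>
  Write \<open>\<chi>\<^sub>\<lambda>\<close> for the character of the cell module of \<open>\<lambda>\<close>, so that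
  \<open>\<chi>\<^sub>\<lambda>(a) = \<Sum>\<^sub>S r\<^sub>a(S,S)\<close>.  Everything rests on one observation: since \<open>\<tau>(a D\<^sub>S\<^sub>T)\<close> is the
  coefficient of \<open>a\<close> at \<open>C\<^sub>S\<^sub>T\<close>, the element \<open>x\<^sub>\<lambda>\<close> represents \<open>\<chi>\<^sub>\<lambda>\<close> with respect to the trace form:
  \<open>\<tau>(a x\<^sub>\<lambda>) = \<chi>\<^sub>\<lambda>(a)\<close> for all \<open>a\<close> (\<open>tr_mult_x_elt_at\<close>).  As \<open>\<tau>\<close> is nondegenerate (\<open>tr_eqI\<close>), statements
  about the \<open>x\<^sub>\<lambda>\<close> become statements about the \<open>\<chi>\<^sub>\<lambda>\<close>, which do not involve \<open>\<tau>\<close>.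

  \<^item> The right-hand side does not mention \<open>T\<close>, so \<open>x\<^sub>\<lambda>\<close> does not depend on it; and \<open>x\<^sub>\<lambda>\<close> is central
    because \<open>\<chi>\<^sub>\<lambda>(ab) = \<chi>\<^sub>\<lambda>(ba)\<close>.

  \<^item> For central \<open>z\<close>, comparing the left expansion of \<open>z C\<^sub>S\<^sub>T\<close> with the right expansion of \<open>C\<^sub>S\<^sub>T z\<close>
    shows that \<open>z\<close> acts on each cell module by a scalar (\<open>central_cell_rep\<close>).  Hence \<open>z x\<^sub>\<lambda>\<close> is a
    multiple of \<open>x\<^sub>\<lambda>\<close>, and \<open>L(A)\<close> is an ideal of the center.

  \<^item> The trace of \<open>c \<mapsto> b c a\<close>, computed in the cellular basis, is
    \<open>\<Sum>\<^sub>\<lambda> \<chi>\<^sub>\<lambda>(b) \<chi>\<^sub>\<lambda>(\<iota> a)\<close>; so \<open>\<Sum> C\<^sub>S\<^sub>T a D\<^sub>S\<^sub>T = \<Sum>\<^sub>\<lambda> \<chi>\<^sub>\<lambda>(\<iota> a) x\<^sub>\<lambda>\<close> (\<open>higman_element\<close>), which lies in \<open>L(A)\<close>.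

  \<^item> A second trace is \<open>\<tau>'(a) = \<tau>(a u)\<close> with \<open>u\<close> central, whence \<open>x\<^sub>\<lambda> = u x'\<^sub>\<lambda>\<close>, and this lies in
    \<open>L'(A)\<close> because \<open>L'(A)\<close> is an ideal of the center; the situation is symmetric.

  Now let \<open>R\<close> be a field, and let \<open>\<Lambda>\<^sub>0\<close> be the set of \<open>\<lambda>\<close> for which \<open>\<chi>\<^sub>\<lambda>(C\<^sub>S\<^sub>T) \<noteq> 0\<close> for some
  \<open>S, T \<in> M(\<lambda>)\<close>.  These values are the Gram matrix of the cell module:
  \<open>C\<^sub>U\<^sub>P C\<^sub>S\<^sub>T \<equiv> \<chi>\<^sub>\<lambda>(C\<^sub>S\<^sub>P) C\<^sub>U\<^sub>T\<close> modulo \<open>A(<\<lambda>)\<close> (\<open>C_mult_C\<close>).  As \<open>\<chi>\<^sub>\<lambda>\<close> vanishes on the basis elements of \<open>\<mu>\<close>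
  unless \<open>\<lambda> \<le> \<mu>\<close>, the \<open>x\<^sub>\<lambda>\<close> with \<open>\<lambda> \<in> \<Lambda>\<^sub>0\<close> are linearly independent, by triangularity.  On the other
  hand, to a simple module \<open>V\<close> one attaches a minimal \<open>\<lambda>\<close> whose basis elements do not all annihilate
  \<open>V\<close>.  Then \<open>\<lambda> \<in> \<Lambda>\<^sub>0\<close> (\<open>cell_type_nonzero\<close>), and \<open>V\<close> contains a nonzero vector whose annihilator is
  described by structure constants of \<open>A\<close> alone (\<open>eigenvector_annihilator\<close>), so that \<open>\<lambda>\<close> determines
  \<open>V\<close> up to isomorphism.  Hence there are at most \<open>|\<Lambda>\<^sub>0| \<le> dim L(A)\<close> classes.
\<close>

section \<open>Finite sums\<close>

lemma (in abelian_monoid) finsum_swap: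
  assumes "finite I" "finite J" "\<And>i j. \<lbrakk>i \<in> I; j \<in> J\<rbrakk> \<Longrightarrow> f i j \<in> carrier G"
  shows "(\<Oplus>i\<in>I. \<Oplus>j\<in>J. f i j) = (\<Oplus>j\<in>J. \<Oplus>i\<in>I. f i j)"
  using assms(1,3)
proof (induction I rule: finite_induct)
  case (insert k I)
  have "(\<Oplus>i\<in>insert k I. \<Oplus>j\<in>J. f i j) = (\<Oplus>j\<in>J. f k j) \<oplus> (\<Oplus>i\<in>I. \<Oplus>j\<in>J. f i j)"
    using insert by (intro finsum_insert) (auto intro!: finsum_closed)
  also have "\<dots> = (\<Oplus>j\<in>J. f k j) \<oplus> (\<Oplus>j\<in>J. \<Oplus>i\<in>I. f i j)"
    using insert by auto
  also have "\<dots> = (\<Oplus>j\<in>J. f k j \<oplus> (\<Oplus>i\<in>I. f i j))"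
    using insert by (intro finsum_addf [symmetric]) (auto intro!: finsum_closed)
  also have "\<dots> = (\<Oplus>j\<in>J. \<Oplus>i\<in>insert k I. f i j)"
    using insert by (intro finsum_cong') (auto intro!: finsum_closed)
  finally show ?case .
qed (simp add: finsum_zero)

lemma (in abelian_monoid) finsum_neutral:
  assumes "finite J" "I \<subseteq> J" "\<And>i. i \<in> J - I \<Longrightarrow> f i = \<zero>" "f \<in> I \<rightarrow> carrier G"
  shows "finsum G f J = finsum G f I"
proof (rule add.finprod_mono_neutral_cong_right)
  show "f \<in> J \<rightarrow> carrier G"
    using assms(3,4) zero_closed by (metis DiffI Pi_iff)
qed (use assms in auto)

lemma (in abelian_monoid) finsum_single:
  assumes "finite I" "k \<in> I" "\<And>i. \<lbrakk>i \<in> I; i \<noteq> k\<rbrakk> \<Longrightarrow> f i = \<zero>" "f k \<in> carrier G"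
  shows "finsum G f I = f k"
  using finsum_neutral[of I "{k}" f] assms by auto

lemma (in abelian_monoid) finsum_eq_zero:
  assumes "\<And>i. i \<in> I \<Longrightarrow> f i = \<zero>"
  shows "finsum G f I = \<zero>"
  using assms by (rule add.finprod_one_eqI)

lemma (in abelian_monoid) finsum_Sigma:
  assumes "finite I" "\<And>i. i \<in> I \<Longrightarrow> finite (J i)"
    and "\<And>i j. \<lbrakk>i \<in> I; j \<in> J i\<rbrakk> \<Longrightarrow> f i j \<in> carrier G"
  shows "(\<Oplus>p\<in>Sigma I J. case p of (i, j) \<Rightarrow> f i j) = (\<Oplus>i\<in>I. \<Oplus>j\<in>J i. f i j)"
  using assms
proof (induction I rule: finite_induct)
  case (insert k I)
  let ?f = "\<lambda>p. case p of (i, j) \<Rightarrow> f i j"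
  have "Sigma (insert k I) J = Pair k ` J k \<union> Sigma I J"
    by auto
  moreover have "Pair k ` J k \<inter> Sigma I J = {}"
    using insert.hyps by auto
  ultimately have "finsum G ?f (Sigma (insert k I) J)
      = finsum G ?f (Pair k ` J k) \<oplus> finsum G ?f (Sigma I J)"
    using insert.prems insert.hyps by (auto intro!: finsum_Un_disjoint)
  also have "finsum G ?f (Pair k ` J k) = (\<Oplus>j\<in>J k. f k j)"
    using insert.prems by (subst finsum_reindex) (auto simp: inj_on_def)
  also have "finsum G ?f (Sigma I J) = (\<Oplus>i\<in>I. \<Oplus>j\<in>J i. f i j)"
    using insert by auto
  also have "(\<Oplus>j\<in>J k. f k j) \<oplus> \<dots> = (\<Oplus>i\<in>insert k I. \<Oplus>j\<in>J i. f i j)"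
    using insert.prems insert.hyps by (subst finsum_insert) (auto intro!: finsum_closed)
  finally show ?case .
qed simp

text \<open>All maps that are moved past a sum below (multiplications, coordinates, traces) are covered
  by this one statement.\<close>

lemma additive_finsum:
  assumes "abelian_group G" "abelian_group H"
    and h: "h \<in> carrier G \<rightarrow> carrier H"
    and add: "\<And>a b. \<lbrakk>a \<in> carrier G; b \<in> carrier G\<rbrakk> \<Longrightarrow> h (a \<oplus>\<^bsub>G\<^esub> b) = h a \<oplus>\<^bsub>H\<^esub> h b"
    and "finite I" "f \<in> I \<rightarrow> carrier G"
  shows "h (finsum G f I) = (\<Oplus>\<^bsub>H\<^esub>i\<in>I. h (f i))"
proof -
  interpret G: abelian_group G by fact
  interpret H: abelian_group H by fact
  have closed: "h a \<in> carrier H" if "a \<in> carrier G" for a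
    using h that by auto
  have "h \<zero>\<^bsub>G\<^esub> \<oplus>\<^bsub>H\<^esub> h \<zero>\<^bsub>G\<^esub> = h \<zero>\<^bsub>G\<^esub>"
    using add[of "\<zero>\<^bsub>G\<^esub>" "\<zero>\<^bsub>G\<^esub>"] by simp
  hence zero: "h \<zero>\<^bsub>G\<^esub> = \<zero>\<^bsub>H\<^esub>"
    using closed by simp
  from \<open>finite I\<close> \<open>f \<in> I \<rightarrow> carrier G\<close> show ?thesis
  proof (induction I rule: finite_induct)
    case (insert k I)
    have "h (finsum G f (insert k I)) = h (f k \<oplus>\<^bsub>G\<^esub> finsum G f I)"
      using insert by (subst G.finsum_insert) auto
    also have "\<dots> = h (f k) \<oplus>\<^bsub>H\<^esub> h (finsum G f I)"
      using insert by (intro add) (auto intro!: G.finsum_closed)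
    also have "\<dots> = (\<Oplus>\<^bsub>H\<^esub>i\<in>insert k I. h (f i))"
      using insert closed by (subst H.finsum_insert) auto
    finally show ?case .
  qed (simp add: zero)
qed


section \<open>Linear independence and dimension\<close>

text \<open>Linear independence of a family, so that a repeated vector makes it dependent.\<close>

definition lin_indep ::
  "('r, 'y) ring_scheme \<Rightarrow> ('r, 'a, 'x) module_scheme \<Rightarrow> 'j set \<Rightarrow> ('j \<Rightarrow> 'a) \<Rightarrow> bool" where
  "lin_indep R A J b \<longleftrightarrow>
     (\<forall>c \<in> J \<rightarrow> carrier R. (\<Oplus>\<^bsub>A\<^esub>j\<in>J. c j \<odot>\<^bsub>A\<^esub> b j) = \<zero>\<^bsub>A\<^esub> \<longrightarrow> (\<forall>j\<in>J. c j = \<zero>\<^bsub>R\<^esub>))"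

context module
begin

lemma smult_minus_distr:
  assumes "r \<in> carrier R" "s \<in> carrier R" "x \<in> carrier M"
  shows "(r \<ominus> s) \<odot>\<^bsub>M\<^esub> x = r \<odot>\<^bsub>M\<^esub> x \<ominus>\<^bsub>M\<^esub> s \<odot>\<^bsub>M\<^esub> x"
  using assms by (simp add: R.minus_eq M.minus_eq smult_l_distr smult_l_minus)

lemma finsum_smult:
  assumes "finite I" "f \<in> I \<rightarrow> carrier R" "x \<in> carrier M"
  shows "(\<Oplus>i\<in>I. f i) \<odot>\<^bsub>M\<^esub> x = (\<Oplus>\<^bsub>M\<^esub>i\<in>I. f i \<odot>\<^bsub>M\<^esub> x)"
  by (rule additive_finsum[of R M "\<lambda>r. r \<odot>\<^bsub>M\<^esub> x"])
     (use assms smult_l_distr in \<open>auto intro: R.abelian_group_axioms M.abelian_group_axioms\<close>)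

lemma lin_spanI:
  "c \<in> I \<rightarrow> carrier R \<Longrightarrow> (\<Oplus>\<^bsub>M\<^esub>i\<in>I. c i \<odot>\<^bsub>M\<^esub> b i) \<in> lin_span R M I b"
  unfolding lin_span_def by auto

lemma lin_spanE:
  assumes "x \<in> lin_span R M I b"
  obtains c where "c \<in> I \<rightarrow> carrier R" "x = (\<Oplus>\<^bsub>M\<^esub>i\<in>I. c i \<odot>\<^bsub>M\<^esub> b i)"
  using assms unfolding lin_span_def by auto

lemma lin_span_submodule:
  assumes "finite I" and b: "b \<in> I \<rightarrow> carrier M"
  shows "submodule (lin_span R M I b) R M"
proof (rule submoduleI)
  have bc: "b i \<in> carrier M" if "i \<in> I" for i
    using b that by auto
  show "lin_span R M I b \<subseteq> carrier M"
    using b unfolding lin_span_def by (auto intro!: M.finsum_closed)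
  have "(\<Oplus>\<^bsub>M\<^esub>i\<in>I. \<zero> \<odot>\<^bsub>M\<^esub> b i) = \<zero>\<^bsub>M\<^esub>"
    using bc by (intro M.finsum_eq_zero) auto
  thus "\<zero>\<^bsub>M\<^esub> \<in> lin_span R M I b"
    using lin_spanI[of "\<lambda>_. \<zero>" I b] by simp
  show smult: "r \<odot>\<^bsub>M\<^esub> x \<in> lin_span R M I b" if r: "r \<in> carrier R" and x: "x \<in> lin_span R M I b" for r x
  proof -
    from x obtain c where c: "c \<in> I \<rightarrow> carrier R" "x = (\<Oplus>\<^bsub>M\<^esub>i\<in>I. c i \<odot>\<^bsub>M\<^esub> b i)"
      by (rule lin_spanE)
    have "r \<odot>\<^bsub>M\<^esub> x = (\<Oplus>\<^bsub>M\<^esub>i\<in>I. (r \<otimes> c i) \<odot>\<^bsub>M\<^esub> b i)"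
      unfolding c(2) using r c(1) b \<open>finite I\<close>
      by (subst finsum_smult_ldistr) (auto intro!: M.finsum_cong' simp: smult_assoc1 Pi_iff)
    thus ?thesis
      using r c(1) by (auto intro!: lin_spanI)
  qed
  show "x \<oplus>\<^bsub>M\<^esub> y \<in> lin_span R M I b" if x: "x \<in> lin_span R M I b" and y: "y \<in> lin_span R M I b" for x y
  proof -
    from x obtain c where c: "c \<in> I \<rightarrow> carrier R" "x = (\<Oplus>\<^bsub>M\<^esub>i\<in>I. c i \<odot>\<^bsub>M\<^esub> b i)"
      by (rule lin_spanE)
    from y obtain d where d: "d \<in> I \<rightarrow> carrier R" "y = (\<Oplus>\<^bsub>M\<^esub>i\<in>I. d i \<odot>\<^bsub>M\<^esub> b i)"
      by (rule lin_spanE)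
    have "x \<oplus>\<^bsub>M\<^esub> y = (\<Oplus>\<^bsub>M\<^esub>i\<in>I. c i \<odot>\<^bsub>M\<^esub> b i \<oplus>\<^bsub>M\<^esub> d i \<odot>\<^bsub>M\<^esub> b i)"
      unfolding c(2) d(2) using c(1) d(1) bc by (intro M.finsum_addf [symmetric]) (auto simp: Pi_iff)
    also have "\<dots> = (\<Oplus>\<^bsub>M\<^esub>i\<in>I. (c i \<oplus> d i) \<odot>\<^bsub>M\<^esub> b i)"
      using c(1) d(1) bc by (intro M.finsum_cong') (auto simp: Pi_iff smult_l_distr)
    finally show ?thesis
      using c(1) d(1) by (auto intro!: lin_spanI)
  qed
  show "\<ominus>\<^bsub>M\<^esub> x \<in> lin_span R M I b" if x: "x \<in> lin_span R M I b" for x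
  proof -
    have "x \<in> carrier M"
      using x \<open>lin_span R M I b \<subseteq> carrier M\<close> by auto
    hence "\<ominus>\<^bsub>M\<^esub> x = (\<ominus> \<one>) \<odot>\<^bsub>M\<^esub> x"
      by (simp add: smult_l_minus)
    thus ?thesis
      using smult[of "\<ominus> \<one>" x] x by simp
  qed
qed

lemma submodule_zero: "submodule K R M \<Longrightarrow> \<zero>\<^bsub>M\<^esub> \<in> K"
  using subgroup.one_closed[of K "add_monoid M"] unfolding submodule_def by simp

lemma submodule_finsum:
  assumes K: "submodule K R M" and "f \<in> I \<rightarrow> K"
  shows "finsum M f I \<in> K"
  using assms(2)
proof (induction I rule: infinite_finite_induct)
  case (insert k I)
  thus ?case
    using submoduleE[OF K] by (subst M.finsum_insert) auto
qed (use submodule_zero[OF K] in \<open>auto simp: M.finsum_infinite\<close>)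

lemma lin_span_least:
  assumes K: "submodule K R M" and "\<And>i. i \<in> I \<Longrightarrow> b i \<in> K"
  shows "lin_span R M I b \<subseteq> K"
  using assms submoduleE(4)[OF K] unfolding lin_span_def by (auto intro!: submodule_finsum[OF K])

lemma lin_span_base:
  assumes "finite I" "b \<in> I \<rightarrow> carrier M" "i \<in> I"
  shows "b i \<in> lin_span R M I b"
proof -
  have "(\<Oplus>\<^bsub>M\<^esub>j\<in>I. (if j = i then \<one> else \<zero>) \<odot>\<^bsub>M\<^esub> b j) = b i"
    using assms by (subst M.finsum_single[of I i]) (auto simp: Pi_iff)
  thus ?thesis
    using lin_spanI[of "\<lambda>j. if j = i then \<one> else \<zero>" I b] by simp
qed

lemma lin_span_is_basis:
  assumes "finite I" and b: "b \<in> I \<rightarrow> carrier M" and ind: "lin_indep R M I b"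
  shows "is_basis R M (lin_span R M I b) I b"
  unfolding is_basis_def
proof (intro conjI ballI)
  show "b \<in> I \<rightarrow> lin_span R M I b"
    using lin_span_base assms by auto
  fix w assume "w \<in> lin_span R M I b"
  then obtain c where c: "c \<in> I \<rightarrow> carrier R" "w = (\<Oplus>\<^bsub>M\<^esub>i\<in>I. c i \<odot>\<^bsub>M\<^esub> b i)"
    by (rule lin_spanE)
  show "\<exists>!c. c \<in> I \<rightarrow>\<^sub>E carrier R \<and> w = (\<Oplus>\<^bsub>M\<^esub>j\<in>I. c j \<odot>\<^bsub>M\<^esub> b j)"
  proof (rule ex1I[of _ "restrict c I"])
    have "(\<Oplus>\<^bsub>M\<^esub>i\<in>I. c i \<odot>\<^bsub>M\<^esub> b i) = (\<Oplus>\<^bsub>M\<^esub>i\<in>I. restrict c I i \<odot>\<^bsub>M\<^esub> b i)"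
      using c(1) b by (intro M.finsum_cong') (auto simp: Pi_iff)
    thus "restrict c I \<in> I \<rightarrow>\<^sub>E carrier R \<and> w = (\<Oplus>\<^bsub>M\<^esub>j\<in>I. restrict c I j \<odot>\<^bsub>M\<^esub> b j)"
      using c by auto
    fix d assume d: "d \<in> I \<rightarrow>\<^sub>E carrier R \<and> w = (\<Oplus>\<^bsub>M\<^esub>j\<in>I. d j \<odot>\<^bsub>M\<^esub> b j)"
    have closed: "d i \<in> carrier R" "c i \<in> carrier R" "b i \<in> carrier M" if "i \<in> I" for i
      using that c d b by auto
    have w: "w \<in> carrier M"
      unfolding c(2) using closed by (auto intro!: M.finsum_closed)
    have "(\<Oplus>\<^bsub>M\<^esub>i\<in>I. (d i \<ominus> c i) \<odot>\<^bsub>M\<^esub> b i) \<oplus>\<^bsub>M\<^esub> w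
        = (\<Oplus>\<^bsub>M\<^esub>i\<in>I. (d i \<ominus> c i) \<odot>\<^bsub>M\<^esub> b i \<oplus>\<^bsub>M\<^esub> c i \<odot>\<^bsub>M\<^esub> b i)"
      unfolding c(2) using closed by (intro M.finsum_addf [symmetric]) auto
    also have "\<dots> = (\<Oplus>\<^bsub>M\<^esub>i\<in>I. d i \<odot>\<^bsub>M\<^esub> b i)"
      using closed by (intro M.finsum_cong')
        (auto simp: smult_minus_distr M.minus_eq M.a_assoc M.l_neg)
    also have "\<dots> = w"
      using d by simp
    finally have "(\<Oplus>\<^bsub>M\<^esub>i\<in>I. (d i \<ominus> c i) \<odot>\<^bsub>M\<^esub> b i) = \<zero>\<^bsub>M\<^esub>"
      using w closed by (simp add: M.finsum_closed Pi_iff)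
    hence "\<forall>i\<in>I. d i \<ominus> c i = \<zero>"
      using ind closed unfolding lin_indep_def by (auto simp: Pi_iff)
    hence "\<forall>i\<in>I. d i = c i"
      using closed by simp
    thus "d = restrict c I"
      using d by (auto simp: PiE_def extensional_def)
  qed
qed fact

lemma is_basis_lin_indep:
  assumes W: "submodule W R M" and bas: "is_basis R M W I b"
  shows "lin_indep R M I b"
  unfolding lin_indep_def
proof (intro ballI impI)
  have b: "b i \<in> carrier M" if "i \<in> I" for i
    using that bas submoduleE(1)[OF W] unfolding is_basis_def by auto
  fix c i assume c: "c \<in> I \<rightarrow> carrier R" and 0: "(\<Oplus>\<^bsub>M\<^esub>j\<in>I. c j \<odot>\<^bsub>M\<^esub> b j) = \<zero>\<^bsub>M\<^esub>" and "i \<in> I"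
  have ex1: "\<exists>!c. c \<in> I \<rightarrow>\<^sub>E carrier R \<and> \<zero>\<^bsub>M\<^esub> = (\<Oplus>\<^bsub>M\<^esub>j\<in>I. c j \<odot>\<^bsub>M\<^esub> b j)"
    using bas submodule_zero[OF W] unfolding is_basis_def by blast
  have "(\<Oplus>\<^bsub>M\<^esub>j\<in>I. restrict c I j \<odot>\<^bsub>M\<^esub> b j) = (\<Oplus>\<^bsub>M\<^esub>j\<in>I. c j \<odot>\<^bsub>M\<^esub> b j)"
    using b c by (intro M.finsum_cong') (auto simp: Pi_iff)
  moreover have "(\<Oplus>\<^bsub>M\<^esub>j\<in>I. (\<lambda>j\<in>I. \<zero>) j \<odot>\<^bsub>M\<^esub> b j) = \<zero>\<^bsub>M\<^esub>"
    using b by (intro M.finsum_eq_zero) auto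
  moreover have "restrict c I \<in> I \<rightarrow>\<^sub>E carrier R" "(\<lambda>j\<in>I. \<zero>) \<in> I \<rightarrow>\<^sub>E carrier R"
    using c by auto
  ultimately have "restrict c I = (\<lambda>j\<in>I. \<zero>)"
    using ex1 0 by metis
  thus "c i = \<zero>"
    using \<open>i \<in> I\<close> by (metis restrict_apply')
qed

lemma is_basis_span:
  assumes "is_basis R M W I b" "w \<in> W"
  shows "w \<in> lin_span R M I b"
proof -
  obtain c where c: "c \<in> I \<rightarrow>\<^sub>E carrier R" "w = (\<Oplus>\<^bsub>M\<^esub>j\<in>I. c j \<odot>\<^bsub>M\<^esub> b j)"
    using assms unfolding is_basis_def by blast
  have "c \<in> I \<rightarrow> carrier R"
    using c(1) by (simp add: PiE_def)
  thus ?thesis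
    unfolding c(2) by (rule lin_spanI)
qed

lemma lin_span_reindex:
  assumes "bij_betw g N I" "b \<in> I \<rightarrow> carrier M"
  shows "lin_span R M N (\<lambda>n. b (g n)) = lin_span R M I b"
proof -
  have inj: "inj_on g N" and img: "g ` N = I"
    using assms(1) by (auto simp: bij_betw_def)
  have re: "(\<Oplus>\<^bsub>M\<^esub>n\<in>N. c (g n) \<odot>\<^bsub>M\<^esub> b (g n)) = (\<Oplus>\<^bsub>M\<^esub>i\<in>I. c i \<odot>\<^bsub>M\<^esub> b i)" if "c \<in> I \<rightarrow> carrier R" for c
    using M.finsum_reindex[of "\<lambda>i. c i \<odot>\<^bsub>M\<^esub> b i" g N] that assms(2) inj
    unfolding img by (auto simp: Pi_iff)
  show ?thesis
  proof
    show "lin_span R M I b \<subseteq> lin_span R M N (\<lambda>n. b (g n))"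
    proof
      fix x assume "x \<in> lin_span R M I b"
      then obtain c where c: "c \<in> I \<rightarrow> carrier R" "x = (\<Oplus>\<^bsub>M\<^esub>i\<in>I. c i \<odot>\<^bsub>M\<^esub> b i)"
        by (rule lin_spanE)
      have "(\<lambda>n. c (g n)) \<in> N \<rightarrow> carrier R"
        using c(1) img by auto
      thus "x \<in> lin_span R M N (\<lambda>n. b (g n))"
        unfolding c(2) re[OF c(1), symmetric] by (rule lin_spanI)
    qed
    show "lin_span R M N (\<lambda>n. b (g n)) \<subseteq> lin_span R M I b"
    proof
      fix x assume "x \<in> lin_span R M N (\<lambda>n. b (g n))"
      then obtain c where c: "c \<in> N \<rightarrow> carrier R" "x = (\<Oplus>\<^bsub>M\<^esub>n\<in>N. c n \<odot>\<^bsub>M\<^esub> b (g n))"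
        by (rule lin_spanE)
      define d where "d = (\<lambda>i. c (the_inv_into N g i))"
      have d: "d (g n) = c n" if "n \<in> N" for n
        using that inj by (simp add: d_def the_inv_into_f_f)
      hence dc: "d \<in> I \<rightarrow> carrier R"
        using c(1) img by auto
      have "x = (\<Oplus>\<^bsub>M\<^esub>n\<in>N. d (g n) \<odot>\<^bsub>M\<^esub> b (g n))"
        unfolding c(2) using d c(1) assms(2) img by (intro M.finsum_cong') (auto simp: Pi_iff)
      thus "x \<in> lin_span R M I b"
        using re[OF dc] dc by (auto intro!: lin_spanI)
    qed
  qed
qed

lemma lin_indep_reindex:
  assumes g: "bij_betw g N I" and b: "b \<in> I \<rightarrow> carrier M" and ind: "lin_indep R M I b"
  shows "lin_indep R M N (\<lambda>n. b (g n))"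
  unfolding lin_indep_def
proof (intro ballI impI)
  have inj: "inj_on g N" and img: "g ` N = I"
    using g by (auto simp: bij_betw_def)
  fix c n assume c: "c \<in> N \<rightarrow> carrier R" and 0: "(\<Oplus>\<^bsub>M\<^esub>n\<in>N. c n \<odot>\<^bsub>M\<^esub> b (g n)) = \<zero>\<^bsub>M\<^esub>" and n: "n \<in> N"
  define d where "d = (\<lambda>i. c (the_inv_into N g i))"
  have d: "d (g n) = c n" if "n \<in> N" for n
    using that inj by (simp add: d_def the_inv_into_f_f)
  hence dc: "d \<in> I \<rightarrow> carrier R"
    using c img by auto
  have "(\<Oplus>\<^bsub>M\<^esub>i\<in>I. d i \<odot>\<^bsub>M\<^esub> b i) = (\<Oplus>\<^bsub>M\<^esub>n\<in>N. d (g n) \<odot>\<^bsub>M\<^esub> b (g n))"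
    using M.finsum_reindex[of "\<lambda>i. d i \<odot>\<^bsub>M\<^esub> b i" g N] dc b inj unfolding img by (auto simp: Pi_iff)
  also have "\<dots> = (\<Oplus>\<^bsub>M\<^esub>n\<in>N. c n \<odot>\<^bsub>M\<^esub> b (g n))"
    using d c b img by (intro M.finsum_cong') (auto simp: Pi_iff)
  finally have "\<forall>i\<in>I. d i = \<zero>"
    using ind dc 0 unfolding lin_indep_def by auto
  thus "c n = \<zero>"
    using d n img by auto
qed

end

text \<open>Gaussian elimination: eliminate one unknown with a nonzero coefficient in one equation.\<close>

lemma (in field) nontrivial_solution:
  assumes "finite I" "finite J" "card I < card J" "\<And>i j. \<lbrakk>i \<in> I; j \<in> J\<rbrakk> \<Longrightarrow> m i j \<in> carrier R"
  shows "\<exists>c \<in> J \<rightarrow> carrier R. (\<exists>j\<in>J. c j \<noteq> \<zero>) \<and> (\<forall>i\<in>I. (\<Oplus>j\<in>J. m i j \<otimes> c j) = \<zero>)"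
  using assms
proof (induction I arbitrary: J m rule: finite_induct)
  case empty
  hence "J \<noteq> {}" by auto
  thus ?case
    by (intro bexI[of _ "\<lambda>_. \<one>"]) auto
next
  case (insert i I)
  have m: "m k j \<in> carrier R" if "k \<in> insert i I" "j \<in> J" for k j
    using insert.prems that by blast
  show ?case
  proof (cases "\<forall>j\<in>J. m i j = \<zero>")
    case True
    have "card I < card J"
      using insert.prems insert.hyps by simp
    then obtain c where c: "c \<in> J \<rightarrow> carrier R" "\<exists>j\<in>J. c j \<noteq> \<zero>" "\<forall>k\<in>I. (\<Oplus>j\<in>J. m k j \<otimes> c j) = \<zero>"
      using insert.IH[OF insert.prems(1), of m] m by auto
    have "(\<Oplus>j\<in>J. m i j \<otimes> c j) = \<zero>"
      using True c(1) by (intro finsum_eq_zero) (auto simp: Pi_iff)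
    thus ?thesis
      using c by (intro bexI[of _ c]) auto
  next
    case False
    then obtain p where p: "p \<in> J" "m i p \<noteq> \<zero>" by auto
    define q where "q = inv (m i p)"
    have q: "q \<in> carrier R" "m i p \<otimes> q = \<one>"
      using p m[of i p] field_Units by (auto simp: q_def)
    define J' where "J' = J - {p}"
    have J': "finite J'" "card I < card J'" "p \<notin> J'" "insert p J' = J" "J' \<subseteq> J"
      using insert.prems insert.hyps p(1) by (auto simp: J'_def)
    \<comment> \<open>Solve equation \<open>i\<close> for the unknown \<open>p\<close> and substitute into the others.\<close>
    define m' where "m' = (\<lambda>k j. m k j \<ominus> (m k p \<otimes> q) \<otimes> m i j)"
    have m': "m' k j \<in> carrier R" if "k \<in> I" "j \<in> J'" for k j
      using that m p q J' by (auto simp: m'_def)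
    obtain c' where c': "c' \<in> J' \<rightarrow> carrier R" "\<exists>j\<in>J'. c' j \<noteq> \<zero>" "\<forall>k\<in>I. (\<Oplus>j\<in>J'. m' k j \<otimes> c' j) = \<zero>"
      using insert.IH[OF J'(1,2), of m'] m' by auto
    define s where "s = (\<lambda>k. \<Oplus>j\<in>J'. m k j \<otimes> c' j)"
    have mc: "m k j \<otimes> c' j \<in> carrier R" if "k \<in> insert i I" "j \<in> J'" for k j
      using that m c'(1) J' by auto
    have s: "s k \<in> carrier R" if "k \<in> insert i I" for k
      using that mc by (auto simp: s_def intro!: finsum_closed)
    define c where "c = (\<lambda>j. if j = p then \<ominus> (q \<otimes> s i) else c' j)"
    have c: "c \<in> J \<rightarrow> carrier R"
      using c'(1) q s J' by (auto simp: c_def)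
    have sum: "(\<Oplus>j\<in>J. m k j \<otimes> c j) = s k \<ominus> (m k p \<otimes> q) \<otimes> s i" if k: "k \<in> insert i I" for k
    proof -
      have "(\<Oplus>j\<in>J'. m k j \<otimes> c j) = s k"
        unfolding s_def using mc k J'(3) by (intro finsum_cong') (auto simp: c_def)
      hence "(\<Oplus>j\<in>J. m k j \<otimes> c j) = m k p \<otimes> c p \<oplus> s k"
        using J' k m c p(1) finsum_insert[OF J'(1,3), of "\<lambda>j. m k j \<otimes> c j"] by (auto simp: Pi_iff)
      also have "\<dots> = s k \<ominus> (m k p \<otimes> q) \<otimes> s i"
        using m[OF k p(1)] q(1) s[OF k] s[of i] by (simp add: c_def) algebra
      finally show ?thesis .
    qed
    have "(\<Oplus>j\<in>J. m k j \<otimes> c j) = \<zero>" if k: "k \<in> insert i I" for k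
    proof (cases "k = i")
      case True
      thus ?thesis
        using sum[of i] q s[of i] by simp
    next
      case False
      hence kI: "k \<in> I" using k by simp
      have "\<zero> = (\<Oplus>j\<in>J'. m' k j \<otimes> c' j)"
        using c'(3) kI by simp
      also have "\<dots> = (\<Oplus>j\<in>J'. m k j \<otimes> c' j \<oplus> (\<ominus> (m k p \<otimes> q)) \<otimes> (m i j \<otimes> c' j))"
      proof (rule finsum_cong')
        fix j assume j: "j \<in> J'"
        show "m' k j \<otimes> c' j = m k j \<otimes> c' j \<oplus> (\<ominus> (m k p \<otimes> q)) \<otimes> (m i j \<otimes> c' j)"
        proof -
          have "m k j \<in> carrier R" "m k p \<in> carrier R" "m i j \<in> carrier R" "c' j \<in> carrier R"
            using m j k p(1) c'(1) J'(5) by auto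
          with q(1) show ?thesis
            unfolding m'_def by algebra
        qed
      qed (use mc[OF k] mc[of i] m[OF k] p q in \<open>auto simp: Pi_iff\<close>)
      also have "\<dots> = s k \<oplus> (\<Oplus>j\<in>J'. (\<ominus> (m k p \<otimes> q)) \<otimes> (m i j \<otimes> c' j))"
        unfolding s_def
        by (rule finsum_addf) (use mc[OF k] mc[of i] m[OF k] p q in \<open>auto simp: Pi_iff\<close>)
      also have "(\<Oplus>j\<in>J'. (\<ominus> (m k p \<otimes> q)) \<otimes> (m i j \<otimes> c' j)) = (\<ominus> (m k p \<otimes> q)) \<otimes> s i"
        unfolding s_def using mc[of i] m[OF k p(1)] q(1) J'(1)
        by (intro finsum_rdistr [symmetric]) auto
      also have "s k \<oplus> (\<ominus> (m k p \<otimes> q)) \<otimes> s i = (\<Oplus>j\<in>J. m k j \<otimes> c j)"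
        using sum[OF k] m[OF k p(1)] q(1) s[OF k] s[of i] by simp algebra
      finally show ?thesis by simp
    qed
    moreover have "\<exists>j\<in>J. c j \<noteq> \<zero>"
      using c'(2) J' by (metis c_def subsetD)
    ultimately show ?thesis
      using c by (intro bexI[of _ c]) auto
  qed
qed

text \<open>A module over a field.\<close>

locale vector_space_over = module R M + field R for R (structure) and M (structure)
begin

lemma lin_indep_card_le:
  assumes I: "finite I" "b \<in> I \<rightarrow> carrier M"
    and J: "finite J" "y \<in> J \<rightarrow> lin_span R M I b" and ind: "lin_indep R M J y"
  shows "card J \<le> card I"
proof (rule ccontr)
  assume "\<not> card J \<le> card I"
  have "\<forall>j\<in>J. \<exists>c. c \<in> I \<rightarrow> carrier R \<and> y j = (\<Oplus>\<^bsub>M\<^esub>i\<in>I. c i \<odot>\<^bsub>M\<^esub> b i)"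
    using J(2) by (auto simp: lin_span_def)
  then obtain m where m: "\<forall>j\<in>J. m j \<in> I \<rightarrow> carrier R \<and> y j = (\<Oplus>\<^bsub>M\<^esub>i\<in>I. m j i \<odot>\<^bsub>M\<^esub> b i)"
    using bchoice by metis
  have mc: "m j i \<in> carrier R" if "i \<in> I" "j \<in> J" for i j
    using m that by auto
  have bc: "b i \<in> carrier M" if "i \<in> I" for i
    using I(2) that by auto
  have "card I < card J"
    using \<open>\<not> card J \<le> card I\<close> by simp
  from nontrivial_solution[OF I(1) J(1) this, of "\<lambda>i j. m j i"] mc
  obtain c where c: "c \<in> J \<rightarrow> carrier R" "\<exists>j\<in>J. c j \<noteq> \<zero>" "\<forall>i\<in>I. (\<Oplus>j\<in>J. m j i \<otimes> c j) = \<zero>"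
    by auto
  have cc: "c j \<in> carrier R" if "j \<in> J" for j
    using c(1) that by auto
  have "(\<Oplus>\<^bsub>M\<^esub>j\<in>J. c j \<odot>\<^bsub>M\<^esub> y j) = (\<Oplus>\<^bsub>M\<^esub>j\<in>J. \<Oplus>\<^bsub>M\<^esub>i\<in>I. (m j i \<otimes> c j) \<odot>\<^bsub>M\<^esub> b i)"
  proof (rule M.finsum_cong')
    fix j assume j: "j \<in> J"
    have "c j \<odot>\<^bsub>M\<^esub> y j = c j \<odot>\<^bsub>M\<^esub> (\<Oplus>\<^bsub>M\<^esub>i\<in>I. m j i \<odot>\<^bsub>M\<^esub> b i)"
      using m j by simp
    also have "\<dots> = (\<Oplus>\<^bsub>M\<^esub>i\<in>I. c j \<odot>\<^bsub>M\<^esub> (m j i \<odot>\<^bsub>M\<^esub> b i))"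
      using I(1) j mc bc cc by (intro finsum_smult_ldistr) auto
    also have "\<dots> = (\<Oplus>\<^bsub>M\<^esub>i\<in>I. (m j i \<otimes> c j) \<odot>\<^bsub>M\<^esub> b i)"
      using j mc bc cc by (intro M.finsum_cong') (auto simp: smult_assoc1 [symmetric] m_comm)
    finally show "c j \<odot>\<^bsub>M\<^esub> y j = (\<Oplus>\<^bsub>M\<^esub>i\<in>I. (m j i \<otimes> c j) \<odot>\<^bsub>M\<^esub> b i)" .
  qed (use mc bc cc in \<open>auto intro!: M.finsum_closed\<close>)
  also have "\<dots> = (\<Oplus>\<^bsub>M\<^esub>i\<in>I. \<Oplus>\<^bsub>M\<^esub>j\<in>J. (m j i \<otimes> c j) \<odot>\<^bsub>M\<^esub> b i)"
    using I J mc bc cc by (intro M.finsum_swap) auto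
  also have "\<dots> = \<zero>\<^bsub>M\<^esub>"
  proof (rule M.finsum_eq_zero)
    fix i assume i: "i \<in> I"
    have "(\<Oplus>\<^bsub>M\<^esub>j\<in>J. (m j i \<otimes> c j) \<odot>\<^bsub>M\<^esub> b i) = (\<Oplus>j\<in>J. m j i \<otimes> c j) \<odot>\<^bsub>M\<^esub> b i"
      using i J(1) mc bc cc by (intro finsum_smult [symmetric]) auto
    thus "(\<Oplus>\<^bsub>M\<^esub>j\<in>J. (m j i \<otimes> c j) \<odot>\<^bsub>M\<^esub> b i) = \<zero>\<^bsub>M\<^esub>"
      using i c(3) bc by simp
  qed
  finally show False
    using ind c unfolding lin_indep_def by blast
qed

lemma lin_span_has_basis:
  assumes "finite I" "b \<in> I \<rightarrow> carrier M"
  shows "\<exists>n g. is_basis R M (lin_span R M I b) {..<n::nat} g"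
  using assms
proof (induction I rule: finite_psubset_induct)
  case (psubset I)
  have bc: "b i \<in> carrier M" if "i \<in> I" for i
    using psubset.prems that by auto
  show ?case
  proof (cases "lin_indep R M I b")
    case True
    obtain g where g: "bij_betw g {..<card I} I"
      using ex_bij_betw_nat_finite[OF psubset.hyps(1)] by (auto simp: lessThan_atLeast0)
    have "(\<lambda>n. b (g n)) \<in> {..<card I} \<rightarrow> carrier M"
      using g bc by (auto simp: bij_betw_def)
    hence "is_basis R M (lin_span R M {..<card I} (\<lambda>n. b (g n))) {..<card I} (\<lambda>n. b (g n))"
      using lin_indep_reindex[OF g psubset.prems True] by (intro lin_span_is_basis) auto
    thus ?thesis
      unfolding lin_span_reindex[OF g psubset.prems] by blast
  next
    case False
    then obtain c k where c: "c \<in> I \<rightarrow> carrier R" "(\<Oplus>\<^bsub>M\<^esub>i\<in>I. c i \<odot>\<^bsub>M\<^esub> b i) = \<zero>\<^bsub>M\<^esub>" "k \<in> I" "c k \<noteq> \<zero>"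
      unfolding lin_indep_def by auto
    define I' where "I' = I - {k}"
    have I': "finite I'" "I' \<subset> I" "insert k I' = I" "k \<notin> I'" "b \<in> I' \<rightarrow> carrier M"
      using psubset c(3) by (auto simp: I'_def)
    note sub = lin_span_submodule[OF I'(1,5)]
    have cc: "c i \<in> carrier R" if "i \<in> I" for i
      using c(1) that by auto
    define z where "z = (\<Oplus>\<^bsub>M\<^esub>i\<in>I'. c i \<odot>\<^bsub>M\<^esub> b i)"
    have z: "z \<in> lin_span R M I' b" "z \<in> carrier M"
      using c(1) I'(2) cc bc by (auto simp: z_def intro!: lin_spanI M.finsum_closed)
    have q: "inv (c k) \<in> carrier R" "inv (c k) \<otimes> c k = \<one>"
      using c(3,4) cc[of k] field_Units by auto
    have "c k \<odot>\<^bsub>M\<^esub> b k \<oplus>\<^bsub>M\<^esub> z = \<zero>\<^bsub>M\<^esub>"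
      using c(2) M.finsum_insert[OF I'(1,4), of "\<lambda>i. c i \<odot>\<^bsub>M\<^esub> b i"] I'(3) cc bc
      by (auto simp: z_def Pi_iff)
    hence "c k \<odot>\<^bsub>M\<^esub> b k = \<ominus>\<^bsub>M\<^esub> z"
      using z(2) cc bc c(3) by (simp add: M.minus_equality [symmetric])
    hence "inv (c k) \<odot>\<^bsub>M\<^esub> (c k \<odot>\<^bsub>M\<^esub> b k) = inv (c k) \<odot>\<^bsub>M\<^esub> (\<ominus>\<^bsub>M\<^esub> z)"
      by simp
    hence "b k = inv (c k) \<odot>\<^bsub>M\<^esub> (\<ominus>\<^bsub>M\<^esub> z)"
      using q cc bc c(3) by (simp add: smult_assoc1 [symmetric])
    hence bk: "b k \<in> lin_span R M I' b"
      using submoduleE(3,4)[OF sub] q(1) z(1) by auto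
    have "lin_span R M I b \<subseteq> lin_span R M I' b"
      using bk I' by (intro lin_span_least[OF sub]) (auto intro!: lin_span_base)
    moreover have "lin_span R M I' b \<subseteq> lin_span R M I b"
      using I' psubset by (intro lin_span_least lin_span_submodule) (auto intro!: lin_span_base)
    ultimately have "lin_span R M I b = lin_span R M I' b" by simp
    thus ?thesis
      using psubset.IH[OF I'(2) I'(5)] by simp
  qed
qed

lemma lin_indep_card_le_basis:
  assumes W: "submodule W R M" and g: "is_basis R M W I g"
    and J: "finite J" "y \<in> J \<rightarrow> W" "lin_indep R M J y"
  shows "card J \<le> card I"
proof (rule lin_indep_card_le)
  show "finite I" "g \<in> I \<rightarrow> carrier M"
    using g submoduleE(1)[OF W] unfolding is_basis_def by auto
  show "y \<in> J \<rightarrow> lin_span R M I g"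
    using J(2) is_basis_span[OF g] by auto
qed fact+

lemma lin_indep_card_le_vdim:
  assumes I: "finite I" "b \<in> I \<rightarrow> carrier M"
    and J: "finite J" "y \<in> J \<rightarrow> lin_span R M I b" "lin_indep R M J y"
  shows "card J \<le> vdim R M (lin_span R M I b)"
proof -
  define W where "W = lin_span R M I b"
  have W: "submodule W R M"
    unfolding W_def by (rule lin_span_submodule[OF I])
  obtain n :: nat and g where g: "is_basis R M W {..<n} g"
    using lin_span_has_basis[OF I] unfolding W_def by auto
  have "vdim R M W = n"
    unfolding vdim_def
  proof (rule the_equality)
    show "\<exists>b. is_basis R M W {..<n} b"
      using g by auto
    fix k :: nat assume "\<exists>b. is_basis R M W {..<k} b"
    then obtain h where h: "is_basis R M W {..<k} h" by auto
    have "g \<in> {..<n} \<rightarrow> W" "h \<in> {..<k} \<rightarrow> W"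
      using g h unfolding is_basis_def by auto
    thus "k = n"
      using lin_indep_card_le_basis[OF W g _ _ is_basis_lin_indep[OF W h]]
        lin_indep_card_le_basis[OF W h _ _ is_basis_lin_indep[OF W g]] by simp
  qed
  thus ?thesis
    using lin_indep_card_le_basis[OF W g J(1) _ J(3)] J(2) unfolding W_def by simp
qed

end


section \<open>Coordinates\<close>

text \<open>The coordinates of \<open>a\<close> with respect to the family \<open>b\<close>; meaningful if \<open>b\<close> is a basis and
  \<open>a\<close> lies in its span.\<close>

definition coordinate ::
  "('r, 'y) ring_scheme \<Rightarrow> ('r, 'a, 'x) module_scheme \<Rightarrow> 'j set \<Rightarrow> ('j \<Rightarrow> 'a) \<Rightarrow> 'a \<Rightarrow> 'j \<Rightarrow> 'r" where
  "coordinate R A I b a =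
     (THE c. c \<in> I \<rightarrow>\<^sub>E carrier R \<and> a = (\<Oplus>\<^bsub>A\<^esub>j\<in>I. c j \<odot>\<^bsub>A\<^esub> b j))"

text \<open>A free module of finite rank with a chosen basis.\<close>

locale module_with_basis = module R M for R (structure) and M (structure) +
  fixes I :: "'j set" and b :: "'j \<Rightarrow> 'c"
  assumes basis: "is_basis R M (carrier M) I b"
begin

lemma index_finite: "finite I"
  and basis_closed: "i \<in> I \<Longrightarrow> b i \<in> carrier M"
proof -
  have "finite I \<and> b \<in> I \<rightarrow> carrier M"
    using basis unfolding is_basis_def by (elim conjE) (intro conjI)
  thus "finite I" "i \<in> I \<Longrightarrow> b i \<in> carrier M" by auto
qed

lemma coordinates_ex1:
  assumes "a \<in> carrier M"
  shows "\<exists>!c. c \<in> I \<rightarrow>\<^sub>E carrier R \<and> a = (\<Oplus>\<^bsub>M\<^esub>j\<in>I. c j \<odot>\<^bsub>M\<^esub> b j)"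
  using basis assms unfolding is_basis_def by (elim conjE) (rule bspec)

lemma coordinate_closed:
  assumes "a \<in> carrier M" "i \<in> I"
  shows "coordinate R M I b a i \<in> carrier R"
  using theI'[OF coordinates_ex1[OF assms(1)]] assms(2)
  unfolding coordinate_def by (auto simp: PiE_iff)

lemma coordinate_expansion:
  assumes "a \<in> carrier M"
  shows "(\<Oplus>\<^bsub>M\<^esub>i\<in>I. coordinate R M I b a i \<odot>\<^bsub>M\<^esub> b i) = a"
  using theI'[OF coordinates_ex1[OF assms]] unfolding coordinate_def by simp

lemma coordinate_finsum_basis:
  assumes "c \<in> I \<rightarrow> carrier R" "i \<in> I"
  shows "coordinate R M I b (\<Oplus>\<^bsub>M\<^esub>i\<in>I. c i \<odot>\<^bsub>M\<^esub> b i) i = c i"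
proof -
  define a where "a = (\<Oplus>\<^bsub>M\<^esub>i\<in>I. c i \<odot>\<^bsub>M\<^esub> b i)"
  have a: "a \<in> carrier M"
    using assms(1) basis_closed by (auto simp: a_def Pi_iff intro!: M.finsum_closed)
  have "a = (\<Oplus>\<^bsub>M\<^esub>i\<in>I. restrict c I i \<odot>\<^bsub>M\<^esub> b i)"
    unfolding a_def using assms(1) basis_closed by (intro M.finsum_cong') (auto simp: Pi_iff)
  hence "coordinate R M I b a = restrict c I"
    unfolding coordinate_def using assms(1)
    by (intro the1_equality[OF coordinates_ex1[OF a]]) auto
  thus ?thesis
    using assms(2) by (simp add: a_def)
qed

lemma coordinate_basis:
  assumes "i \<in> I" "j \<in> I"
  shows "coordinate R M I b (b j) i = (if i = j then \<one> else \<zero>)"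
proof -
  have "(\<Oplus>\<^bsub>M\<^esub>i\<in>I. (if i = j then \<one> else \<zero>) \<odot>\<^bsub>M\<^esub> b i) = b j"
    using assms index_finite basis_closed by (subst M.finsum_single[of I j]) auto
  thus ?thesis
    using coordinate_finsum_basis[of "\<lambda>i. if i = j then \<one> else \<zero>" i] assms by simp
qed

lemma coordinate_add:
  assumes a: "a \<in> carrier M" and a': "a' \<in> carrier M" and i: "i \<in> I"
  shows "coordinate R M I b (a \<oplus>\<^bsub>M\<^esub> a') i = coordinate R M I b a i \<oplus> coordinate R M I b a' i"
proof -
  let ?c = "coordinate R M I b"
  have "a \<oplus>\<^bsub>M\<^esub> a' = (\<Oplus>\<^bsub>M\<^esub>i\<in>I. ?c a i \<odot>\<^bsub>M\<^esub> b i) \<oplus>\<^bsub>M\<^esub> (\<Oplus>\<^bsub>M\<^esub>i\<in>I. ?c a' i \<odot>\<^bsub>M\<^esub> b i)"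
    using a a' by (simp add: coordinate_expansion)
  also have "\<dots> = (\<Oplus>\<^bsub>M\<^esub>i\<in>I. ?c a i \<odot>\<^bsub>M\<^esub> b i \<oplus>\<^bsub>M\<^esub> ?c a' i \<odot>\<^bsub>M\<^esub> b i)"
    using a a' coordinate_closed basis_closed by (intro M.finsum_addf [symmetric]) auto
  also have "\<dots> = (\<Oplus>\<^bsub>M\<^esub>i\<in>I. (?c a i \<oplus> ?c a' i) \<odot>\<^bsub>M\<^esub> b i)"
    using a a' coordinate_closed basis_closed by (intro M.finsum_cong') (auto simp: smult_l_distr)
  finally show ?thesis
    using a a' i coordinate_closed coordinate_finsum_basis[of "\<lambda>i. ?c a i \<oplus> ?c a' i" i] by simp
qed

lemma coordinate_smult:
  assumes r: "r \<in> carrier R" and a: "a \<in> carrier M" and i: "i \<in> I"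
  shows "coordinate R M I b (r \<odot>\<^bsub>M\<^esub> a) i = r \<otimes> coordinate R M I b a i"
proof -
  let ?c = "coordinate R M I b"
  have "r \<odot>\<^bsub>M\<^esub> a = r \<odot>\<^bsub>M\<^esub> (\<Oplus>\<^bsub>M\<^esub>i\<in>I. ?c a i \<odot>\<^bsub>M\<^esub> b i)"
    using a by (simp add: coordinate_expansion)
  also have "\<dots> = (\<Oplus>\<^bsub>M\<^esub>i\<in>I. r \<odot>\<^bsub>M\<^esub> (?c a i \<odot>\<^bsub>M\<^esub> b i))"
    using r a coordinate_closed basis_closed index_finite by (intro finsum_smult_ldistr) auto
  also have "\<dots> = (\<Oplus>\<^bsub>M\<^esub>i\<in>I. (r \<otimes> ?c a i) \<odot>\<^bsub>M\<^esub> b i)"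
    using r a coordinate_closed basis_closed by (intro M.finsum_cong') (auto simp: smult_assoc1)
  finally show ?thesis
    using r a i coordinate_closed coordinate_finsum_basis[of "\<lambda>i. r \<otimes> ?c a i" i] by simp
qed

end


section \<open>Associative algebras and their centers\<close>

context assoc_algebra
begin

lemma mult_finsum_left:
  assumes "finite I" "a \<in> carrier A" "f \<in> I \<rightarrow> carrier A"
  shows "a \<otimes>\<^bsub>A\<^esub> (\<Oplus>\<^bsub>A\<^esub>i\<in>I. f i) = (\<Oplus>\<^bsub>A\<^esub>i\<in>I. a \<otimes>\<^bsub>A\<^esub> f i)"
  by (rule additive_finsum[of A A "\<lambda>x. a \<otimes>\<^bsub>A\<^esub> x"])
     (use assms r_distr in \<open>auto intro: M.abelian_group_axioms\<close>)

text \<open>Preimages of submodules under left multiplications; with \<open>lin_span_least\<close> they replace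
  explicit linear expansions.\<close>

lemma submodule_left_mult:
  assumes K: "submodule K R A" and a: "a \<in> carrier A"
  shows "submodule {x \<in> carrier A. a \<otimes>\<^bsub>A\<^esub> x \<in> K} R A"
  by (rule submoduleI)
     (use submoduleE[OF K] submodule_zero[OF K] a in \<open>auto simp: r_distr smult_mult_right r_minus\<close>)

lemma submodule_diff:
  assumes K: "submodule K R A" and "a \<in> carrier A" "b \<in> K" "a \<ominus>\<^bsub>A\<^esub> b \<in> K"
  shows "a \<in> K"
proof -
  have b: "b \<in> carrier A"
    using assms(3) submoduleE(1)[OF K] by auto
  have "(a \<ominus>\<^bsub>A\<^esub> b) \<oplus>\<^bsub>A\<^esub> b = a"
    using assms(2) b by (simp add: M.minus_eq M.a_assoc M.l_neg)
  thus ?thesis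
    using submoduleE(5)[OF K assms(4,3)] by simp
qed


lemma center_submodule: "submodule (alg_center A) R A"
  by (rule submoduleI)
     (auto simp: alg_center_def l_distr r_distr l_minus r_minus smult_mult_left smult_mult_right)

lemma center_ring: "ring (A\<lparr>carrier := alg_center A\<rparr>)"
proof -
  have "subring (alg_center A) A"
  proof (rule ring.subringI)
    show "ring A" by (rule ring_axioms)
    show "\<And>h. h \<in> alg_center A \<Longrightarrow> \<ominus>\<^bsub>A\<^esub> h \<in> alg_center A"
      by (rule submoduleE(3)[OF center_submodule])
    show "\<And>g h. \<lbrakk>g \<in> alg_center A; h \<in> alg_center A\<rbrakk> \<Longrightarrow> g \<oplus>\<^bsub>A\<^esub> h \<in> alg_center A"
      by (rule submoduleE(5)[OF center_submodule])
    fix g h assume g: "g \<in> alg_center A" and h: "h \<in> alg_center A"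
    have gc: "g \<in> carrier A" "h \<in> carrier A"
      using g h by (auto simp: alg_center_def)
    have "(g \<otimes>\<^bsub>A\<^esub> h) \<otimes>\<^bsub>A\<^esub> a = a \<otimes>\<^bsub>A\<^esub> (g \<otimes>\<^bsub>A\<^esub> h)" if a: "a \<in> carrier A" for a
    proof -
      have "(g \<otimes>\<^bsub>A\<^esub> h) \<otimes>\<^bsub>A\<^esub> a = g \<otimes>\<^bsub>A\<^esub> (a \<otimes>\<^bsub>A\<^esub> h)"
        using a gc h by (simp add: m_assoc alg_center_def)
      also have "\<dots> = (a \<otimes>\<^bsub>A\<^esub> g) \<otimes>\<^bsub>A\<^esub> h"
        using a gc g by (simp add: m_assoc [symmetric] alg_center_def)
      finally show ?thesis
        using a gc by (simp add: m_assoc)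
    qed
    thus "g \<otimes>\<^bsub>A\<^esub> h \<in> alg_center A"
      using gc by (simp add: alg_center_def)
  qed (auto simp: alg_center_def)
  thus ?thesis
    by (rule subring_is_ring)
qed

end


section \<open>Cell modules and their characters\<close>

context cellular_algebra
begin

sublocale cell: module_with_basis R A "cell_index \<Lambda> M" "cell_family C"
  by unfold_locales (rule cellular_basis)

text \<open>The coefficient of \<open>a\<close> at the cellular basis element \<open>C l S T\<close>.\<close>

definition coef :: "'a \<Rightarrow> 'l \<Rightarrow> 's \<Rightarrow> 's \<Rightarrow> 'r" where
  "coef a l S T = coordinate R A (cell_index \<Lambda> M) (cell_family C) a (l, S, T)"

text \<open>The strict part of the partial order of \<open>\<Lambda>\<close>.\<close>

definition below :: "'l \<Rightarrow> 'l \<Rightarrow> bool" where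
  "below m l \<longleftrightarrow> (m, l) \<in> po \<and> m \<noteq> l"

text \<open>The span \<open>A(<l)\<close>.\<close>

abbreviation lower_part :: "'l \<Rightarrow> 'a set" where
  "lower_part l \<equiv> lower_span R A \<Lambda> po M C l"

lemma cell_index_iff [simp]: "(l, S, T) \<in> cell_index \<Lambda> M \<longleftrightarrow> l \<in> \<Lambda> \<and> S \<in> M l \<and> T \<in> M l"
  by (auto simp: cell_index_def)

lemma po_refl: "l \<in> \<Lambda> \<Longrightarrow> (l, l) \<in> po"
  and po_trans: "\<lbrakk>(k, l) \<in> po; (l, m) \<in> po\<rbrakk> \<Longrightarrow> (k, m) \<in> po"
  and po_antisym: "\<lbrakk>(k, l) \<in> po; (l, k) \<in> po\<rbrakk> \<Longrightarrow> k = l"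
  using finite_poset(2) unfolding partial_order_on_def preorder_on_def
  by (auto dest: refl_onD transD antisymD)

lemma C_closed [simp]: "\<lbrakk>l \<in> \<Lambda>; S \<in> M l; T \<in> M l\<rbrakk> \<Longrightarrow> C l S T \<in> carrier A"
  using cell.basis_closed[of "(l, S, T)"] by simp

lemma iota_closed [simp]: "a \<in> carrier A \<Longrightarrow> \<iota> a \<in> carrier A"
  using inv_closed by auto

lemma coef_closed [simp]:
  "\<lbrakk>a \<in> carrier A; l \<in> \<Lambda>; S \<in> M l; T \<in> M l\<rbrakk> \<Longrightarrow> coef a l S T \<in> carrier R"
  unfolding coef_def by (rule cell.coordinate_closed) auto

lemma coef_C:
  assumes "l \<in> \<Lambda>" "S \<in> M l" "T \<in> M l" "m \<in> \<Lambda>" "U \<in> M m" "V \<in> M m"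
  shows "coef (C l S T) m U V = (if l = m \<and> S = U \<and> T = V then \<one> else \<zero>)"
  using cell.coordinate_basis[of "(m, U, V)" "(l, S, T)"] assms by (auto simp: coef_def)

lemma coef_add:
  assumes "a \<in> carrier A" "b \<in> carrier A" "l \<in> \<Lambda>" "S \<in> M l" "T \<in> M l"
  shows "coef (a \<oplus>\<^bsub>A\<^esub> b) l S T = coef a l S T \<oplus> coef b l S T"
  using cell.coordinate_add[of a b "(l, S, T)"] assms by (simp add: coef_def)

lemma coef_smult:
  assumes "r \<in> carrier R" "a \<in> carrier A" "l \<in> \<Lambda>" "S \<in> M l" "T \<in> M l"
  shows "coef (r \<odot>\<^bsub>A\<^esub> a) l S T = r \<otimes> coef a l S T"
  using cell.coordinate_smult[of r a "(l, S, T)"] assms by (simp add: coef_def)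

lemma coef_finsum:
  assumes "finite I" "f \<in> I \<rightarrow> carrier A" "l \<in> \<Lambda>" "S \<in> M l" "T \<in> M l"
  shows "coef (\<Oplus>\<^bsub>A\<^esub>i\<in>I. f i) l S T = (\<Oplus>i\<in>I. coef (f i) l S T)"
  by (rule additive_finsum[of A R "\<lambda>a. coef a l S T"])
     (use assms in \<open>auto simp: coef_add intro: M.abelian_group_axioms R.abelian_group_axioms\<close>)

lemma coef_expansion:
  assumes "a \<in> carrier A"
  shows "(\<Oplus>\<^bsub>A\<^esub>j\<in>cell_index \<Lambda> M. case j of (l, S, T) \<Rightarrow> coef a l S T \<odot>\<^bsub>A\<^esub> C l S T) = a"
  using cell.coordinate_expansion[OF assms]
  by (simp add: coef_def case_prod_unfold)

lemma cell_index_finite: "finite (cell_index \<Lambda> M)"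
  by (rule cell.index_finite)

lemma coef_kernel_submodule:
  assumes "l \<in> \<Lambda>" "S \<in> M l" "T \<in> M l"
  shows "submodule {a \<in> carrier A. coef a l S T = \<zero>} R A"
proof (rule submoduleI)
  show 0: "\<zero>\<^bsub>A\<^esub> \<in> {a \<in> carrier A. coef a l S T = \<zero>}"
    using coef_smult[of \<zero> "\<zero>\<^bsub>A\<^esub>"] assms by simp
  fix a assume a: "a \<in> {a \<in> carrier A. coef a l S T = \<zero>}"
  have "coef (\<ominus>\<^bsub>A\<^esub> a \<oplus>\<^bsub>A\<^esub> a) l S T = \<zero>"
    using 0 a by (simp add: M.l_neg)
  thus "\<ominus>\<^bsub>A\<^esub> a \<in> {a \<in> carrier A. coef a l S T = \<zero>}"
    using a assms by (simp add: coef_add)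
qed (use assms in \<open>auto simp: coef_add coef_smult\<close>)

lemma coef_diff:
  assumes "a \<in> carrier A" "b \<in> carrier A" "l \<in> \<Lambda>" "S \<in> M l" "T \<in> M l"
  shows "coef (a \<ominus>\<^bsub>A\<^esub> b) l S T = coef a l S T \<ominus> coef b l S T"
proof -
  have "a \<ominus>\<^bsub>A\<^esub> b = a \<oplus>\<^bsub>A\<^esub> (\<ominus> \<one>) \<odot>\<^bsub>A\<^esub> b"
    using assms by (simp add: M.minus_eq smult_l_minus)
  thus ?thesis
    using assms by (simp add: coef_add coef_smult R.minus_eq R.l_minus)
qed

lemma span_all: "a \<in> carrier A \<Longrightarrow> a \<in> lin_span R A (cell_index \<Lambda> M) (cell_family C)"
  by (rule is_basis_span[OF cellular_basis])

lemma coef_iota: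
  assumes "a \<in> carrier A" "l \<in> \<Lambda>" "S \<in> M l" "T \<in> M l"
  shows "coef (\<iota> a) l S T = coef a l T S"
proof -
  let ?c = "\<lambda>(m, U, V). coef a m U V"
  have "\<iota> a = \<iota> (\<Oplus>\<^bsub>A\<^esub>j\<in>cell_index \<Lambda> M. ?c j \<odot>\<^bsub>A\<^esub> cell_family C j)"
    using coef_expansion[OF assms(1)] by (simp add: case_prod_unfold)
  also have "\<dots> = (\<Oplus>\<^bsub>A\<^esub>j\<in>cell_index \<Lambda> M. \<iota> (?c j \<odot>\<^bsub>A\<^esub> cell_family C j))"
    using cell_index_finite assms(1) inv_closed inv_add
    by (intro additive_finsum[of A A \<iota>] M.abelian_group_axioms) auto
  finally have eq: "\<iota> a = (\<Oplus>\<^bsub>A\<^esub>j\<in>cell_index \<Lambda> M. \<iota> (?c j \<odot>\<^bsub>A\<^esub> cell_family C j))" .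
  have "(\<lambda>j. \<iota> (?c j \<odot>\<^bsub>A\<^esub> cell_family C j)) \<in> cell_index \<Lambda> M \<rightarrow> carrier A"
    using assms(1) by auto
  hence "coef (\<iota> a) l S T
      = (\<Oplus>j\<in>cell_index \<Lambda> M. coef (\<iota> (?c j \<odot>\<^bsub>A\<^esub> cell_family C j)) l S T)"
    unfolding eq using cell_index_finite assms(2-4) by (intro coef_finsum)
  also have "\<dots> = coef (\<iota> (?c (l, T, S) \<odot>\<^bsub>A\<^esub> cell_family C (l, T, S))) l S T"
  proof (rule R.finsum_single)
    fix j assume "j \<in> cell_index \<Lambda> M" "j \<noteq> (l, T, S)"
    thus "coef (\<iota> (?c j \<odot>\<^bsub>A\<^esub> cell_family C j)) l S T = \<zero>"
      using assms by (cases j) (auto simp: inv_smult inv_basis coef_smult coef_C)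
  qed (use assms cell_index_finite in auto)
  also have "\<dots> = coef a l T S"
    using assms by (simp add: inv_smult inv_basis coef_smult coef_C)
  finally show ?thesis .
qed

lemma coef_lower:
  assumes "z \<in> lower_part l" "m \<in> \<Lambda>" "U \<in> M m" "V \<in> M m" "\<not> below m l"
  shows "coef z m U V = \<zero>"
proof -
  have "lower_part l \<subseteq> {a \<in> carrier A. coef a m U V = \<zero>}"
    unfolding lower_span_def using assms
    by (intro lin_span_least coef_kernel_submodule) (auto simp: cell_index_def coef_C below_def)
  thus ?thesis
    using assms(1) by auto
qed

lemma lower_submodule: "submodule (lower_part l) R A"
  unfolding lower_span_def
proof (rule lin_span_submodule)
  show "finite (cell_index {\<mu> \<in> \<Lambda>. (\<mu>, l) \<in> po \<and> \<mu> \<noteq> l} M)"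
    by (rule finite_subset[OF _ cell_index_finite]) (auto simp: cell_index_def)
qed (auto simp: cell_index_def)

lemma lower_subset:
  assumes "submodule K R A"
    and "\<And>m U V. \<lbrakk>m \<in> \<Lambda>; U \<in> M m; V \<in> M m; below m l\<rbrakk> \<Longrightarrow> C m U V \<in> K"
  shows "lower_part l \<subseteq> K"
  unfolding lower_span_def using assms
  by (intro lin_span_least) (auto simp: cell_index_def below_def)

lemma lowerI:
  assumes z: "z \<in> carrier A"
    and 0: "\<And>m U V. \<lbrakk>m \<in> \<Lambda>; U \<in> M m; V \<in> M m; \<not> below m l\<rbrakk> \<Longrightarrow> coef z m U V = \<zero>"
  shows "z \<in> lower_part l"
proof -
  have "(\<lambda>j. (case j of (m, U, V) \<Rightarrow> coef z m U V \<odot>\<^bsub>A\<^esub> C m U V)) \<in> cell_index \<Lambda> M \<rightarrow> lower_part l"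
  proof
    fix j assume "j \<in> cell_index \<Lambda> M"
    then obtain m U V where j: "j = (m, U, V)" "m \<in> \<Lambda>" "U \<in> M m" "V \<in> M m"
      by (cases j) auto
    show "(case j of (m, U, V) \<Rightarrow> coef z m U V \<odot>\<^bsub>A\<^esub> C m U V) \<in> lower_part l"
    proof (cases "below m l")
      case True
      let ?J = "cell_index {\<mu> \<in> \<Lambda>. (\<mu>, l) \<in> po \<and> \<mu> \<noteq> l} M"
      have "finite ?J"
        by (rule finite_subset[OF _ cell_index_finite]) (auto simp: cell_index_def)
      moreover have "cell_family C \<in> ?J \<rightarrow> carrier A"
        by (auto simp: cell_index_def)
      moreover have "(m, U, V) \<in> ?J"
        using True j by (auto simp: cell_index_def below_def)
      ultimately have "C m U V \<in> lower_part l"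
        unfolding lower_span_def using lin_span_base[of ?J "cell_family C" "(m, U, V)"] by simp
      thus ?thesis
        using j z submoduleE(4)[OF lower_submodule] by simp
    next
      case False
      thus ?thesis
        using j 0 submodule_zero[OF lower_submodule] by simp
    qed
  qed
  thus ?thesis
    using submodule_finsum[OF lower_submodule] coef_expansion[OF z] by fastforce
qed

text \<open>The straightening law, read off coefficientwise: outside \<open>A(<l)\<close>, left multiplication moves only
  the first index of \<open>C l S T\<close>, by a matrix that does not depend on \<open>T\<close>.\<close>

lemma left_action:
  assumes a: "a \<in> carrier A" and l: "l \<in> \<Lambda>"
  shows "\<exists>r. (\<forall>S\<in>M l. \<forall>T\<in>M l.
      (a \<otimes>\<^bsub>A\<^esub> C l S T) \<ominus>\<^bsub>A\<^esub> (\<Oplus>\<^bsub>A\<^esub>S'\<in>M l. r S' S \<odot>\<^bsub>A\<^esub> C l S' T) \<in> lower_part l) \<and>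
    (\<forall>S\<in>M l. \<forall>T\<in>M l. \<forall>m\<in>\<Lambda>. \<forall>U\<in>M m. \<forall>V\<in>M m. \<not> below m l \<longrightarrow>
    coef (a \<otimes>\<^bsub>A\<^esub> C l S T) m U V = (if m = l \<and> V = T then r U S else \<zero>))"
proof -
  obtain r where r: "r \<in> M l \<rightarrow> M l \<rightarrow> carrier R"
    and diff: "\<forall>S\<in>M l. \<forall>T\<in>M l.
          (a \<otimes>\<^bsub>A\<^esub> C l S T) \<ominus>\<^bsub>A\<^esub> (\<Oplus>\<^bsub>A\<^esub>S'\<in>M l. r S' S \<odot>\<^bsub>A\<^esub> C l S' T) \<in> lower_part l"
    using straightening[OF a l] by auto
  have rc: "r U S \<in> carrier R" if "U \<in> M l" "S \<in> M l" for U S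
    using r that by auto
  have "coef (a \<otimes>\<^bsub>A\<^esub> C l S T) m U V = (if m = l \<and> V = T then r U S else \<zero>)"
    if *: "S \<in> M l" "T \<in> M l" "m \<in> \<Lambda>" "U \<in> M m" "V \<in> M m" "\<not> below m l" for S T m U V
  proof -
    define s where "s = (\<Oplus>\<^bsub>A\<^esub>S'\<in>M l. r S' S \<odot>\<^bsub>A\<^esub> C l S' T)"
    define x where "x = a \<otimes>\<^bsub>A\<^esub> C l S T"
    have s: "s \<in> carrier A"
      using rc * l by (auto simp: s_def intro!: M.finsum_closed)
    have x: "x \<in> carrier A"
      using a * l by (simp add: x_def)
    have "coef x m U V = coef ((x \<ominus>\<^bsub>A\<^esub> s) \<oplus>\<^bsub>A\<^esub> s) m U V"
      using x s by (simp add: M.minus_eq M.a_assoc M.l_neg)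
    also have "\<dots> = coef (x \<ominus>\<^bsub>A\<^esub> s) m U V \<oplus> coef s m U V"
      using x s * by (intro coef_add) auto
    also have "coef (x \<ominus>\<^bsub>A\<^esub> s) m U V = \<zero>"
      using diff * by (intro coef_lower[of _ l]) (auto simp: x_def s_def)
    also have "coef s m U V = (\<Oplus>S'\<in>M l. coef (r S' S \<odot>\<^bsub>A\<^esub> C l S' T) m U V)"
      unfolding s_def using rc * l finite_M by (intro coef_finsum) auto
    also have "\<dots> = (\<Oplus>S'\<in>M l. r S' S \<otimes> (if m = l \<and> V = T \<and> S' = U then \<one> else \<zero>))"
      using rc * l by (intro R.finsum_cong') (auto simp: coef_smult coef_C)
    also have "\<dots> = (if m = l \<and> V = T then r U S else \<zero>)"
    proof (cases "m = l \<and> V = T")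
      case True
      thus ?thesis
        using * l rc finite_M by (subst R.finsum_single[of _ U]) auto
    next
      case False
      hence "(\<Oplus>S'\<in>M l. r S' S \<otimes> (if m = l \<and> V = T \<and> S' = U then \<one> else \<zero>)) = \<zero>"
        using * rc by (intro R.finsum_eq_zero) auto
      thus ?thesis using False by (simp only: if_False)
    qed
    finally show ?thesis
      using rc * l by (auto simp: x_def)
  qed
  thus ?thesis
    using diff by blast
qed

text \<open>The matrix \<open>r\<^sub>a(U, S)\<close> by which \<open>a\<close> acts on the cell module of \<open>l\<close>.  The second index \<open>T\<close> of the
  basis elements used here is arbitrary.\<close>

definition cell_rep :: "'l \<Rightarrow> 'a \<Rightarrow> 's \<Rightarrow> 's \<Rightarrow> 'r" where
  "cell_rep l a U S = (let T = (SOME T. T \<in> M l) in coef (a \<otimes>\<^bsub>A\<^esub> C l S T) l U T)"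

text \<open>The character of the cell module of \<open>l\<close>.\<close>

definition cell_char :: "'l \<Rightarrow> 'a \<Rightarrow> 'r" where
  "cell_char l a = (\<Oplus>S\<in>M l. cell_rep l a S S)"

lemma
  assumes a: "a \<in> carrier A" and l: "l \<in> \<Lambda>" "S \<in> M l" "T \<in> M l"
  shows coef_left_mult: "\<lbrakk>m \<in> \<Lambda>; U \<in> M m; V \<in> M m; \<not> below m l\<rbrakk> \<Longrightarrow>
      coef (a \<otimes>\<^bsub>A\<^esub> C l S T) m U V = (if m = l \<and> V = T then cell_rep l a U S else \<zero>)"
    and left_mult_congruence:
      "(a \<otimes>\<^bsub>A\<^esub> C l S T) \<ominus>\<^bsub>A\<^esub> (\<Oplus>\<^bsub>A\<^esub>S'\<in>M l. cell_rep l a S' S \<odot>\<^bsub>A\<^esub> C l S' T) \<in> lower_part l"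
proof -
  obtain r where diff: "\<forall>S\<in>M l. \<forall>T\<in>M l.
      (a \<otimes>\<^bsub>A\<^esub> C l S T) \<ominus>\<^bsub>A\<^esub> (\<Oplus>\<^bsub>A\<^esub>S'\<in>M l. r S' S \<odot>\<^bsub>A\<^esub> C l S' T) \<in> lower_part l"
    and r: "\<forall>S\<in>M l. \<forall>T\<in>M l. \<forall>m\<in>\<Lambda>. \<forall>U\<in>M m. \<forall>V\<in>M m. \<not> below m l \<longrightarrow>
      coef (a \<otimes>\<^bsub>A\<^esub> C l S T) m U V = (if m = l \<and> V = T then r U S else \<zero>)"
    using left_action[OF a l(1)] by blast
  define T0 where "T0 = (SOME T. T \<in> M l)"
  have T0: "T0 \<in> M l"
    unfolding T0_def using nonempty_M[OF l(1)] by (simp add: some_in_eq)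
  have rep: "cell_rep l a U S = r U S" if "U \<in> M l" for U
    using r l T0 that unfolding cell_rep_def Let_def T0_def[symmetric] by (simp add: below_def)
  show "coef (a \<otimes>\<^bsub>A\<^esub> C l S T) m U V = (if m = l \<and> V = T then cell_rep l a U S else \<zero>)"
    if "m \<in> \<Lambda>" "U \<in> M m" "V \<in> M m" "\<not> below m l"
    using r l that rep by auto
  have "cell_rep l a U S \<in> carrier R" if "U \<in> M l" for U
    unfolding cell_rep_def Let_def T0_def[symmetric] using a l T0 that by simp
  hence "(\<Oplus>\<^bsub>A\<^esub>S'\<in>M l. r S' S \<odot>\<^bsub>A\<^esub> C l S' T) = (\<Oplus>\<^bsub>A\<^esub>S'\<in>M l. cell_rep l a S' S \<odot>\<^bsub>A\<^esub> C l S' T)"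
    using l rep by (intro M.finsum_cong') auto
  thus "(a \<otimes>\<^bsub>A\<^esub> C l S T) \<ominus>\<^bsub>A\<^esub> (\<Oplus>\<^bsub>A\<^esub>S'\<in>M l. cell_rep l a S' S \<odot>\<^bsub>A\<^esub> C l S' T) \<in> lower_part l"
    using diff l by metis
qed

lemma coef_right_mult:
  assumes a: "a \<in> carrier A" and l: "l \<in> \<Lambda>" "S \<in> M l" "T \<in> M l"
    and m: "m \<in> \<Lambda>" "U \<in> M m" "V \<in> M m" "\<not> below m l"
  shows "coef (C l S T \<otimes>\<^bsub>A\<^esub> a) m U V = (if m = l \<and> U = S then cell_rep l (\<iota> a) V T else \<zero>)"
proof -
  have "coef (C l S T \<otimes>\<^bsub>A\<^esub> a) m U V = coef (\<iota> (C l S T \<otimes>\<^bsub>A\<^esub> a)) m V U"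
    using a l m by (simp add: coef_iota)
  also have "\<iota> (C l S T \<otimes>\<^bsub>A\<^esub> a) = \<iota> a \<otimes>\<^bsub>A\<^esub> C l T S"
    using a l by (simp add: inv_mult inv_basis)
  finally show ?thesis
    using a l m by (simp add: coef_left_mult)
qed

lemma cell_rep_closed [simp]:
  assumes "a \<in> carrier A" "l \<in> \<Lambda>" "U \<in> M l" "S \<in> M l"
  shows "cell_rep l a U S \<in> carrier R"
proof -
  have "cell_rep l a U S = coef (a \<otimes>\<^bsub>A\<^esub> C l S S) l U S"
    using assms by (subst coef_left_mult) (auto simp: below_def)
  thus ?thesis
    using assms by simp
qed

lemma cell_char_closed [simp]: "\<lbrakk>a \<in> carrier A; l \<in> \<Lambda>\<rbrakk> \<Longrightarrow> cell_char l a \<in> carrier R"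
  unfolding cell_char_def by (intro R.finsum_closed) auto

text \<open>The left ideal generated by \<open>C l S T\<close> lies in the span of the column of \<open>T\<close> and \<open>A(<l)\<close>; dually
  for right ideals and rows in \<open>right_mult_mem\<close>.\<close>

lemma left_mult_mem:
  assumes K: "submodule K R A" and low: "lower_part l \<subseteq> K"
    and l: "l \<in> \<Lambda>" "S \<in> M l" "T \<in> M l" and a: "a \<in> carrier A"
    and C: "\<And>S'. S' \<in> M l \<Longrightarrow> C l S' T \<in> K"
  shows "a \<otimes>\<^bsub>A\<^esub> C l S T \<in> K"
proof -
  have "(\<lambda>S'. cell_rep l a S' S \<odot>\<^bsub>A\<^esub> C l S' T) \<in> M l \<rightarrow> K"
    using C submoduleE(4)[OF K] a l by auto
  hence sum: "(\<Oplus>\<^bsub>A\<^esub>S'\<in>M l. cell_rep l a S' S \<odot>\<^bsub>A\<^esub> C l S' T) \<in> K"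
    by (rule submodule_finsum[OF K])
  show ?thesis
    by (rule submodule_diff[OF K _ sum subsetD[OF low left_mult_congruence[OF a l]]])
       (use a l in simp)
qed

lemma iota_submodule:
  assumes K: "submodule K R A"
  shows "submodule {x \<in> carrier A. \<iota> x \<in> K} R A"
proof (rule submoduleI)
  have neg: "\<iota> (\<ominus>\<^bsub>A\<^esub> x) = \<ominus>\<^bsub>A\<^esub> \<iota> x" if "x \<in> carrier A" for x
    using inv_smult[of "\<ominus> \<one>" x] that by (simp add: smult_l_minus)
  show "\<And>x. x \<in> {x \<in> carrier A. \<iota> x \<in> K} \<Longrightarrow> \<ominus>\<^bsub>A\<^esub> x \<in> {x \<in> carrier A. \<iota> x \<in> K}"
    using submoduleE(3)[OF K] neg by auto
  show "\<zero>\<^bsub>A\<^esub> \<in> {x \<in> carrier A. \<iota> x \<in> K}"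
    using inv_smult[of \<zero> "\<zero>\<^bsub>A\<^esub>"] submodule_zero[OF K] by simp
qed (use submoduleE[OF K] in \<open>auto simp: inv_add inv_smult\<close>)

lemma right_mult_mem:
  assumes K: "submodule K R A" and low: "lower_part l \<subseteq> K"
    and l: "l \<in> \<Lambda>" "S \<in> M l" "T \<in> M l" and a: "a \<in> carrier A"
    and C: "\<And>T'. T' \<in> M l \<Longrightarrow> C l S T' \<in> K"
  shows "C l S T \<otimes>\<^bsub>A\<^esub> a \<in> K"
proof -
  let ?K = "{x \<in> carrier A. \<iota> x \<in> K}"
  have "z \<in> ?K" if "z \<in> lower_part l" for z
  proof -
    have z: "z \<in> carrier A"
      using that submoduleE(1)[OF lower_submodule] by auto
    have "\<iota> z \<in> lower_part l"
      using z coef_lower[OF that] by (intro lowerI) (auto simp: coef_iota)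
    thus ?thesis
      using z low by auto
  qed
  hence "\<iota> a \<otimes>\<^bsub>A\<^esub> C l T S \<in> ?K"
    using C l a by (intro left_mult_mem[OF iota_submodule[OF K]]) (auto simp: inv_basis)
  thus ?thesis
    using l a by (simp add: inv_mult inv_inv inv_basis)
qed

lemma coef_left_mult_lower:
  assumes a: "a \<in> carrier A" and z: "z \<in> lower_part l" and l: "l \<in> \<Lambda>" "S \<in> M l" "T \<in> M l"
  shows "coef (a \<otimes>\<^bsub>A\<^esub> z) l S T = \<zero>"
proof -
  have "lower_part l \<subseteq> {x \<in> carrier A. a \<otimes>\<^bsub>A\<^esub> x \<in> {y \<in> carrier A. coef y l S T = \<zero>}}"
  proof (rule lower_subset)
    fix m U V assume m: "m \<in> \<Lambda>" "U \<in> M m" "V \<in> M m" "below m l"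
    hence "\<not> below l m" "l \<noteq> m"
      using po_antisym by (auto simp: below_def)
    thus "C m U V \<in> {x \<in> carrier A. a \<otimes>\<^bsub>A\<^esub> x \<in> {y \<in> carrier A. coef y l S T = \<zero>}}"
      using a l m by (simp add: coef_left_mult)
  qed (intro submodule_left_mult coef_kernel_submodule a l)
  thus ?thesis
    using z by auto
qed

lemma coef_mult_expansion:
  assumes a: "a \<in> carrier A" and b: "b \<in> carrier A" and l: "l \<in> \<Lambda>" "S \<in> M l" "T \<in> M l"
  shows "coef (a \<otimes>\<^bsub>A\<^esub> b) l S T =
    (\<Oplus>j\<in>cell_index \<Lambda> M. case j of (m, U, V) \<Rightarrow> coef b m U V \<otimes> coef (a \<otimes>\<^bsub>A\<^esub> C m U V) l S T)"
proof -
  let ?f = "\<lambda>j. case j of (m, U, V) \<Rightarrow> coef b m U V \<odot>\<^bsub>A\<^esub> C m U V"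
  have f: "?f \<in> cell_index \<Lambda> M \<rightarrow> carrier A"
    using b by auto
  have "a \<otimes>\<^bsub>A\<^esub> b = a \<otimes>\<^bsub>A\<^esub> (\<Oplus>\<^bsub>A\<^esub>j\<in>cell_index \<Lambda> M. ?f j)"
    using coef_expansion[OF b] by simp
  also have "\<dots> = (\<Oplus>\<^bsub>A\<^esub>j\<in>cell_index \<Lambda> M. a \<otimes>\<^bsub>A\<^esub> ?f j)"
    by (rule mult_finsum_left[OF cell_index_finite a f])
  also have "coef \<dots> l S T = (\<Oplus>j\<in>cell_index \<Lambda> M. coef (a \<otimes>\<^bsub>A\<^esub> ?f j) l S T)"
    by (rule coef_finsum[OF cell_index_finite _ l]) (use a b in auto)
  also have "\<dots> = (\<Oplus>j\<in>cell_index \<Lambda> M.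
      case j of (m, U, V) \<Rightarrow> coef b m U V \<otimes> coef (a \<otimes>\<^bsub>A\<^esub> C m U V) l S T)"
    by (rule R.finsum_cong') (use a b l in \<open>auto simp: smult_mult_right coef_smult\<close>)
  finally show ?thesis .
qed

text \<open>Both sides are the diagonal entries, in the cellular basis, of \<open>c \<mapsto> b c a\<close>.\<close>

lemma coef_two_sided_diagonal:
  assumes a: "a \<in> carrier A" and b: "b \<in> carrier A" and l: "l \<in> \<Lambda>" "S \<in> M l" "T \<in> M l"
  shows "coef (b \<otimes>\<^bsub>A\<^esub> (C l S T \<otimes>\<^bsub>A\<^esub> a)) l S T = cell_rep l b S S \<otimes> cell_rep l (\<iota> a) T T"
proof -
  let ?y = "C l S T \<otimes>\<^bsub>A\<^esub> a"
  let ?f = "\<lambda>(m, U, V). coef ?y m U V \<otimes> coef (b \<otimes>\<^bsub>A\<^esub> C m U V) l S T"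
  have "coef (b \<otimes>\<^bsub>A\<^esub> ?y) l S T = (\<Oplus>j\<in>cell_index \<Lambda> M. ?f j)"
    using a b l by (subst coef_mult_expansion) auto
  also have "\<dots> = ?f (l, S, T)"
  proof (rule R.finsum_single[OF cell_index_finite])
    fix j assume "j \<in> cell_index \<Lambda> M" "j \<noteq> (l, S, T)"
    then obtain m U V where j: "j = (m, U, V)" "m \<in> \<Lambda>" "U \<in> M m" "V \<in> M m" "(m, U, V) \<noteq> (l, S, T)"
      by (cases j) auto
    \<comment> \<open>A nonzero \<open>coef ?y m U V\<close> forces \<open>m < l\<close> or \<open>(m, U) = (l, S)\<close>; the second factor excludes the
      former and, in the latter case, forces \<open>V = T\<close>.\<close>
    show "?f j = \<zero>"
    proof (cases "below m l")
      case True
      hence "\<not> below l m" "l \<noteq> m"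
        using po_antisym by (auto simp: below_def)
      thus ?thesis
        using j a b l by (simp add: coef_left_mult)
    next
      case False
      show ?thesis
      proof (cases "m = l \<and> U = S")
        case True
        thus ?thesis
          using j a b l by (auto simp: coef_left_mult below_def)
      next
        case False
        thus ?thesis
          using j a b l \<open>\<not> below m l\<close> by (auto simp: coef_right_mult)
      qed
    qed
  qed (use a b l in auto)
  also have "\<dots> = cell_rep l b S S \<otimes> cell_rep l (\<iota> a) T T"
    using a b l by (simp add: coef_left_mult coef_right_mult below_def R.m_comm)
  finally show ?thesis .
qed

lemma cell_rep_mult:
  assumes a: "a \<in> carrier A" and b: "b \<in> carrier A" and l: "l \<in> \<Lambda>" and U: "U \<in> M l" and S: "S \<in> M l"
  shows "cell_rep l (a \<otimes>\<^bsub>A\<^esub> b) U S = (\<Oplus>S'\<in>M l. cell_rep l a U S' \<otimes> cell_rep l b S' S)"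
proof -
  define s where "s = (\<Oplus>\<^bsub>A\<^esub>S'\<in>M l. cell_rep l b S' S \<odot>\<^bsub>A\<^esub> C l S' S)"
  have s: "s \<in> carrier A"
    unfolding s_def using b l S by (auto intro!: M.finsum_closed)
  define n where "n = (b \<otimes>\<^bsub>A\<^esub> C l S S) \<ominus>\<^bsub>A\<^esub> s"
  have n: "n \<in> lower_part l"
    unfolding n_def s_def using left_mult_congruence[OF b l S S] by simp
  have nc: "n \<in> carrier A"
    using b l S s by (simp add: n_def)
  have "cell_rep l (a \<otimes>\<^bsub>A\<^esub> b) U S = coef ((a \<otimes>\<^bsub>A\<^esub> b) \<otimes>\<^bsub>A\<^esub> C l S S) l U S"
    using a b l U S by (subst coef_left_mult) (auto simp: below_def)
  also have "(a \<otimes>\<^bsub>A\<^esub> b) \<otimes>\<^bsub>A\<^esub> C l S S = a \<otimes>\<^bsub>A\<^esub> (n \<oplus>\<^bsub>A\<^esub> s)"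
    using a b l S s by (simp add: n_def M.minus_eq M.a_assoc M.l_neg m_assoc)
  also have "\<dots> = a \<otimes>\<^bsub>A\<^esub> n \<oplus>\<^bsub>A\<^esub> a \<otimes>\<^bsub>A\<^esub> s"
    using a nc s by (simp add: r_distr)
  also have "coef \<dots> l U S = coef (a \<otimes>\<^bsub>A\<^esub> s) l U S"
    using a nc s l U S coef_left_mult_lower[OF a n l U S] by (simp add: coef_add)
  also have "a \<otimes>\<^bsub>A\<^esub> s = (\<Oplus>\<^bsub>A\<^esub>S'\<in>M l. a \<otimes>\<^bsub>A\<^esub> (cell_rep l b S' S \<odot>\<^bsub>A\<^esub> C l S' S))"
    unfolding s_def using a b l S finite_M by (intro mult_finsum_left) auto
  also have "coef \<dots> l U S = (\<Oplus>S'\<in>M l. coef (a \<otimes>\<^bsub>A\<^esub> (cell_rep l b S' S \<odot>\<^bsub>A\<^esub> C l S' S)) l U S)"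
    using a b l U S finite_M by (intro coef_finsum) auto
  also have "\<dots> = (\<Oplus>S'\<in>M l. cell_rep l a U S' \<otimes> cell_rep l b S' S)"
    using a b l U S
    by (intro R.finsum_cong')
       (auto simp: smult_mult_right coef_smult coef_left_mult below_def R.m_comm)
  finally show ?thesis .
qed

lemma cell_char_comm:
  assumes "a \<in> carrier A" "b \<in> carrier A" "l \<in> \<Lambda>"
  shows "cell_char l (a \<otimes>\<^bsub>A\<^esub> b) = cell_char l (b \<otimes>\<^bsub>A\<^esub> a)"
proof -
  have "cell_char l (a \<otimes>\<^bsub>A\<^esub> b) = (\<Oplus>S\<in>M l. \<Oplus>T\<in>M l. cell_rep l a S T \<otimes> cell_rep l b T S)"
    unfolding cell_char_def using assms
    by (intro R.finsum_cong') (auto simp: cell_rep_mult intro!: R.finsum_closed)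
  also have "\<dots> = (\<Oplus>T\<in>M l. \<Oplus>S\<in>M l. cell_rep l a S T \<otimes> cell_rep l b T S)"
    using assms finite_M by (intro R.finsum_swap) auto
  also have "\<dots> = (\<Oplus>T\<in>M l. \<Oplus>S\<in>M l. cell_rep l b T S \<otimes> cell_rep l a S T)"
    using assms by (intro R.finsum_cong') (auto simp: R.m_comm intro!: R.finsum_closed)
  also have "\<dots> = cell_char l (b \<otimes>\<^bsub>A\<^esub> a)"
    unfolding cell_char_def using assms
    by (intro R.finsum_cong') (auto simp: cell_rep_mult intro!: R.finsum_closed)
  finally show ?thesis .
qed

text \<open>Left multiplication leaves \<open>T\<close> fixed and right multiplication leaves \<open>S\<close> fixed, so the matrix of a
  central element has no entries off the diagonal, and its diagonal entries agree.\<close>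

lemma central_cell_rep:
  assumes z: "z \<in> alg_center A" and l: "l \<in> \<Lambda>"
  shows "\<exists>c\<in>carrier R. \<forall>U\<in>M l. \<forall>S\<in>M l. cell_rep l z U S = (if U = S then c else \<zero>)"
proof -
  have zc: "z \<in> carrier A"
    using z by (simp add: alg_center_def)
  have comm: "z \<otimes>\<^bsub>A\<^esub> C l S T = C l S T \<otimes>\<^bsub>A\<^esub> z" if "S \<in> M l" "T \<in> M l" for S T
    using z l that by (simp add: alg_center_def)
  have eq: "cell_rep l z U S = (if U = S then cell_rep l (\<iota> z) T T else \<zero>)"
    if "U \<in> M l" "S \<in> M l" "T \<in> M l" for U S T
    using coef_left_mult[OF zc l that(2,3) l that(1,3)] coef_right_mult[OF zc l that(2,3) l that(1,3)]
      comm[OF that(2,3)] by (simp add: below_def)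
  obtain T where "T \<in> M l"
    using nonempty_M[OF l] by auto
  thus ?thesis
    using eq[OF _ _ \<open>T \<in> M l\<close>] zc l by (intro bexI[of _ "cell_rep l (\<iota> z) T T"]) simp_all
qed

lemma cell_char_central:
  assumes z: "z \<in> alg_center A" and l: "l \<in> \<Lambda>"
  shows "\<exists>c\<in>carrier R. \<forall>a\<in>carrier A. cell_char l (a \<otimes>\<^bsub>A\<^esub> z) = c \<otimes> cell_char l a"
proof -
  obtain c where c: "c \<in> carrier R"
    "\<And>U S. \<lbrakk>U \<in> M l; S \<in> M l\<rbrakk> \<Longrightarrow> cell_rep l z U S = (if U = S then c else \<zero>)"
    using central_cell_rep[OF z l] by auto
  have zc: "z \<in> carrier A"
    using z by (simp add: alg_center_def)
  have "cell_char l (a \<otimes>\<^bsub>A\<^esub> z) = c \<otimes> cell_char l a" if a: "a \<in> carrier A" for a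
  proof -
    have rep: "cell_rep l (a \<otimes>\<^bsub>A\<^esub> z) S S = c \<otimes> cell_rep l a S S" if S: "S \<in> M l" for S
    proof -
      have "cell_rep l (a \<otimes>\<^bsub>A\<^esub> z) S S = (\<Oplus>S'\<in>M l. cell_rep l a S S' \<otimes> cell_rep l z S' S)"
        using a zc l S by (intro cell_rep_mult)
      also have "\<dots> = cell_rep l a S S \<otimes> cell_rep l z S S"
        using a zc l S finite_M c by (intro R.finsum_single) auto
      finally show ?thesis
        using c a l S by (simp add: R.m_comm)
    qed
    have "cell_char l (a \<otimes>\<^bsub>A\<^esub> z) = (\<Oplus>S\<in>M l. c \<otimes> cell_rep l a S S)"
      unfolding cell_char_def using rep c a l by (intro R.finsum_cong') auto
    also have "\<dots> = c \<otimes> cell_char l a"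
      unfolding cell_char_def using c a l finite_M by (intro R.finsum_rdistr [symmetric]) auto
    finally show ?thesis .
  qed
  thus ?thesis
    using c(1) by blast
qed

text \<open>The triangularity behind the linear independence of the \<open>x\<^sub>\<lambda>\<close>.\<close>

lemma cell_char_C_zero:
  assumes l: "l \<in> \<Lambda>" and m: "m \<in> \<Lambda>" "S \<in> M m" "T \<in> M m" and "(l, m) \<notin> po"
  shows "cell_char l (C m S T) = \<zero>"
  unfolding cell_char_def
proof (rule R.finsum_eq_zero)
  fix Q assume Q: "Q \<in> M l"
  have "l \<noteq> m" "\<not> below l m"
    using assms(5) po_refl[OF l] by (auto simp: below_def)
  have "cell_rep l (C m S T) Q Q = coef (C m S T \<otimes>\<^bsub>A\<^esub> C l Q Q) l Q Q"
    using l m Q by (subst coef_left_mult) (auto simp: below_def)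
  also have "\<dots> = \<zero>"
    using l m Q \<open>l \<noteq> m\<close> \<open>\<not> below l m\<close> by (subst coef_right_mult) auto
  finally show "cell_rep l (C m S T) Q Q = \<zero>" .
qed

text \<open>The bilinear form of the cell module is given by the values of its character.\<close>

lemma cell_rep_C:
  assumes l: "l \<in> \<Lambda>" and Q: "U \<in> M l" "P \<in> M l" "Q \<in> M l" "S \<in> M l"
  shows "cell_rep l (C l U P) Q S = (if Q = U then cell_char l (C l S P) else \<zero>)"
proof -
  have eq: "cell_rep l (C l U P) Q S = (if Q = U then cell_rep l (C l T S) T P else \<zero>)"
    if "U \<in> M l" "P \<in> M l" "Q \<in> M l" "S \<in> M l" "T \<in> M l" for U P Q S T
  proof -
    have "cell_rep l (C l U P) Q S = coef (C l U P \<otimes>\<^bsub>A\<^esub> C l S T) l Q T"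
      using l that by (subst coef_left_mult) (auto simp: below_def)
    also have "\<dots> = (if Q = U then cell_rep l (C l T S) T P else \<zero>)"
      using l that by (subst coef_right_mult) (auto simp: below_def inv_basis)
    finally show ?thesis .
  qed
  have "cell_char l (C l S P) = cell_rep l (C l S P) S S"
    unfolding cell_char_def
    using eq[of S P _ _ S] l Q finite_M by (intro R.finsum_single) auto
  also have "\<dots> = cell_rep l (C l S S) S P"
    using eq[of S P S S S] Q by simp
  also have "(if Q = U then \<dots> else \<zero>) = cell_rep l (C l U P) Q S"
    using eq[of U P Q S S] Q by simp
  finally show ?thesis by simp
qed

lemma C_mult_C:
  assumes l: "l \<in> \<Lambda>" "U \<in> M l" "P \<in> M l" "S \<in> M l" "T \<in> M l"
  shows "C l U P \<otimes>\<^bsub>A\<^esub> C l S T \<ominus>\<^bsub>A\<^esub> cell_char l (C l S P) \<odot>\<^bsub>A\<^esub> C l U T \<in> lower_part l"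
proof (rule lowerI)
  let ?x = "C l U P \<otimes>\<^bsub>A\<^esub> C l S T" and ?y = "cell_char l (C l S P) \<odot>\<^bsub>A\<^esub> C l U T"
  fix m Q Y assume m: "m \<in> \<Lambda>" "Q \<in> M m" "Y \<in> M m" "\<not> below m l"
  have "coef ?x m Q Y = coef ?y m Q Y"
    using l m by (auto simp: coef_left_mult cell_rep_C coef_smult coef_C)
  thus "coef (?x \<ominus>\<^bsub>A\<^esub> ?y) m Q Y = \<zero>"
    using l m by (simp add: coef_diff)
qed (use l in auto)

end


section \<open>The elements \<open>x\<^sub>\<lambda>\<close> as duals of the cell characters\<close>

text \<open>A cellular algebra with a symmetrizing trace and the corresponding dual basis.\<close>

locale symmetric_cellular_algebra = cellular_algebra R A \<Lambda> po M C \<iota>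
  for R :: "('r, 'y) ring_scheme" (structure) and A :: "('r, 'a, 'x) module_scheme" (structure)
    and \<Lambda> :: "'l set" and po :: "'l rel" and M :: "'l \<Rightarrow> 's set"
    and C :: "'l \<Rightarrow> 's \<Rightarrow> 's \<Rightarrow> 'a" and \<iota> :: "'a \<Rightarrow> 'a" +
  fixes \<tau> :: "'a \<Rightarrow> 'r" and D :: "'l \<Rightarrow> 's \<Rightarrow> 's \<Rightarrow> 'a"
  assumes trace: "symmetrizing_trace R A \<tau>"
    and dual: "dual_cell_basis R A \<Lambda> M C \<tau> D"
begin

lemma
  shows tr_closed [simp]: "a \<in> carrier A \<Longrightarrow> \<tau> a \<in> carrier R"
    and tr_add: "\<lbrakk>a \<in> carrier A; b \<in> carrier A\<rbrakk> \<Longrightarrow> \<tau> (a \<oplus>\<^bsub>A\<^esub> b) = \<tau> a \<oplus> \<tau> b"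
    and tr_smult: "\<lbrakk>r \<in> carrier R; a \<in> carrier A\<rbrakk> \<Longrightarrow> \<tau> (r \<odot>\<^bsub>A\<^esub> a) = r \<otimes> \<tau> a"
    and tr_comm: "\<lbrakk>a \<in> carrier A; b \<in> carrier A\<rbrakk> \<Longrightarrow> \<tau> (a \<otimes>\<^bsub>A\<^esub> b) = \<tau> (b \<otimes>\<^bsub>A\<^esub> a)"
proof -
  obtain f where f: "symmetrizing_form R A f" and \<tau>: "\<forall>a\<in>carrier A. \<tau> a = f a \<one>\<^bsub>A\<^esub>"
    using trace unfolding symmetrizing_trace_def by blast
  have closed: "f \<in> carrier A \<rightarrow> carrier A \<rightarrow> carrier R"
    and add: "\<forall>a\<in>carrier A. \<forall>b\<in>carrier A. \<forall>c\<in>carrier A. f (a \<oplus>\<^bsub>A\<^esub> b) c = f a c \<oplus> f b c"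
    and smult: "\<forall>r\<in>carrier R. \<forall>a\<in>carrier A. \<forall>b\<in>carrier A. f (r \<odot>\<^bsub>A\<^esub> a) b = r \<otimes> f a b"
    and sym: "\<forall>a\<in>carrier A. \<forall>b\<in>carrier A. f a b = f b a"
    and assoc: "\<forall>a\<in>carrier A. \<forall>b\<in>carrier A. \<forall>c\<in>carrier A.
      f (a \<otimes>\<^bsub>A\<^esub> b) c = f a (b \<otimes>\<^bsub>A\<^esub> c)"
    using f unfolding symmetrizing_form_def by - (elim conjE, assumption)+
  show "a \<in> carrier A \<Longrightarrow> \<tau> a \<in> carrier R"
    using closed \<tau> by auto
  show "\<lbrakk>a \<in> carrier A; b \<in> carrier A\<rbrakk> \<Longrightarrow> \<tau> (a \<oplus>\<^bsub>A\<^esub> b) = \<tau> a \<oplus> \<tau> b"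
    using add \<tau> by simp
  show "\<lbrakk>r \<in> carrier R; a \<in> carrier A\<rbrakk> \<Longrightarrow> \<tau> (r \<odot>\<^bsub>A\<^esub> a) = r \<otimes> \<tau> a"
    using smult \<tau> by simp
  have prod: "\<tau> (a \<otimes>\<^bsub>A\<^esub> b) = f a b" if "a \<in> carrier A" "b \<in> carrier A" for a b
    using assoc \<tau> that by simp
  show "\<lbrakk>a \<in> carrier A; b \<in> carrier A\<rbrakk> \<Longrightarrow> \<tau> (a \<otimes>\<^bsub>A\<^esub> b) = \<tau> (b \<otimes>\<^bsub>A\<^esub> a)"
    using prod sym by simp
qed

lemma tr_finsum:
  assumes "finite I" "f \<in> I \<rightarrow> carrier A"
  shows "\<tau> (\<Oplus>\<^bsub>A\<^esub>i\<in>I. f i) = (\<Oplus>i\<in>I. \<tau> (f i))"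
  by (rule additive_finsum[of A R \<tau>])
     (use assms in \<open>auto simp: tr_add intro: M.abelian_group_axioms R.abelian_group_axioms\<close>)

lemma dual_basis: "is_basis R A (carrier A) (cell_index \<Lambda> M) (cell_family D)"
  using dual unfolding dual_cell_basis_def by (rule conjunct1)

sublocale dual: module_with_basis R A "cell_index \<Lambda> M" "cell_family D"
  by unfold_locales (rule dual_basis)

lemma D_closed [simp]: "\<lbrakk>l \<in> \<Lambda>; S \<in> M l; T \<in> M l\<rbrakk> \<Longrightarrow> D l S T \<in> carrier A"
  using dual.basis_closed[of "(l, S, T)"] by simp

lemma tr_C_D:
  assumes "l \<in> \<Lambda>" "S \<in> M l" "T \<in> M l" "m \<in> \<Lambda>" "U \<in> M m" "V \<in> M m"
  shows "\<tau> (C l S T \<otimes>\<^bsub>A\<^esub> D m U V) = (if l = m \<and> S = U \<and> T = V then \<one> else \<zero>)"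
  using dual assms unfolding dual_cell_basis_def by blast

lemma linear_functional_equalizer_submodule:
  assumes "\<And>a. a \<in> carrier A \<Longrightarrow> g a \<in> carrier R" "\<And>a. a \<in> carrier A \<Longrightarrow> h a \<in> carrier R"
    and "\<And>a b. \<lbrakk>a \<in> carrier A; b \<in> carrier A\<rbrakk> \<Longrightarrow> g (a \<oplus>\<^bsub>A\<^esub> b) = g a \<oplus> g b"
    and "\<And>a b. \<lbrakk>a \<in> carrier A; b \<in> carrier A\<rbrakk> \<Longrightarrow> h (a \<oplus>\<^bsub>A\<^esub> b) = h a \<oplus> h b"
    and g: "\<And>r a. \<lbrakk>r \<in> carrier R; a \<in> carrier A\<rbrakk> \<Longrightarrow> g (r \<odot>\<^bsub>A\<^esub> a) = r \<otimes> g a"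
    and h: "\<And>r a. \<lbrakk>r \<in> carrier R; a \<in> carrier A\<rbrakk> \<Longrightarrow> h (r \<odot>\<^bsub>A\<^esub> a) = r \<otimes> h a"
  shows "submodule {a \<in> carrier A. g a = h a} R A"
proof (rule submoduleI)
  show "\<zero>\<^bsub>A\<^esub> \<in> {a \<in> carrier A. g a = h a}"
    using g[of \<zero> "\<zero>\<^bsub>A\<^esub>"] h[of \<zero> "\<zero>\<^bsub>A\<^esub>"] assms(1,2) by simp
  show "\<ominus>\<^bsub>A\<^esub> a \<in> {a \<in> carrier A. g a = h a}" if "a \<in> {a \<in> carrier A. g a = h a}" for a
    using g[of "\<ominus> \<one>" a] h[of "\<ominus> \<one>" a] that by (simp add: smult_l_minus)
qed (use assms in auto)

text \<open>Linear functionals that agree on the cellular basis are equal.\<close>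

lemma linear_functional_eqI:
  assumes "\<And>a. a \<in> carrier A \<Longrightarrow> g a \<in> carrier R" "\<And>a. a \<in> carrier A \<Longrightarrow> h a \<in> carrier R"
    and "\<And>a b. \<lbrakk>a \<in> carrier A; b \<in> carrier A\<rbrakk> \<Longrightarrow> g (a \<oplus>\<^bsub>A\<^esub> b) = g a \<oplus> g b"
    and "\<And>a b. \<lbrakk>a \<in> carrier A; b \<in> carrier A\<rbrakk> \<Longrightarrow> h (a \<oplus>\<^bsub>A\<^esub> b) = h a \<oplus> h b"
    and "\<And>r a. \<lbrakk>r \<in> carrier R; a \<in> carrier A\<rbrakk> \<Longrightarrow> g (r \<odot>\<^bsub>A\<^esub> a) = r \<otimes> g a"
    and "\<And>r a. \<lbrakk>r \<in> carrier R; a \<in> carrier A\<rbrakk> \<Longrightarrow> h (r \<odot>\<^bsub>A\<^esub> a) = r \<otimes> h a"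
    and C: "\<And>l S T. \<lbrakk>l \<in> \<Lambda>; S \<in> M l; T \<in> M l\<rbrakk> \<Longrightarrow> g (C l S T) = h (C l S T)"
    and a: "a \<in> carrier A"
  shows "g a = h a"
proof -
  have "lin_span R A (cell_index \<Lambda> M) (cell_family C) \<subseteq> {a \<in> carrier A. g a = h a}"
    by (rule lin_span_least) (use assms in \<open>auto intro: linear_functional_equalizer_submodule\<close>)
  thus ?thesis
    using span_all[OF a] by auto
qed

lemma tr_mult_D:
  assumes "a \<in> carrier A" "l \<in> \<Lambda>" "S \<in> M l" "T \<in> M l"
  shows "\<tau> (a \<otimes>\<^bsub>A\<^esub> D l S T) = coef a l S T"
  by (rule linear_functional_eqI[where g = "\<lambda>a. \<tau> (a \<otimes>\<^bsub>A\<^esub> D l S T)" and h = "\<lambda>a. coef a l S T"])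
     (use assms in \<open>auto simp: l_distr tr_add coef_add smult_mult_left tr_smult coef_smult tr_C_D coef_C\<close>)

lemma tr_C_mult:
  assumes "z \<in> carrier A" "l \<in> \<Lambda>" "S \<in> M l" "T \<in> M l"
  shows "\<tau> (C l S T \<otimes>\<^bsub>A\<^esub> z) = coordinate R A (cell_index \<Lambda> M) (cell_family D) z (l, S, T)"
proof -
  define d where "d = coordinate R A (cell_index \<Lambda> M) (cell_family D) z"
  have d: "d j \<in> carrier R" if "j \<in> cell_index \<Lambda> M" for j
    unfolding d_def using that assms(1) by (rule dual.coordinate_closed [rotated])
  have Dj: "cell_family D j \<in> carrier A" if "j \<in> cell_index \<Lambda> M" for j
    using that by (rule dual.basis_closed)
  have "C l S T \<otimes>\<^bsub>A\<^esub> z = C l S T \<otimes>\<^bsub>A\<^esub> (\<Oplus>\<^bsub>A\<^esub>j\<in>cell_index \<Lambda> M. d j \<odot>\<^bsub>A\<^esub> cell_family D j)"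
    unfolding d_def using dual.coordinate_expansion[OF assms(1)] by simp
  also have "\<dots> = (\<Oplus>\<^bsub>A\<^esub>j\<in>cell_index \<Lambda> M. C l S T \<otimes>\<^bsub>A\<^esub> (d j \<odot>\<^bsub>A\<^esub> cell_family D j))"
    by (rule mult_finsum_left) (use cell_index_finite d Dj assms in auto)
  also have "\<tau> \<dots> = (\<Oplus>j\<in>cell_index \<Lambda> M. \<tau> (C l S T \<otimes>\<^bsub>A\<^esub> (d j \<odot>\<^bsub>A\<^esub> cell_family D j)))"
    by (rule tr_finsum) (use cell_index_finite d Dj assms in auto)
  also have "\<dots> = \<tau> (C l S T \<otimes>\<^bsub>A\<^esub> (d (l, S, T) \<odot>\<^bsub>A\<^esub> cell_family D (l, S, T)))"
  proof (rule R.finsum_single)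
    fix j assume j: "j \<in> cell_index \<Lambda> M" "j \<noteq> (l, S, T)"
    thus "\<tau> (C l S T \<otimes>\<^bsub>A\<^esub> (d j \<odot>\<^bsub>A\<^esub> cell_family D j)) = \<zero>"
      using assms d[OF j(1)] by (cases j) (auto simp: smult_mult_right tr_smult tr_C_D)
  qed (use cell_index_finite d Dj assms in auto)
  also have "\<dots> = d (l, S, T)"
    using assms d[of "(l, S, T)"] by (simp add: smult_mult_right tr_smult tr_C_D)
  finally show ?thesis
    by (simp add: d_def)
qed

text \<open>Nondegeneracy of the trace form; it follows from the existence of the dual basis, without the
  determinant.\<close>

lemma tr_eqI:
  assumes z: "z \<in> carrier A" and w: "w \<in> carrier A"
    and eq: "\<And>a. a \<in> carrier A \<Longrightarrow> \<tau> (a \<otimes>\<^bsub>A\<^esub> z) = \<tau> (a \<otimes>\<^bsub>A\<^esub> w)"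
  shows "z = w"
proof -
  let ?d = "coordinate R A (cell_index \<Lambda> M) (cell_family D)"
  have "?d z j = ?d w j" if j: "j \<in> cell_index \<Lambda> M" for j
  proof -
    obtain l S T where lST: "j = (l, S, T)" "l \<in> \<Lambda>" "S \<in> M l" "T \<in> M l"
      using j by (cases j) auto
    show ?thesis
      using eq[OF C_closed[OF lST(2-4)]] tr_C_mult[OF z lST(2-4)] tr_C_mult[OF w lST(2-4)] lST(1)
      by simp
  qed
  hence "(\<Oplus>\<^bsub>A\<^esub>j\<in>cell_index \<Lambda> M. ?d z j \<odot>\<^bsub>A\<^esub> cell_family D j)
      = (\<Oplus>\<^bsub>A\<^esub>j\<in>cell_index \<Lambda> M. ?d w j \<odot>\<^bsub>A\<^esub> cell_family D j)"
    using w dual.coordinate_closed dual.basis_closed by (intro M.finsum_cong') auto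
  thus ?thesis
    using z w by (simp add: dual.coordinate_expansion)
qed

text \<open>Every linear functional is of the form \<open>a \<mapsto> \<tau>(a u)\<close>; if it is symmetric, then \<open>u\<close> is central, by
  \<open>functional_represented_central\<close>.\<close>

lemma functional_representable:
  assumes closed: "\<And>a. a \<in> carrier A \<Longrightarrow> g a \<in> carrier R"
    and add: "\<And>a b. \<lbrakk>a \<in> carrier A; b \<in> carrier A\<rbrakk> \<Longrightarrow> g (a \<oplus>\<^bsub>A\<^esub> b) = g a \<oplus> g b"
    and smult: "\<And>r a. \<lbrakk>r \<in> carrier R; a \<in> carrier A\<rbrakk> \<Longrightarrow> g (r \<odot>\<^bsub>A\<^esub> a) = r \<otimes> g a"
  shows "\<exists>u\<in>carrier A. \<forall>a\<in>carrier A. g a = \<tau> (a \<otimes>\<^bsub>A\<^esub> u)"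
proof -
  define u where "u = (\<Oplus>\<^bsub>A\<^esub>j\<in>cell_index \<Lambda> M. g (cell_family C j) \<odot>\<^bsub>A\<^esub> cell_family D j)"
  have gC: "g (cell_family C j) \<in> carrier R" if "j \<in> cell_index \<Lambda> M" for j
    using closed cell.basis_closed[OF that] by simp
  have u: "u \<in> carrier A"
    unfolding u_def using gC dual.basis_closed by (intro M.finsum_closed) auto
  have C: "\<tau> (C l S T \<otimes>\<^bsub>A\<^esub> u) = g (C l S T)" if "l \<in> \<Lambda>" "S \<in> M l" "T \<in> M l" for l S T
    using that u gC tr_C_mult[of u l S T]
      dual.coordinate_finsum_basis[of "\<lambda>j. g (cell_family C j)" "(l, S, T)"]
    by (auto simp: u_def)
  have "g a = \<tau> (a \<otimes>\<^bsub>A\<^esub> u)" if "a \<in> carrier A" for a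
    by (rule linear_functional_eqI[where g = g and h = "\<lambda>a. \<tau> (a \<otimes>\<^bsub>A\<^esub> u)"])
       (use assms that u C in \<open>simp_all add: l_distr tr_add smult_mult_left tr_smult\<close>)
  thus ?thesis
    using u by blast
qed

lemma functional_represented_central:
  assumes u: "u \<in> carrier A"
    and comm: "\<And>a b. \<lbrakk>a \<in> carrier A; b \<in> carrier A\<rbrakk> \<Longrightarrow>
      \<tau> ((a \<otimes>\<^bsub>A\<^esub> b) \<otimes>\<^bsub>A\<^esub> u) = \<tau> ((b \<otimes>\<^bsub>A\<^esub> a) \<otimes>\<^bsub>A\<^esub> u)"
  shows "u \<in> alg_center A"
proof -
  have "u \<otimes>\<^bsub>A\<^esub> b = b \<otimes>\<^bsub>A\<^esub> u" if b: "b \<in> carrier A" for b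
  proof (rule tr_eqI)
    fix a assume a: "a \<in> carrier A"
    have "\<tau> (a \<otimes>\<^bsub>A\<^esub> (u \<otimes>\<^bsub>A\<^esub> b)) = \<tau> ((a \<otimes>\<^bsub>A\<^esub> u) \<otimes>\<^bsub>A\<^esub> b)"
      using a b u by (simp add: m_assoc)
    also have "\<dots> = \<tau> (b \<otimes>\<^bsub>A\<^esub> (a \<otimes>\<^bsub>A\<^esub> u))"
      using a b u by (intro tr_comm) auto
    also have "\<dots> = \<tau> ((b \<otimes>\<^bsub>A\<^esub> a) \<otimes>\<^bsub>A\<^esub> u)"
      using a b u by (simp add: m_assoc)
    also have "\<dots> = \<tau> ((a \<otimes>\<^bsub>A\<^esub> b) \<otimes>\<^bsub>A\<^esub> u)"
      using comm a b by simp
    finally show "\<tau> (a \<otimes>\<^bsub>A\<^esub> (u \<otimes>\<^bsub>A\<^esub> b)) = \<tau> (a \<otimes>\<^bsub>A\<^esub> (b \<otimes>\<^bsub>A\<^esub> u))"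
      using a b u by (simp add: m_assoc)
  qed (use u b in auto)
  thus ?thesis
    using u by (simp add: alg_center_def)
qed

lemma x_elt_at_closed: "\<lbrakk>l \<in> \<Lambda>; T \<in> M l\<rbrakk> \<Longrightarrow> x_elt_at A M C D l T \<in> carrier A"
  unfolding x_elt_at_def by (intro M.finsum_closed) auto

text \<open>The element \<open>x\<^sub>\<lambda>\<close> represents the cell character.\<close>

lemma tr_mult_x_elt_at:
  assumes a: "a \<in> carrier A" and l: "l \<in> \<Lambda>" "T \<in> M l"
  shows "\<tau> (a \<otimes>\<^bsub>A\<^esub> x_elt_at A M C D l T) = cell_char l a"
proof -
  have "a \<otimes>\<^bsub>A\<^esub> x_elt_at A M C D l T = (\<Oplus>\<^bsub>A\<^esub>S\<in>M l. a \<otimes>\<^bsub>A\<^esub> (C l S T \<otimes>\<^bsub>A\<^esub> D l S T))"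
    unfolding x_elt_at_def by (rule mult_finsum_left) (use a l finite_M in auto)
  also have "\<tau> \<dots> = (\<Oplus>S\<in>M l. \<tau> (a \<otimes>\<^bsub>A\<^esub> (C l S T \<otimes>\<^bsub>A\<^esub> D l S T)))"
    by (rule tr_finsum) (use a l finite_M in auto)
  also have "\<dots> = cell_char l a"
    unfolding cell_char_def
  proof (rule R.finsum_cong')
    fix S assume S: "S \<in> M l"
    have "\<tau> (a \<otimes>\<^bsub>A\<^esub> (C l S T \<otimes>\<^bsub>A\<^esub> D l S T)) = coef (a \<otimes>\<^bsub>A\<^esub> C l S T) l S T"
      using a l S by (simp add: m_assoc [symmetric] tr_mult_D)
    also have "\<dots> = cell_rep l a S S"
      using a l S by (simp add: coef_left_mult below_def)
    finally show "\<tau> (a \<otimes>\<^bsub>A\<^esub> (C l S T \<otimes>\<^bsub>A\<^esub> D l S T)) = cell_rep l a S S" .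
  qed (use a l in auto)
  finally show ?thesis .
qed

lemma x_elt_at_indep:
  assumes "l \<in> \<Lambda>" "T \<in> M l" "T' \<in> M l"
  shows "x_elt_at A M C D l T = x_elt_at A M C D l T'"
  by (rule tr_eqI) (use assms in \<open>auto simp: x_elt_at_closed tr_mult_x_elt_at\<close>)

abbreviation x :: "'l \<Rightarrow> 'a" where "x \<equiv> x_elt A M C D"

lemma x_closed [simp]: "l \<in> \<Lambda> \<Longrightarrow> x l \<in> carrier A"
  and tr_mult_x: "\<lbrakk>a \<in> carrier A; l \<in> \<Lambda>\<rbrakk> \<Longrightarrow> \<tau> (a \<otimes>\<^bsub>A\<^esub> x l) = cell_char l a"
  unfolding x_elt_def using nonempty_M
  by (simp_all add: x_elt_at_closed tr_mult_x_elt_at some_in_eq)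

lemma x_central: "l \<in> \<Lambda> \<Longrightarrow> x l \<in> alg_center A"
  by (rule functional_represented_central) (simp_all add: tr_mult_x cell_char_comm)

lemma central_mult_x:
  assumes z: "z \<in> alg_center A" and l: "l \<in> \<Lambda>"
  shows "\<exists>c\<in>carrier R. z \<otimes>\<^bsub>A\<^esub> x l = c \<odot>\<^bsub>A\<^esub> x l"
proof -
  obtain c where c: "c \<in> carrier R"
    "\<And>a. a \<in> carrier A \<Longrightarrow> cell_char l (a \<otimes>\<^bsub>A\<^esub> z) = c \<otimes> cell_char l a"
    using cell_char_central[OF z l] by auto
  have zc: "z \<in> carrier A"
    using z by (simp add: alg_center_def)
  have "z \<otimes>\<^bsub>A\<^esub> x l = c \<odot>\<^bsub>A\<^esub> x l"
  proof (rule tr_eqI)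
    fix a assume a: "a \<in> carrier A"
    have "\<tau> (a \<otimes>\<^bsub>A\<^esub> (z \<otimes>\<^bsub>A\<^esub> x l)) = cell_char l (a \<otimes>\<^bsub>A\<^esub> z)"
      using a zc l by (simp add: m_assoc [symmetric] tr_mult_x)
    also have "\<dots> = \<tau> (a \<otimes>\<^bsub>A\<^esub> (c \<odot>\<^bsub>A\<^esub> x l))"
      using a c l by (simp add: smult_mult_right tr_smult tr_mult_x)
    finally show "\<tau> (a \<otimes>\<^bsub>A\<^esub> (z \<otimes>\<^bsub>A\<^esub> x l)) = \<tau> (a \<otimes>\<^bsub>A\<^esub> (c \<odot>\<^bsub>A\<^esub> x l))" .
  qed (use zc c l in auto)
  thus ?thesis
    using c(1) by blast
qed

abbreviation L :: "'a set" where "L \<equiv> L_ideal R A \<Lambda> M C D"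

lemma L_submodule: "submodule L R A"
  unfolding L_ideal_def by (rule lin_span_submodule) (auto simp: finite_poset)

lemma x_in_L: "l \<in> \<Lambda> \<Longrightarrow> x l \<in> L"
  unfolding L_ideal_def by (rule lin_span_base) (auto simp: finite_poset)

lemma L_subset_center: "L \<subseteq> alg_center A"
  unfolding L_ideal_def by (intro lin_span_least center_submodule x_central)

lemma central_mult_L:
  assumes z: "z \<in> alg_center A" and w: "w \<in> L"
  shows "z \<otimes>\<^bsub>A\<^esub> w \<in> L"
proof -
  have zc: "z \<in> carrier A"
    using z by (simp add: alg_center_def)
  have "lin_span R A \<Lambda> x \<subseteq> {w \<in> carrier A. z \<otimes>\<^bsub>A\<^esub> w \<in> L}"
  proof (rule lin_span_least)
    fix l assume l: "l \<in> \<Lambda>"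
    then obtain c where "c \<in> carrier R" "z \<otimes>\<^bsub>A\<^esub> x l = c \<odot>\<^bsub>A\<^esub> x l"
      using central_mult_x[OF z] by auto
    thus "x l \<in> {w \<in> carrier A. z \<otimes>\<^bsub>A\<^esub> w \<in> L}"
      using l x_in_L submoduleE(4)[OF L_submodule] by auto
  qed (intro submodule_left_mult L_submodule zc)
  thus ?thesis
    using w unfolding L_ideal_def by auto
qed

lemma L_is_ideal: "ideal L (A\<lparr>carrier := alg_center A\<rparr>)"
proof (rule idealI[OF center_ring])
  show "subgroup L (add_monoid (A\<lparr>carrier := alg_center A\<rparr>))"
  proof
    show "L \<subseteq> carrier (add_monoid (A\<lparr>carrier := alg_center A\<rparr>))"
      using L_subset_center by simp
    show "\<And>v w. \<lbrakk>v \<in> L; w \<in> L\<rbrakk> \<Longrightarrow> v \<otimes>\<^bsub>add_monoid (A\<lparr>carrier := alg_center A\<rparr>)\<^esub> w \<in> L"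
      using submoduleE(5)[OF L_submodule] by simp
    show "\<one>\<^bsub>add_monoid (A\<lparr>carrier := alg_center A\<rparr>)\<^esub> \<in> L"
      using submodule_zero[OF L_submodule] by simp
    fix w assume w: "w \<in> L"
    have Z: "w \<in> alg_center A" "\<ominus>\<^bsub>A\<^esub> w \<in> alg_center A" "w \<in> carrier A"
      using w L_subset_center submoduleE(3)[OF center_submodule] by (auto simp: alg_center_def)
    interpret Z: ring "A\<lparr>carrier := alg_center A\<rparr>"
      by (rule center_ring)
    have "\<ominus>\<^bsub>A\<lparr>carrier := alg_center A\<rparr>\<^esub> w = \<ominus>\<^bsub>A\<^esub> w"
      by (rule Z.minus_equality) (use Z in \<open>auto simp: M.l_neg\<close>)
    thus "inv\<^bsub>add_monoid (A\<lparr>carrier := alg_center A\<rparr>)\<^esub> w \<in> L"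
      using submoduleE(3)[OF L_submodule w] by (simp add: a_inv_def)
  qed
  fix w z assume w: "w \<in> L" and z: "z \<in> carrier (A\<lparr>carrier := alg_center A\<rparr>)"
  show "z \<otimes>\<^bsub>A\<lparr>carrier := alg_center A\<rparr>\<^esub> w \<in> L"
    using central_mult_L w z by simp
  moreover have "w \<otimes>\<^bsub>A\<^esub> z = z \<otimes>\<^bsub>A\<^esub> w"
    using w z L_subset_center by (auto simp: alg_center_def)
  ultimately show "w \<otimes>\<^bsub>A\<lparr>carrier := alg_center A\<rparr>\<^esub> z \<in> L"
    by simp
qed

lemma higman_element:
  assumes a: "a \<in> carrier A"
  shows "finsum A (\<lambda>(l, S, T). C l S T \<otimes>\<^bsub>A\<^esub> a \<otimes>\<^bsub>A\<^esub> D l S T) (cell_index \<Lambda> M)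
    = (\<Oplus>\<^bsub>A\<^esub>l\<in>\<Lambda>. cell_char l (\<iota> a) \<odot>\<^bsub>A\<^esub> x l)"
    (is "finsum A ?h _ = ?w")
proof (rule tr_eqI)
  have h: "?h \<in> cell_index \<Lambda> M \<rightarrow> carrier A"
    using a by auto
  thus "finsum A ?h (cell_index \<Lambda> M) \<in> carrier A"
    by (rule M.finsum_closed)
  show "?w \<in> carrier A"
    using a by (intro M.finsum_closed) auto
  fix b assume b: "b \<in> carrier A"
  have fin: "finite \<Lambda>" "\<And>l. l \<in> \<Lambda> \<Longrightarrow> finite (M l)"
    using finite_poset finite_M by auto
  let ?r = "\<lambda>l S T. cell_rep l b S S \<otimes> cell_rep l (\<iota> a) T T"
  have r: "?r l S T \<in> carrier R" if "l \<in> \<Lambda>" "S \<in> M l" "T \<in> M l" for l S T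
    using that a b by simp
  have "b \<otimes>\<^bsub>A\<^esub> finsum A ?h (cell_index \<Lambda> M) = (\<Oplus>\<^bsub>A\<^esub>j\<in>cell_index \<Lambda> M. b \<otimes>\<^bsub>A\<^esub> ?h j)"
    by (rule mult_finsum_left[OF cell_index_finite b h])
  also have "\<tau> \<dots> = (\<Oplus>j\<in>cell_index \<Lambda> M. \<tau> (b \<otimes>\<^bsub>A\<^esub> ?h j))"
    by (rule tr_finsum[OF cell_index_finite]) (use a b in auto)
  also have "\<dots> = (\<Oplus>j\<in>cell_index \<Lambda> M. case j of (l, p) \<Rightarrow> case p of (S, T) \<Rightarrow> ?r l S T)"
  proof (rule R.finsum_cong')
    fix j assume "j \<in> cell_index \<Lambda> M"
    then obtain l S T where j: "j = (l, S, T)" "l \<in> \<Lambda>" "S \<in> M l" "T \<in> M l"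
      by (cases j) auto
    have "\<tau> (b \<otimes>\<^bsub>A\<^esub> (C l S T \<otimes>\<^bsub>A\<^esub> a \<otimes>\<^bsub>A\<^esub> D l S T))
        = \<tau> ((b \<otimes>\<^bsub>A\<^esub> (C l S T \<otimes>\<^bsub>A\<^esub> a)) \<otimes>\<^bsub>A\<^esub> D l S T)"
      using j a b by (simp add: m_assoc)
    also have "\<dots> = ?r l S T"
      using j a b by (simp only: tr_mult_D coef_two_sided_diagonal m_closed C_closed)
    finally show "\<tau> (b \<otimes>\<^bsub>A\<^esub> ?h j) = (case j of (l, p) \<Rightarrow> case p of (S, T) \<Rightarrow> ?r l S T)"
      using j by simp
  qed (use r in auto)
  also have "\<dots> = (\<Oplus>l\<in>\<Lambda>. \<Oplus>p\<in>M l \<times> M l. case p of (S, T) \<Rightarrow> ?r l S T)"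
    unfolding cell_index_def by (rule R.finsum_Sigma) (use fin r in auto)
  also have "\<dots> = (\<Oplus>l\<in>\<Lambda>. cell_char l (\<iota> a) \<otimes> cell_char l b)"
  proof (rule R.finsum_cong')
    fix l assume l: "l \<in> \<Lambda>"
    have "(\<Oplus>p\<in>M l \<times> M l. case p of (S, T) \<Rightarrow> ?r l S T) = (\<Oplus>S\<in>M l. \<Oplus>T\<in>M l. ?r l S T)"
      by (rule R.finsum_Sigma) (use fin l r in auto)
    also have "\<dots> = (\<Oplus>S\<in>M l. cell_rep l b S S \<otimes> cell_char l (\<iota> a))"
      unfolding cell_char_def using l a b fin
      by (intro R.finsum_cong' R.finsum_rdistr [symmetric])
         (auto intro!: R.m_closed R.finsum_closed)
    also have "\<dots> = cell_char l b \<otimes> cell_char l (\<iota> a)"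
      unfolding cell_char_def[of l b] using l a b fin
      by (intro R.finsum_ldistr [symmetric]) auto
    finally show "(\<Oplus>p\<in>M l \<times> M l. case p of (S, T) \<Rightarrow> ?r l S T)
        = cell_char l (\<iota> a) \<otimes> cell_char l b"
      using l a b by (simp add: R.m_comm)
  qed (use a b in auto)
  also have "\<dots> = (\<Oplus>l\<in>\<Lambda>. \<tau> (b \<otimes>\<^bsub>A\<^esub> (cell_char l (\<iota> a) \<odot>\<^bsub>A\<^esub> x l)))"
    using a b by (intro R.finsum_cong') (auto simp: smult_mult_right tr_smult tr_mult_x)
  also have "\<dots> = \<tau> (\<Oplus>\<^bsub>A\<^esub>l\<in>\<Lambda>. b \<otimes>\<^bsub>A\<^esub> (cell_char l (\<iota> a) \<odot>\<^bsub>A\<^esub> x l))"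
    by (rule tr_finsum [symmetric]) (use a b fin in auto)
  also have "(\<Oplus>\<^bsub>A\<^esub>l\<in>\<Lambda>. b \<otimes>\<^bsub>A\<^esub> (cell_char l (\<iota> a) \<odot>\<^bsub>A\<^esub> x l)) = b \<otimes>\<^bsub>A\<^esub> ?w"
    by (rule mult_finsum_left [symmetric]) (use a b fin in auto)
  finally show "\<tau> (b \<otimes>\<^bsub>A\<^esub> finsum A ?h (cell_index \<Lambda> M)) = \<tau> (b \<otimes>\<^bsub>A\<^esub> ?w)" .
qed

lemma higman_subset_L: "higman_ideal A \<Lambda> M C D \<subseteq> L"
proof
  fix w assume "w \<in> higman_ideal A \<Lambda> M C D"
  then obtain a where a: "a \<in> carrier A"
    and w: "w = finsum A (\<lambda>(l, S, T). C l S T \<otimes>\<^bsub>A\<^esub> a \<otimes>\<^bsub>A\<^esub> D l S T) (cell_index \<Lambda> M)"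
    unfolding higman_ideal_def by auto
  show "w \<in> L"
    unfolding w higman_element[OF a] L_ideal_def using a by (intro lin_spanI) auto
qed

text \<open>Independence of the trace, in one direction; the two traces play symmetric roles.\<close>

lemma L_subset_of_trace:
  assumes "symmetric_cellular_algebra R A \<Lambda> po M C \<iota> \<tau>' D'"
  shows "L \<subseteq> L_ideal R A \<Lambda> M C D'"
proof -
  \<comment> \<open>The center and the ideal property do not refer to the trace, so \<open>u\<close> can be used on both sides.\<close>
  interpret other: symmetric_cellular_algebra R A \<Lambda> po M C \<iota> \<tau>' D'
    by fact
  obtain u where u: "u \<in> carrier A" "\<And>a. a \<in> carrier A \<Longrightarrow> \<tau>' a = \<tau> (a \<otimes>\<^bsub>A\<^esub> u)"
    using functional_representable[of \<tau>'] other.tr_add other.tr_smult by auto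
  have uz: "u \<in> alg_center A"
    using u(1) by (rule functional_represented_central)
      (simp add: u(2) [symmetric] other.tr_comm)
  have "x l \<in> L_ideal R A \<Lambda> M C D'" if l: "l \<in> \<Lambda>" for l
  proof -
    have "x l = u \<otimes>\<^bsub>A\<^esub> other.x l"
    proof (rule tr_eqI)
      fix a assume a: "a \<in> carrier A"
      have "\<tau> (a \<otimes>\<^bsub>A\<^esub> x l) = \<tau>' (a \<otimes>\<^bsub>A\<^esub> other.x l)"
        using a l by (simp add: tr_mult_x other.tr_mult_x)
      also have "\<dots> = \<tau> (a \<otimes>\<^bsub>A\<^esub> (other.x l \<otimes>\<^bsub>A\<^esub> u))"
        using a l u by (simp add: m_assoc)
      also have "other.x l \<otimes>\<^bsub>A\<^esub> u = u \<otimes>\<^bsub>A\<^esub> other.x l"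
        using uz l by (simp add: alg_center_def)
      finally show "\<tau> (a \<otimes>\<^bsub>A\<^esub> x l) = \<tau> (a \<otimes>\<^bsub>A\<^esub> (u \<otimes>\<^bsub>A\<^esub> other.x l))" .
    qed (use l u in auto)
    thus ?thesis
      using other.central_mult_L[OF uz other.x_in_L[OF l]] by simp
  qed
  thus ?thesis
    unfolding L_ideal_def[of R A \<Lambda> M C D]
    by (intro lin_span_least other.L_submodule)
qed

end


section \<open>Simple modules\<close>

context left_module
begin

lemma act_zero_left [simp]:
  assumes "v \<in> carrier V"
  shows "\<zero> \<odot>\<^bsub>V\<^esub> v = \<zero>\<^bsub>V\<^esub>"
proof -
  have "\<zero> \<odot>\<^bsub>V\<^esub> v \<oplus>\<^bsub>V\<^esub> \<zero> \<odot>\<^bsub>V\<^esub> v = \<zero> \<odot>\<^bsub>V\<^esub> v"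
    using act_l_distr[of \<zero> \<zero> v] assms by simp
  thus ?thesis
    using act_closed[of \<zero> v] assms by simp
qed

lemma act_zero_right [simp]:
  assumes "a \<in> carrier A"
  shows "a \<odot>\<^bsub>V\<^esub> \<zero>\<^bsub>V\<^esub> = \<zero>\<^bsub>V\<^esub>"
proof -
  have "a \<odot>\<^bsub>V\<^esub> \<zero>\<^bsub>V\<^esub> \<oplus>\<^bsub>V\<^esub> a \<odot>\<^bsub>V\<^esub> \<zero>\<^bsub>V\<^esub> = a \<odot>\<^bsub>V\<^esub> \<zero>\<^bsub>V\<^esub>"
    using act_r_distr[of a "\<zero>\<^bsub>V\<^esub>" "\<zero>\<^bsub>V\<^esub>"] assms by simp
  thus ?thesis
    using act_closed[of a "\<zero>\<^bsub>V\<^esub>"] assms by simp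
qed

lemma act_minus:
  assumes "a \<in> carrier A" "v \<in> carrier V"
  shows "(\<ominus> a) \<odot>\<^bsub>V\<^esub> v = \<ominus>\<^bsub>V\<^esub> (a \<odot>\<^bsub>V\<^esub> v)"
proof (rule V.minus_equality [symmetric])
  show "(\<ominus> a) \<odot>\<^bsub>V\<^esub> v \<oplus>\<^bsub>V\<^esub> a \<odot>\<^bsub>V\<^esub> v = \<zero>\<^bsub>V\<^esub>"
    using assms act_l_distr[of "\<ominus> a" a v] by (simp add: A.l_neg)
qed (use assms act_closed in auto)

lemma act_eq_iff:
  assumes "a \<in> carrier A" "b \<in> carrier A" "v \<in> carrier V"
  shows "(a \<ominus> b) \<odot>\<^bsub>V\<^esub> v = \<zero>\<^bsub>V\<^esub> \<longleftrightarrow> a \<odot>\<^bsub>V\<^esub> v = b \<odot>\<^bsub>V\<^esub> v"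
proof -
  have closed: "a \<odot>\<^bsub>V\<^esub> v \<in> carrier V" "b \<odot>\<^bsub>V\<^esub> v \<in> carrier V" "(a \<ominus> b) \<odot>\<^bsub>V\<^esub> v \<in> carrier V"
    using assms by (auto intro!: act_closed)
  have "(a \<ominus> b) \<odot>\<^bsub>V\<^esub> v \<oplus>\<^bsub>V\<^esub> b \<odot>\<^bsub>V\<^esub> v = ((a \<ominus> b) \<oplus> b) \<odot>\<^bsub>V\<^esub> v"
    using assms by (simp add: act_l_distr)
  also have "(a \<ominus> b) \<oplus> b = a"
    using assms by (simp add: A.minus_eq A.a_assoc A.l_neg)
  finally have sum: "(a \<ominus> b) \<odot>\<^bsub>V\<^esub> v \<oplus>\<^bsub>V\<^esub> b \<odot>\<^bsub>V\<^esub> v = a \<odot>\<^bsub>V\<^esub> v" .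
  show ?thesis
    unfolding sum [symmetric] using closed by simp
qed

end

lemma simple_module_cyclic:
  assumes simple: "simple_module A V" and w: "w \<in> carrier V" "w \<noteq> \<zero>\<^bsub>V\<^esub>" and v: "v \<in> carrier V"
  obtains a where "a \<in> carrier A" "v = a \<odot>\<^bsub>V\<^esub> w"
proof -
  interpret left_module A V
    using simple unfolding simple_module_def by blast
  define H where "H = (\<lambda>a. a \<odot>\<^bsub>V\<^esub> w) ` carrier A"
  have "submodule H A V"
  proof (intro submodule.intro V.add.subgroupI submodule_axioms.intro)
    show "H \<subseteq> carrier V" "H \<noteq> {}"
      using w by (auto simp: H_def act_closed)
    show "\<ominus>\<^bsub>V\<^esub> y \<in> H" if "y \<in> H" for y
      using that w by (auto simp: H_def act_minus [symmetric])
    show "y \<oplus>\<^bsub>V\<^esub> z \<in> H" if "y \<in> H" "z \<in> H" for y z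
      using that w by (auto simp: H_def act_l_distr [symmetric])
    show "a \<odot>\<^bsub>V\<^esub> y \<in> H" if "a \<in> carrier A" "y \<in> H" for a y
      using that w by (auto simp: H_def act_assoc [symmetric])
  qed
  moreover have "w \<in> H"
    unfolding H_def using w act_one by (intro image_eqI[of _ _ "\<one>\<^bsub>A\<^esub>"]) auto
  ultimately have "H = carrier V"
    using simple w(2) unfolding simple_module_def by blast
  thus ?thesis
    using v that by (auto simp: H_def)
qed

text \<open>Both modules are the quotient of the regular module by the common annihilator.\<close>

lemma simple_module_isoI:
  assumes V: "simple_module A V" and W: "simple_module A W"
    and v: "v \<in> carrier V" "v \<noteq> \<zero>\<^bsub>V\<^esub>" and w: "w \<in> carrier W" "w \<noteq> \<zero>\<^bsub>W\<^esub>"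
    and ann: "\<And>a. a \<in> carrier A \<Longrightarrow> a \<odot>\<^bsub>V\<^esub> v = \<zero>\<^bsub>V\<^esub> \<longleftrightarrow> a \<odot>\<^bsub>W\<^esub> w = \<zero>\<^bsub>W\<^esub>"
  shows "module_iso A V W"
proof -
  interpret V: left_module A V
    using V unfolding simple_module_def by blast
  interpret W: left_module A W
    using W unfolding simple_module_def by blast
  have eq_iff: "a \<odot>\<^bsub>V\<^esub> v = b \<odot>\<^bsub>V\<^esub> v \<longleftrightarrow> a \<odot>\<^bsub>W\<^esub> w = b \<odot>\<^bsub>W\<^esub> w"
    if "a \<in> carrier A" "b \<in> carrier A" for a b
    using ann[of "a \<ominus>\<^bsub>A\<^esub> b"] that v(1) w(1) by (simp add: V.act_eq_iff W.act_eq_iff)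
  define h where "h = (\<lambda>y. (SOME a. a \<in> carrier A \<and> y = a \<odot>\<^bsub>V\<^esub> v) \<odot>\<^bsub>W\<^esub> w)"
  have h: "h (a \<odot>\<^bsub>V\<^esub> v) = a \<odot>\<^bsub>W\<^esub> w" if a: "a \<in> carrier A" for a
  proof -
    define b where "b = (SOME b. b \<in> carrier A \<and> a \<odot>\<^bsub>V\<^esub> v = b \<odot>\<^bsub>V\<^esub> v)"
    have "b \<in> carrier A \<and> a \<odot>\<^bsub>V\<^esub> v = b \<odot>\<^bsub>V\<^esub> v"
      unfolding b_def by (rule someI[of _ a]) (use a in simp)
    thus ?thesis
      using eq_iff[OF a, of b] by (simp add: h_def b_def)
  qed
  have "bij_betw h (carrier V) (carrier W)"
  proof (rule bij_betw_imageI)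
    show "inj_on h (carrier V)"
    proof (rule inj_onI)
      fix y z assume y: "y \<in> carrier V" and z: "z \<in> carrier V" and hyz: "h y = h z"
      obtain a where a: "a \<in> carrier A" "y = a \<odot>\<^bsub>V\<^esub> v"
        using simple_module_cyclic[OF V v y] by blast
      obtain b where b: "b \<in> carrier A" "z = b \<odot>\<^bsub>V\<^esub> v"
        using simple_module_cyclic[OF V v z] by blast
      show "y = z"
        using hyz h a b eq_iff by simp
    qed
    show "h ` carrier V = carrier W"
    proof (intro equalityI subsetI)
      fix y assume "y \<in> h ` carrier V"
      then obtain z where z: "z \<in> carrier V" "y = h z" by auto
      obtain a where "a \<in> carrier A" "z = a \<odot>\<^bsub>V\<^esub> v"
        using simple_module_cyclic[OF V v z(1)] by blast
      thus "y \<in> carrier W"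
        using z(2) h w(1) W.act_closed by simp
    next
      fix y assume y: "y \<in> carrier W"
      obtain a where a: "a \<in> carrier A" "y = a \<odot>\<^bsub>W\<^esub> w"
        using simple_module_cyclic[OF W w y] by blast
      thus "y \<in> h ` carrier V"
        using h[OF a(1)] V.act_closed[OF a(1) v(1)] by (metis imageI)
    qed
  qed
  moreover have "h (y \<oplus>\<^bsub>V\<^esub> z) = h y \<oplus>\<^bsub>W\<^esub> h z" if y: "y \<in> carrier V" and z: "z \<in> carrier V" for y z
  proof -
    obtain a where a: "a \<in> carrier A" "y = a \<odot>\<^bsub>V\<^esub> v"
      using simple_module_cyclic[OF V v y] by blast
    obtain b where b: "b \<in> carrier A" "z = b \<odot>\<^bsub>V\<^esub> v"
      using simple_module_cyclic[OF V v z] by blast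
    have "y \<oplus>\<^bsub>V\<^esub> z = (a \<oplus>\<^bsub>A\<^esub> b) \<odot>\<^bsub>V\<^esub> v"
      using a b v(1) by (simp add: V.act_l_distr)
    thus ?thesis
      using a b h w(1) by (simp add: W.act_l_distr)
  qed
  moreover have "h (a \<odot>\<^bsub>V\<^esub> y) = a \<odot>\<^bsub>W\<^esub> h y" if a: "a \<in> carrier A" and y: "y \<in> carrier V" for a y
  proof -
    obtain b where b: "b \<in> carrier A" "y = b \<odot>\<^bsub>V\<^esub> v"
      using simple_module_cyclic[OF V v y] by blast
    have "a \<odot>\<^bsub>V\<^esub> y = (a \<otimes>\<^bsub>A\<^esub> b) \<odot>\<^bsub>V\<^esub> v"
      using a b v(1) by (simp add: V.act_assoc)
    thus ?thesis
      using a b h w(1) by (simp add: W.act_assoc)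
  qed
  ultimately show ?thesis
    unfolding module_iso_def by blast
qed

lemma module_iso_trans:
  assumes "module_iso A U V" "module_iso A V W"
  shows "module_iso A U W"
proof -
  obtain h where h: "bij_betw h (carrier U) (carrier V)"
    "\<forall>v\<in>carrier U. \<forall>w\<in>carrier U. h (v \<oplus>\<^bsub>U\<^esub> w) = h v \<oplus>\<^bsub>V\<^esub> h w"
    "\<forall>a\<in>carrier A. \<forall>v\<in>carrier U. h (a \<odot>\<^bsub>U\<^esub> v) = a \<odot>\<^bsub>V\<^esub> h v"
    using assms(1) unfolding module_iso_def by blast
  obtain g where g: "bij_betw g (carrier V) (carrier W)"
    "\<forall>v\<in>carrier V. \<forall>w\<in>carrier V. g (v \<oplus>\<^bsub>V\<^esub> w) = g v \<oplus>\<^bsub>W\<^esub> g w"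
    "\<forall>a\<in>carrier A. \<forall>v\<in>carrier V. g (a \<odot>\<^bsub>V\<^esub> v) = a \<odot>\<^bsub>W\<^esub> g v"
    using assms(2) unfolding module_iso_def by blast
  have "h v \<in> carrier V" if "v \<in> carrier U" for v
    using h(1) that by (auto simp: bij_betw_def)
  thus ?thesis
    using bij_betw_trans[OF h(1) g(1)] h(2,3) g(2,3)
    unfolding module_iso_def by (intro exI[of _ "g \<circ> h"]) simp
qed

text \<open>Counting classes by an invariant \<open>f\<close> that separates nonisomorphic simple modules.  It need not be
  constant on isomorphism classes, since one representative of each class is picked.\<close>

lemma
  assumes f: "\<And>V. simple_module A V \<Longrightarrow> f V \<in> I" and "finite I"
    and iso: "\<And>V W :: ('a, 'm) module. \<lbrakk>simple_module A V; simple_module A W; f V = f W\<rbrakk> \<Longrightarrow> module_iso A V W"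
  shows finite_simple_module_classes: "finite (simple_module_classes A :: ('a, 'm) module set set)"
    and card_simple_module_classes_le:
      "card (simple_module_classes A :: ('a, 'm) module set set) \<le> card I"
proof -
  define r :: "('a, 'm) module rel" where
    "r = {(V, W). simple_module A V \<and> simple_module A W \<and> module_iso A V W}"
  define pick where "pick = (\<lambda>K. SOME V. simple_module A V \<and> K = r `` {V})"
  have pick: "simple_module A (pick K) \<and> K = r `` {pick K}" if "K \<in> simple_module_classes A" for K
  proof -
    have "\<exists>V. simple_module A V \<and> K = r `` {V}"
      using that unfolding simple_module_classes_def r_def by (auto elim!: quotientE)
    thus ?thesis
      unfolding pick_def by (rule someI_ex)
  qed
  have sub: "r `` {V} \<subseteq> r `` {W}" if "simple_module A V" "simple_module A W" "f V = f W" for V W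
    using iso[OF that(2,1)] that module_iso_trans unfolding r_def by auto
  have inj: "inj_on (\<lambda>K. f (pick K)) (simple_module_classes A)"
  proof (rule inj_onI)
    fix K K' :: "('a, 'm) module set"
    assume K: "K \<in> simple_module_classes A" and K': "K' \<in> simple_module_classes A"
      and eq: "f (pick K) = f (pick K')"
    have "r `` {pick K} = r `` {pick K'}"
      using sub[of "pick K" "pick K'"] sub[of "pick K'" "pick K"] pick[OF K] pick[OF K'] eq by simp
    thus "K = K'"
      using pick[OF K] pick[OF K'] by simp
  qed
  have img: "(\<lambda>K. f (pick K)) ` simple_module_classes A \<subseteq> I"
    using pick f by auto
  show "finite (simple_module_classes A :: ('a, 'm) module set set)"
    by (rule inj_on_finite[OF inj img \<open>finite I\<close>])
  show "card (simple_module_classes A :: ('a, 'm) module set set) \<le> card I"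
    by (rule card_inj_on_le[OF inj img \<open>finite I\<close>])
qed


section \<open>The cell of a simple module\<close>

context cellular_algebra
begin

lemma exists_minimal:
  assumes "N \<subseteq> \<Lambda>" "N \<noteq> {}"
  obtains l where "l \<in> N" "\<And>m. m \<in> N \<Longrightarrow> \<not> below m l"
proof -
  \<comment> \<open>The size of the down-set is a strictly monotone height function.\<close>
  define height where "height = (\<lambda>l. card {m \<in> \<Lambda>. (m, l) \<in> po})"
  obtain k where "k \<in> N"
    using assms(2) by auto
  then obtain l where l: "l \<in> N" "\<And>m. m \<in> N \<Longrightarrow> height l \<le> height m"
    using ex_has_least_nat[of "\<lambda>l. l \<in> N" k height] by auto
  have "\<not> below m l" if m: "m \<in> N" for m
  proof
    assume b: "below m l"
    have "{k \<in> \<Lambda>. (k, m) \<in> po} \<subset> {k \<in> \<Lambda>. (k, l) \<in> po}"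
      using b po_trans po_antisym po_refl[of l] l(1) assms(1) unfolding below_def by blast
    hence "height m < height l"
      unfolding height_def by (intro psubset_card_mono) (auto simp: finite_poset)
    thus False
      using l(2)[OF m] by simp
  qed
  thus ?thesis
    using that l(1) by blast
qed

text \<open>Left multiplication preserves the index \<open>V\<close> and right multiplication the index \<open>S\<close>, so only one
  coefficient survives outside \<open>A(<l)\<close>.\<close>

lemma C_mult_C_sandwich:
  assumes l: "l \<in> \<Lambda>" "S \<in> M l" "T \<in> M l" "U \<in> M l" "V \<in> M l" and a: "a \<in> carrier A"
  shows "C l S T \<otimes>\<^bsub>A\<^esub> (a \<otimes>\<^bsub>A\<^esub> C l U V) \<ominus>\<^bsub>A\<^esub>
    coef (C l S T \<otimes>\<^bsub>A\<^esub> (a \<otimes>\<^bsub>A\<^esub> C l U V)) l S V \<odot>\<^bsub>A\<^esub> C l S V \<in> lower_part l"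
proof (rule lowerI)
  let ?y = "C l S T \<otimes>\<^bsub>A\<^esub> (a \<otimes>\<^bsub>A\<^esub> C l U V)"
  fix m Q P assume m: "m \<in> \<Lambda>" "Q \<in> M m" "P \<in> M m" "\<not> below m l"
  have y: "?y = (C l S T \<otimes>\<^bsub>A\<^esub> a) \<otimes>\<^bsub>A\<^esub> C l U V"
    using l a by (simp add: m_assoc)
  have "coef ?y m Q P = \<zero>" if "m \<noteq> l \<or> Q \<noteq> S"
    using coef_right_mult[of "a \<otimes>\<^bsub>A\<^esub> C l U V" l S T m Q P] that l m a by auto
  moreover have "coef ?y m Q P = \<zero>" if "m \<noteq> l \<or> P \<noteq> V"
    unfolding y using coef_left_mult[of "C l S T \<otimes>\<^bsub>A\<^esub> a" l U V m Q P] that l m a by auto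
  ultimately have "coef ?y m Q P = coef (coef ?y l S V \<odot>\<^bsub>A\<^esub> C l S V) m Q P"
    using l m a by (auto simp: coef_smult coef_C)
  thus "coef (?y \<ominus>\<^bsub>A\<^esub> coef ?y l S V \<odot>\<^bsub>A\<^esub> C l S V) m Q P = \<zero>"
    using l m a by (simp add: coef_diff)
qed (use l a in auto)

text \<open>\<open>l\<close> is a minimal cell whose basis elements do not all annihilate \<open>V\<close>.\<close>

definition cell_type :: "('a, 'm, 'z) module_scheme \<Rightarrow> 'l \<Rightarrow> bool" where
  "cell_type V l \<longleftrightarrow> l \<in> \<Lambda> \<and>
     (\<exists>S\<in>M l. \<exists>T\<in>M l. \<exists>v\<in>carrier V. C l S T \<odot>\<^bsub>V\<^esub> v \<noteq> \<zero>\<^bsub>V\<^esub>) \<and>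
     (\<forall>m\<in>\<Lambda>. below m l \<longrightarrow> (\<forall>S\<in>M m. \<forall>T\<in>M m. \<forall>v\<in>carrier V. C m S T \<odot>\<^bsub>V\<^esub> v = \<zero>\<^bsub>V\<^esub>))"

text \<open>The set \<open>\<Lambda>\<^sub>0\<close> of the cells whose bilinear form is nonzero; its Gram matrix is
  \<open>cell_char l (C l S T)\<close>, by \<open>C_mult_C\<close>.\<close>

definition nonzero_cells :: "'l set" where
  "nonzero_cells = {l \<in> \<Lambda>. \<exists>S\<in>M l. \<exists>T\<in>M l. cell_char l (C l S T) \<noteq> \<zero>}"

end

text \<open>A left module over a cellular algebra; scalars \<open>r\<close> of \<open>R\<close> act on it through \<open>r \<odot> \<one>\<close>.\<close>

locale cellular_left_module = cellular_algebra R A \<Lambda> po M C \<iota> + V?: left_module A V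
  for R :: "('r, 'y) ring_scheme" (structure) and A :: "('r, 'a, 'x) module_scheme" (structure)
    and \<Lambda> :: "'l set" and po :: "'l rel" and M :: "'l \<Rightarrow> 's set"
    and C :: "'l \<Rightarrow> 's \<Rightarrow> 's \<Rightarrow> 'a" and \<iota> :: "'a \<Rightarrow> 'a" and V :: "('a, 'm, 'z) module_scheme"
begin

lemma act_smult:
  assumes "r \<in> carrier R" "a \<in> carrier A" "v \<in> carrier V"
  shows "(r \<odot>\<^bsub>A\<^esub> a) \<odot>\<^bsub>V\<^esub> v = (r \<odot>\<^bsub>A\<^esub> \<one>\<^bsub>A\<^esub>) \<odot>\<^bsub>V\<^esub> (a \<odot>\<^bsub>V\<^esub> v)"
  using assms act_assoc[of "r \<odot>\<^bsub>A\<^esub> \<one>\<^bsub>A\<^esub>" a v] by (simp add: smult_mult_left)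

lemma annihilator_submodule:
  assumes "v \<in> carrier V"
  shows "submodule {a \<in> carrier A. a \<odot>\<^bsub>V\<^esub> v = \<zero>\<^bsub>V\<^esub>} R A"
  by (rule submoduleI)
     (use assms in \<open>auto simp: act_minus act_l_distr act_smult\<close>)

lemma smult_act_eq_zero_iff:
  assumes "field R" "r \<in> carrier R" "a \<in> carrier A" "v \<in> carrier V"
  shows "(r \<odot>\<^bsub>A\<^esub> a) \<odot>\<^bsub>V\<^esub> v = \<zero>\<^bsub>V\<^esub> \<longleftrightarrow> r = \<zero> \<or> a \<odot>\<^bsub>V\<^esub> v = \<zero>\<^bsub>V\<^esub>"
proof (cases "r = \<zero>")
  case False
  interpret R: field R by fact
  have q: "inv r \<in> carrier R" "inv r \<otimes> r = \<one>"
    using False assms(2) R.field_Units by auto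
  have "a \<odot>\<^bsub>V\<^esub> v = (inv r \<odot>\<^bsub>A\<^esub> (r \<odot>\<^bsub>A\<^esub> a)) \<odot>\<^bsub>V\<^esub> v"
    using q assms by (simp add: smult_assoc1 [symmetric])
  also have "\<dots> = (inv r \<odot>\<^bsub>A\<^esub> \<one>\<^bsub>A\<^esub>) \<odot>\<^bsub>V\<^esub> ((r \<odot>\<^bsub>A\<^esub> a) \<odot>\<^bsub>V\<^esub> v)"
    using q assms by (intro act_smult) auto
  finally have "a \<odot>\<^bsub>V\<^esub> v = (inv r \<odot>\<^bsub>A\<^esub> \<one>\<^bsub>A\<^esub>) \<odot>\<^bsub>V\<^esub> ((r \<odot>\<^bsub>A\<^esub> a) \<odot>\<^bsub>V\<^esub> v)" .
  moreover have "(r \<odot>\<^bsub>A\<^esub> a) \<odot>\<^bsub>V\<^esub> v = (r \<odot>\<^bsub>A\<^esub> \<one>\<^bsub>A\<^esub>) \<odot>\<^bsub>V\<^esub> (a \<odot>\<^bsub>V\<^esub> v)"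
    using assms by (intro act_smult) auto
  ultimately show ?thesis
    using False q assms by auto
qed (use assms in simp)

lemma cell_type_exists:
  assumes nz: "carrier V \<noteq> {\<zero>\<^bsub>V\<^esub>}"
  shows "\<exists>l. cell_type V l"
proof -
  define N where "N = {l \<in> \<Lambda>. \<exists>S\<in>M l. \<exists>T\<in>M l. \<exists>v\<in>carrier V. C l S T \<odot>\<^bsub>V\<^esub> v \<noteq> \<zero>\<^bsub>V\<^esub>}"
  have "N \<noteq> {}"
  proof
    assume N: "N = {}"
    obtain v where v: "v \<in> carrier V" "v \<noteq> \<zero>\<^bsub>V\<^esub>"
      using nz V.zero_closed by blast
    have "lin_span R A (cell_index \<Lambda> M) (cell_family C) \<subseteq> {a \<in> carrier A. a \<odot>\<^bsub>V\<^esub> v = \<zero>\<^bsub>V\<^esub>}"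
      by (rule lin_span_least[OF annihilator_submodule[OF v(1)]])
         (use N v(1) in \<open>auto simp: N_def\<close>)
    hence "\<one>\<^bsub>A\<^esub> \<odot>\<^bsub>V\<^esub> v = \<zero>\<^bsub>V\<^esub>"
      using span_all[of "\<one>\<^bsub>A\<^esub>"] by auto
    thus False
      using v act_one by simp
  qed
  then obtain l where "l \<in> N" "\<And>m. m \<in> N \<Longrightarrow> \<not> below m l"
    using exists_minimal[of N] by (auto simp: N_def)
  thus ?thesis
    unfolding cell_type_def N_def by blast
qed

lemma lower_part_act:
  assumes type: "cell_type V l" and z: "z \<in> lower_part l" and v: "v \<in> carrier V"
  shows "z \<odot>\<^bsub>V\<^esub> v = \<zero>\<^bsub>V\<^esub>"
proof -
  have "lower_part l \<subseteq> {a \<in> carrier A. a \<odot>\<^bsub>V\<^esub> v = \<zero>\<^bsub>V\<^esub>}"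
    by (rule lower_subset[OF annihilator_submodule[OF v]])
       (use type v in \<open>auto simp: cell_type_def\<close>)
  thus ?thesis
    using z by auto
qed

lemma congruent_act:
  assumes type: "cell_type V l" and "a \<ominus>\<^bsub>A\<^esub> b \<in> lower_part l"
    and "a \<in> carrier A" "b \<in> carrier A" "v \<in> carrier V"
  shows "a \<odot>\<^bsub>V\<^esub> v = b \<odot>\<^bsub>V\<^esub> v"
  using lower_part_act[OF assms(1,2,5)] assms(3-5) by (simp add: act_eq_iff)

lemma C_act_C:
  assumes type: "cell_type V l" and l: "U \<in> M l" "P \<in> M l" "S \<in> M l" "T \<in> M l" and v: "v \<in> carrier V"
  shows "C l U P \<odot>\<^bsub>V\<^esub> (C l S T \<odot>\<^bsub>V\<^esub> v) = (cell_char l (C l S P) \<odot>\<^bsub>A\<^esub> C l U T) \<odot>\<^bsub>V\<^esub> v"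
proof -
  have L: "l \<in> \<Lambda>"
    using type by (simp add: cell_type_def)
  have "C l U P \<odot>\<^bsub>V\<^esub> (C l S T \<odot>\<^bsub>V\<^esub> v) = (C l U P \<otimes>\<^bsub>A\<^esub> C l S T) \<odot>\<^bsub>V\<^esub> v"
    using L l v by (simp add: act_assoc)
  also have "\<dots> = (cell_char l (C l S P) \<odot>\<^bsub>A\<^esub> C l U T) \<odot>\<^bsub>V\<^esub> v"
    using L l v C_mult_C[OF L l] by (intro congruent_act[OF type]) auto
  finally show ?thesis .
qed

text \<open>If the form vanished, then \<open>C l S T \<otimes> a \<otimes> C l S T\<close> would lie in \<open>A(<l)\<close> for all \<open>a\<close>; but some such
  element maps \<open>v\<close> to \<open>C l S T v \<noteq> 0\<close>, because the latter vector generates \<open>V\<close>.\<close>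

lemma cell_type_nonzero:
  assumes simple: "simple_module A V" and type: "cell_type V l"
  shows "l \<in> nonzero_cells"
proof (rule ccontr)
  have L: "l \<in> \<Lambda>"
    using type by (simp add: cell_type_def)
  assume "l \<notin> nonzero_cells"
  hence zero: "cell_char l (C l S T) = \<zero>" if "S \<in> M l" "T \<in> M l" for S T
    using that L by (auto simp: nonzero_cells_def)
  obtain S T v where ST: "S \<in> M l" "T \<in> M l" and v: "v \<in> carrier V" "C l S T \<odot>\<^bsub>V\<^esub> v \<noteq> \<zero>\<^bsub>V\<^esub>"
    using type unfolding cell_type_def by blast
  have Cv: "C l S T \<odot>\<^bsub>V\<^esub> v \<in> carrier V"
    using L ST v by (simp add: act_closed)
  obtain a where a: "a \<in> carrier A" "v = a \<odot>\<^bsub>V\<^esub> (C l S T \<odot>\<^bsub>V\<^esub> v)"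
    using simple_module_cyclic[OF simple Cv v(2) v(1)] by blast
  let ?K = "{y \<in> carrier A. C l S T \<otimes>\<^bsub>A\<^esub> y \<in> {a \<in> carrier A. a \<odot>\<^bsub>V\<^esub> v = \<zero>\<^bsub>V\<^esub>}}"
  have CK: "C l S' T \<in> ?K" if "S' \<in> M l" for S'
    using C_act_C[OF type ST that ST(2) v(1)] that L ST v zero by (simp add: act_assoc)
  have low: "lower_part l \<subseteq> ?K"
  proof
    fix y assume y: "y \<in> lower_part l"
    hence "y \<in> carrier A"
      using submoduleE(1)[OF lower_submodule] by auto
    thus "y \<in> ?K"
      using lower_part_act[OF type y v(1)] L ST v(1) by (simp add: act_assoc)
  qed
  have "a \<otimes>\<^bsub>A\<^esub> C l S T \<in> ?K"
    by (rule left_mult_mem[OF submodule_left_mult[OF annihilator_submodule] low L ST a(1) CK])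
       (use L ST v in auto)
  hence "C l S T \<odot>\<^bsub>V\<^esub> (a \<odot>\<^bsub>V\<^esub> (C l S T \<odot>\<^bsub>V\<^esub> v)) = \<zero>\<^bsub>V\<^esub>"
    using L ST v(1) a(1) by (simp add: act_assoc act_closed)
  thus False
    using a(2) v(2) by simp
qed

text \<open>A nonzero multiple of \<open>C l Q P\<close> acts on \<open>V\<close> as an idempotent; \<open>w\<close> is a nonzero vector in its image.\<close>

lemma exists_eigenvector:
  assumes field: "field R" and type: "cell_type V l" and QP: "Q \<in> M l" "P \<in> M l"
    and nz: "cell_char l (C l Q P) \<noteq> \<zero>"
  obtains w where "w \<in> carrier V" "w \<noteq> \<zero>\<^bsub>V\<^esub>"
    "C l Q P \<odot>\<^bsub>V\<^esub> w = (cell_char l (C l Q P) \<odot>\<^bsub>A\<^esub> \<one>\<^bsub>A\<^esub>) \<odot>\<^bsub>V\<^esub> w"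
proof -
  have L: "l \<in> \<Lambda>"
    using type by (simp add: cell_type_def)
  obtain S T v where ST: "S \<in> M l" "T \<in> M l" and v: "v \<in> carrier V" "C l S T \<odot>\<^bsub>V\<^esub> v \<noteq> \<zero>\<^bsub>V\<^esub>"
    using type unfolding cell_type_def by blast
  define w where "w = C l Q T \<odot>\<^bsub>V\<^esub> v"
  have w: "w \<in> carrier V"
    using L QP ST v by (simp add: w_def act_closed)
  have "C l S P \<odot>\<^bsub>V\<^esub> w = (cell_char l (C l Q P) \<odot>\<^bsub>A\<^esub> C l S T) \<odot>\<^bsub>V\<^esub> v"
    unfolding w_def by (rule C_act_C) (use type QP ST v in auto)
  hence "C l S P \<odot>\<^bsub>V\<^esub> w \<noteq> \<zero>\<^bsub>V\<^esub>"
    using smult_act_eq_zero_iff[OF field, of "cell_char l (C l Q P)" "C l S T" v] L QP ST v nz by simp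
  hence "w \<noteq> \<zero>\<^bsub>V\<^esub>"
    using L QP ST by auto
  moreover have "C l Q P \<odot>\<^bsub>V\<^esub> w = (cell_char l (C l Q P) \<odot>\<^bsub>A\<^esub> \<one>\<^bsub>A\<^esub>) \<odot>\<^bsub>V\<^esub> w"
    unfolding w_def using C_act_C[OF type QP QP(1) ST(2) v(1)] L QP ST v
      act_smult[of "cell_char l (C l Q P)" "C l Q T" v] by simp
  ultimately show ?thesis
    using that w by blast
qed

text \<open>The annihilator of the eigenvector does not involve \<open>V\<close>.  If \<open>C l Q T\<close> annihilates \<open>a w\<close> for all \<open>T\<close>,
  then \<open>a w = 0\<close>: otherwise \<open>a w\<close> generates \<open>V\<close>, and \<open>C l Q P\<close> would annihilate \<open>V\<close>.  And
  \<open>C l Q T \<otimes> a\<close> annihilates \<open>w\<close> if and only if \<open>C l Q T \<otimes> a \<otimes> C l Q P\<close> does, which is a scalar multiple of \<open>C l Q P\<close>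
  modulo \<open>A(<l)\<close>.\<close>

lemma eigenvector_annihilator:
  assumes field: "field R" and simple: "simple_module A V" and type: "cell_type V l"
    and QP: "Q \<in> M l" "P \<in> M l" and nz: "cell_char l (C l Q P) \<noteq> \<zero>"
    and w: "w \<in> carrier V" "w \<noteq> \<zero>\<^bsub>V\<^esub>"
    and eigen: "C l Q P \<odot>\<^bsub>V\<^esub> w = (cell_char l (C l Q P) \<odot>\<^bsub>A\<^esub> \<one>\<^bsub>A\<^esub>) \<odot>\<^bsub>V\<^esub> w"
    and a: "a \<in> carrier A"
  shows "a \<odot>\<^bsub>V\<^esub> w = \<zero>\<^bsub>V\<^esub> \<longleftrightarrow> (\<forall>T\<in>M l. coef (C l Q T \<otimes>\<^bsub>A\<^esub> (a \<otimes>\<^bsub>A\<^esub> C l Q P)) l Q P = \<zero>)"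
proof -
  have L: "l \<in> \<Lambda>"
    using type by (simp add: cell_type_def)
  define c where "c = cell_char l (C l Q P)"
  have c: "c \<in> carrier R" "c \<noteq> \<zero>"
    using L QP nz by (auto simp: c_def)
  have Cw: "C l Q P \<odot>\<^bsub>V\<^esub> w \<noteq> \<zero>\<^bsub>V\<^esub>"
    using smult_act_eq_zero_iff[OF field, of c "\<one>\<^bsub>A\<^esub>" w] eigen c w by (simp add: c_def act_one)
  have key: "C l Q T \<odot>\<^bsub>V\<^esub> (a \<odot>\<^bsub>V\<^esub> w) = \<zero>\<^bsub>V\<^esub> \<longleftrightarrow>
      coef (C l Q T \<otimes>\<^bsub>A\<^esub> (a \<otimes>\<^bsub>A\<^esub> C l Q P)) l Q P = \<zero>" if T: "T \<in> M l" for T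
  proof -
    let ?y = "C l Q T \<otimes>\<^bsub>A\<^esub> (a \<otimes>\<^bsub>A\<^esub> C l Q P)"
    have y: "?y \<in> carrier A"
      using L QP T a by simp
    have "?y \<odot>\<^bsub>V\<^esub> w = (C l Q T \<otimes>\<^bsub>A\<^esub> a) \<odot>\<^bsub>V\<^esub> (C l Q P \<odot>\<^bsub>V\<^esub> w)"
      using L QP T a w by (simp add: act_assoc act_closed)
    also have "\<dots> = (C l Q T \<otimes>\<^bsub>A\<^esub> a) \<odot>\<^bsub>V\<^esub> ((c \<odot>\<^bsub>A\<^esub> \<one>\<^bsub>A\<^esub>) \<odot>\<^bsub>V\<^esub> w)"
      using eigen by (simp add: c_def)
    also have "\<dots> = (c \<odot>\<^bsub>A\<^esub> (C l Q T \<otimes>\<^bsub>A\<^esub> a)) \<odot>\<^bsub>V\<^esub> w"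
      using L QP T a w c by (simp add: act_assoc [symmetric] smult_mult_right)
    finally have "?y \<odot>\<^bsub>V\<^esub> w = \<zero>\<^bsub>V\<^esub> \<longleftrightarrow> (C l Q T \<otimes>\<^bsub>A\<^esub> a) \<odot>\<^bsub>V\<^esub> w = \<zero>\<^bsub>V\<^esub>"
      using smult_act_eq_zero_iff[OF field, of c "C l Q T \<otimes>\<^bsub>A\<^esub> a" w] L QP T a w c by simp
    moreover have "?y \<odot>\<^bsub>V\<^esub> w = (coef ?y l Q P \<odot>\<^bsub>A\<^esub> C l Q P) \<odot>\<^bsub>V\<^esub> w"
      using L QP T a w C_mult_C_sandwich[OF L QP(1) T QP a] by (intro congruent_act[OF type]) auto
    moreover have "(coef ?y l Q P \<odot>\<^bsub>A\<^esub> C l Q P) \<odot>\<^bsub>V\<^esub> w = \<zero>\<^bsub>V\<^esub> \<longleftrightarrow> coef ?y l Q P = \<zero>"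
      using smult_act_eq_zero_iff[OF field, of "coef ?y l Q P" "C l Q P" w] L QP y w Cw by simp
    ultimately show ?thesis
      using L QP T a w by (simp add: act_assoc)
  qed
  have "a \<odot>\<^bsub>V\<^esub> w = \<zero>\<^bsub>V\<^esub>" if zero: "\<forall>T\<in>M l. C l Q T \<odot>\<^bsub>V\<^esub> (a \<odot>\<^bsub>V\<^esub> w) = \<zero>\<^bsub>V\<^esub>"
  proof (rule ccontr)
    let ?v = "a \<odot>\<^bsub>V\<^esub> w"
    assume nzv: "?v \<noteq> \<zero>\<^bsub>V\<^esub>"
    have v: "?v \<in> carrier V"
      using a w by (simp add: act_closed)
    obtain b where b: "b \<in> carrier A" "w = b \<odot>\<^bsub>V\<^esub> ?v"
      using simple_module_cyclic[OF simple v nzv w(1)] by blast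
    let ?K = "{x \<in> carrier A. x \<odot>\<^bsub>V\<^esub> ?v = \<zero>\<^bsub>V\<^esub>}"
    have low: "lower_part l \<subseteq> ?K"
      using lower_part_act[OF type _ v] submoduleE(1)[OF lower_submodule] by auto
    have "C l Q P \<otimes>\<^bsub>A\<^esub> b \<in> ?K"
      by (rule right_mult_mem[OF annihilator_submodule[OF v] low L QP b(1)])
         (use L QP zero in auto)
    hence "C l Q P \<odot>\<^bsub>V\<^esub> (b \<odot>\<^bsub>V\<^esub> ?v) = \<zero>\<^bsub>V\<^esub>"
      using L QP b(1) v by (simp add: act_assoc)
    thus False
      using b(2) Cw by simp
  qed
  moreover have "\<forall>T\<in>M l. C l Q T \<odot>\<^bsub>V\<^esub> (a \<odot>\<^bsub>V\<^esub> w) = \<zero>\<^bsub>V\<^esub>" if "a \<odot>\<^bsub>V\<^esub> w = \<zero>\<^bsub>V\<^esub>"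
    using that L QP by simp
  ultimately show ?thesis
    using key by blast
qed

end

context cellular_algebra
begin

lemma cellular_left_moduleI: "simple_module A V \<Longrightarrow> cellular_left_module R A \<Lambda> po M C \<iota> V"
  unfolding simple_module_def cellular_left_module_def
  using cellular_algebra_axioms by blast

lemma same_cell_type_iso:
  assumes field: "field R" and V: "simple_module A V" and W: "simple_module A W"
    and tV: "cell_type V l" and tW: "cell_type W l"
  shows "module_iso A V W"
proof -
  interpret V: cellular_left_module R A \<Lambda> po M C \<iota> V
    by (rule cellular_left_moduleI[OF V])
  interpret W: cellular_left_module R A \<Lambda> po M C \<iota> W
    by (rule cellular_left_moduleI[OF W])
  obtain Q P where QP: "Q \<in> M l" "P \<in> M l" "cell_char l (C l Q P) \<noteq> \<zero>"
    using V.cell_type_nonzero[OF V tV] unfolding nonzero_cells_def by blast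
  obtain v where v: "v \<in> carrier V" "v \<noteq> \<zero>\<^bsub>V\<^esub>"
    "C l Q P \<odot>\<^bsub>V\<^esub> v = (cell_char l (C l Q P) \<odot>\<^bsub>A\<^esub> \<one>\<^bsub>A\<^esub>) \<odot>\<^bsub>V\<^esub> v"
    using V.exists_eigenvector[OF field tV QP] by blast
  obtain w where w: "w \<in> carrier W" "w \<noteq> \<zero>\<^bsub>W\<^esub>"
    "C l Q P \<odot>\<^bsub>W\<^esub> w = (cell_char l (C l Q P) \<odot>\<^bsub>A\<^esub> \<one>\<^bsub>A\<^esub>) \<odot>\<^bsub>W\<^esub> w"
    using W.exists_eigenvector[OF field tW QP] by blast
  show ?thesis
    by (rule simple_module_isoI[OF V W v(1,2) w(1,2)])
       (simp add: V.eigenvector_annihilator[OF field V tV QP v]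
          W.eigenvector_annihilator[OF field W tW QP w])
qed

lemma
  assumes field: "field R"
  shows finite_simple_modules: "finite (simple_module_classes A :: ('a, 'm) module set set)"
    and card_simple_modules_le:
      "card (simple_module_classes A :: ('a, 'm) module set set) \<le> card nonzero_cells"
proof -
  define f :: "('a, 'm) module \<Rightarrow> 'l" where "f = (\<lambda>V. SOME l. cell_type V l)"
  have f: "cell_type V (f V)" if V: "simple_module A V" for V
  proof -
    interpret V: cellular_left_module R A \<Lambda> po M C \<iota> V
      by (rule cellular_left_moduleI[OF V])
    have "\<exists>l. cell_type V l"
      using V by (intro V.cell_type_exists) (simp add: simple_module_def)
    thus ?thesis
      unfolding f_def by (rule someI_ex)
  qed
  have mem: "f V \<in> nonzero_cells" if V: "simple_module A V" for V
    using cellular_left_module.cell_type_nonzero[OF cellular_left_moduleI[OF V] V f[OF V]] .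
  have fin: "finite nonzero_cells"
    by (rule finite_subset[of _ \<Lambda>]) (auto simp: nonzero_cells_def finite_poset)
  have iso: "module_iso A V W" if V: "simple_module A V" and W: "simple_module A W" and "f V = f W" for V W
    using same_cell_type_iso[OF field V W f[OF V]] f[OF W] that(3) by simp
  show "finite (simple_module_classes A :: ('a, 'm) module set set)"
    by (rule finite_simple_module_classes[OF mem fin iso])
  show "card (simple_module_classes A :: ('a, 'm) module set set) \<le> card nonzero_cells"
    by (rule card_simple_module_classes_le[OF mem fin iso])
qed

end


section \<open>Linear independence of the \<open>x\<^sub>\<lambda>\<close>\<close>

context symmetric_cellular_algebra
begin

lemma x_lin_indep:
  assumes "field R"
  shows "lin_indep R A nonzero_cells x"
  unfolding lin_indep_def
proof (intro ballI impI, rule ccontr)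
  interpret R: field R by fact
  have sub: "nonzero_cells \<subseteq> \<Lambda>"
    by (auto simp: nonzero_cells_def)
  have fin: "finite nonzero_cells"
    by (rule finite_subset[OF sub]) (simp add: finite_poset)
  fix c k assume c: "c \<in> nonzero_cells \<rightarrow> carrier R" and k: "k \<in> nonzero_cells" "c k \<noteq> \<zero>"
    and 0: "(\<Oplus>\<^bsub>A\<^esub>j\<in>nonzero_cells. c j \<odot>\<^bsub>A\<^esub> x j) = \<zero>\<^bsub>A\<^esub>"
  have cc: "c j \<in> carrier R" "x j \<in> carrier A" "j \<in> \<Lambda>" if "j \<in> nonzero_cells" for j
    using c sub that by auto
  \<comment> \<open>Evaluating at a basis element of a minimal cell in the support isolates one coefficient.\<close>
  obtain l where l: "l \<in> nonzero_cells" "c l \<noteq> \<zero>"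
    and min: "\<And>m. \<lbrakk>m \<in> nonzero_cells; c m \<noteq> \<zero>\<rbrakk> \<Longrightarrow> \<not> below m l"
  proof (rule exists_minimal)
    show "{l \<in> nonzero_cells. c l \<noteq> \<zero>} \<subseteq> \<Lambda>" "{l \<in> nonzero_cells. c l \<noteq> \<zero>} \<noteq> {}"
      using sub k by auto
  qed auto
  obtain S T where ST: "S \<in> M l" "T \<in> M l" "cell_char l (C l S T) \<noteq> \<zero>"
    using l(1) unfolding nonzero_cells_def by blast
  have L: "l \<in> \<Lambda>" using l sub by auto
  have C: "C l S T \<in> carrier A"
    using L ST by simp
  have "\<zero> = \<tau> (C l S T \<otimes>\<^bsub>A\<^esub> (\<Oplus>\<^bsub>A\<^esub>j\<in>nonzero_cells. c j \<odot>\<^bsub>A\<^esub> x j))"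
    unfolding 0 using C tr_smult[of \<zero> "\<zero>\<^bsub>A\<^esub>"] by simp
  also have "C l S T \<otimes>\<^bsub>A\<^esub> (\<Oplus>\<^bsub>A\<^esub>j\<in>nonzero_cells. c j \<odot>\<^bsub>A\<^esub> x j)
      = (\<Oplus>\<^bsub>A\<^esub>j\<in>nonzero_cells. C l S T \<otimes>\<^bsub>A\<^esub> (c j \<odot>\<^bsub>A\<^esub> x j))"
    by (rule mult_finsum_left[OF fin C]) (use cc in auto)
  also have "\<tau> \<dots> = (\<Oplus>j\<in>nonzero_cells. \<tau> (C l S T \<otimes>\<^bsub>A\<^esub> (c j \<odot>\<^bsub>A\<^esub> x j)))"
    by (rule tr_finsum[OF fin]) (use cc C in auto)
  also have "\<dots> = (\<Oplus>j\<in>nonzero_cells. c j \<otimes> cell_char j (C l S T))"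
    by (rule R.finsum_cong') (use cc C in \<open>auto simp: smult_mult_right tr_smult tr_mult_x\<close>)
  also have "\<dots> = c l \<otimes> cell_char l (C l S T)"
  proof (rule R.finsum_single[OF fin l(1)])
    fix j assume j: "j \<in> nonzero_cells" "j \<noteq> l"
    show "c j \<otimes> cell_char j (C l S T) = \<zero>"
    proof (cases "c j = \<zero>")
      case False
      hence "(j, l) \<notin> po"
        using min[OF j(1)] j(2) by (auto simp: below_def)
      thus ?thesis
        using cell_char_C_zero[OF cc(3)[OF j(1)] L ST(1,2)] cc j by simp
    qed (use cc[OF j(1)] C in simp)
  qed (use cc[OF l(1)] C in simp)
  finally show False
    using R.integral[of "c l" "cell_char l (C l S T)"] l(2) ST(3) cc[OF l(1)] C L
    by (metis cell_char_closed)
qed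

lemma card_nonzero_cells_le_vdim:
  assumes "field R"
  shows "card nonzero_cells \<le> vdim R A L"
proof -
  interpret vs: vector_space_over R A
    using assms module_axioms by (simp add: vector_space_over_def)
  have sub: "nonzero_cells \<subseteq> \<Lambda>"
    by (auto simp: nonzero_cells_def)
  show ?thesis
    unfolding L_ideal_def
  proof (rule vs.lin_indep_card_le_vdim)
    show "finite nonzero_cells"
      by (rule finite_subset[OF sub]) (simp add: finite_poset)
    show "x \<in> nonzero_cells \<rightarrow> lin_span R A \<Lambda> x"
      using sub x_in_L unfolding L_ideal_def by auto
  qed (use finite_poset x_lin_indep[OF assms] in auto)
qed

end

theorem theorem3p2:
  fixes R :: "('r, 'y) ring_scheme" and A :: "('r, 'a, 'x) module_scheme"
    and \<Lambda> :: "'l set" and po :: "'l rel" and M :: "'l \<Rightarrow> 's set"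
    and C D :: "'l \<Rightarrow> 's \<Rightarrow> 's \<Rightarrow> 'a" and \<iota> :: "'a \<Rightarrow> 'a" and \<tau> :: "'a \<Rightarrow> 'r"
  assumes "cring R"
    and "symmetric_algebra R A"
    and "cellular_algebra R A \<Lambda> po M C \<iota>"
    and "symmetrizing_trace R A \<tau>"
    and "dual_cell_basis R A \<Lambda> M C \<tau> D"
  shows
    "(\<forall>l\<in>\<Lambda>. \<forall>T\<in>M l. \<forall>T'\<in>M l. x_elt_at A M C D l T = x_elt_at A M C D l T') \<and>
     (ideal (L_ideal R A \<Lambda> M C D) (A\<lparr>carrier := alg_center A\<rparr>) \<and>
      higman_ideal A \<Lambda> M C D \<subseteq> L_ideal R A \<Lambda> M C D) \<and>
     (\<forall>\<tau>' D'. symmetrizing_trace R A \<tau>' \<and> dual_cell_basis R A \<Lambda> M C \<tau>' D' \<longrightarrow>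
        L_ideal R A \<Lambda> M C D' = L_ideal R A \<Lambda> M C D) \<and>
     (field R \<longrightarrow>
        finite (simple_module_classes A :: ('a, 'm) module set set) \<and>
        card (simple_module_classes A :: ('a, 'm) module set set) \<le> vdim R A (L_ideal R A \<Lambda> M C D))"
proof -
  interpret cellular_algebra R A \<Lambda> po M C \<iota>
    by fact
  have sca: "symmetric_cellular_algebra R A \<Lambda> po M C \<iota> \<tau>' D'"
    if "symmetrizing_trace R A \<tau>'" "dual_cell_basis R A \<Lambda> M C \<tau>' D'" for \<tau>' D'
    using that by unfold_locales
  interpret symmetric_cellular_algebra R A \<Lambda> po M C \<iota> \<tau> D
    by (rule sca) fact+
  have "\<forall>l\<in>\<Lambda>. \<forall>T\<in>M l. \<forall>T'\<in>M l. x_elt_at A M C D l T = x_elt_at A M C D l T'"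
    using x_elt_at_indep by blast
  moreover have "L_ideal R A \<Lambda> M C D' = L"
    if "symmetrizing_trace R A \<tau>'" "dual_cell_basis R A \<Lambda> M C \<tau>' D'" for \<tau>' D'
    using L_subset_of_trace[OF sca[OF that]]
      symmetric_cellular_algebra.L_subset_of_trace[OF sca[OF that] symmetric_cellular_algebra_axioms]
    by (rule antisym [rotated])
  moreover have "finite (simple_module_classes A :: ('a, 'm) module set set) \<and>
      card (simple_module_classes A :: ('a, 'm) module set set) \<le> vdim R A L" if "field R"
    using finite_simple_modules[OF that]
      order_trans[OF card_simple_modules_le[OF that] card_nonzero_cells_le_vdim[OF that]]
    by (rule conjI)
  ultimately show ?thesis
    using L_is_ideal higman_subset_L by blast
qed

end
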